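(* Let $r>0$, $\sigma>0$, $\mu\in\mathbb{R}$, $\nu=\frac{r-1}{2}$, $Z\sim\mathrm{SVG}(r,\sigma,\mu)$, and for a function $h:\mathbb{R}\to\mathbb{R}$ with $\mathbb{E}|h(Z)|<\infty$ let $f=f_h$ be the solution of the $\mathrm{SVG}(r,\sigma,\mu)$ Stein equation defined in the context. (a) If $h$ is bounded and measurable, then $$\|(x-\mu)f(x)\|\le\Big(\frac32+\frac1{2r}\Big)\|\tilde h\|,\quad \|(x-\mu)f'(x)\|\le\frac1\sigma\Big(1+\frac1{2r}\Big)\|\tilde h\|,\quad \|(x-\mu)f''(x)\|\le\frac1{2\sigma^2}\Big(9+\frac1r\Big)\|\tilde h\|.$$ (b) If $h$ is Lipschitz, then $$\|f\|\le\frac72\|h'\|,\quad \|f'\|\le\frac{9}{2\sigma}\Big(\frac1{r+1}+\frac{\pi\Gamma(\frac{r+1}{2})}{2\Gamma(\frac r2+1)}\Big)\|h'\|,\quad \|f''\|\le\frac{9}{\sigma^2(r+1)}\|h'\|,$$ and $$\|(x-\mu)f'(x)\|\le\frac92\Big(\frac32+\frac1{2(r+1)}\Big)\|h'\|,\quad \|(x-\mu)f''(x)\|\le\frac9{2\sigma}\Big(1+\frac1{2(r+1)}\Big)\|h'\|,$$ $$\|(x-\mu)f^{(3)}(x)\|\le\frac9{4\sigma^2}\Big(9+\frac1{r+1}\Big)\|h'\|.$$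
   Context: $\mathrm{SVG}(r,\sigma,\mu)$ ($r>0,\sigma>0,\mu\in\mathbb{R}$) is the distribution with density $p(x)=\frac{1}{\sigma\sqrt{\pi}\Gamma(r/2)}\big(\frac{|x-\mu|}{2\sigma}\big)^{\frac{r-1}{2}}K_{\frac{r-1}{2}}\big(\frac{|x-\mu|}{\sigma}\big)$, where $I_\nu(x)=\sum_{k\ge0}\frac{(x/2)^{\nu+2k}}{\Gamma(\nu+k+1)k!}$ and $K_\nu(x)=\int_0^\infty e^{-x\cosh t}\cosh(\nu t)\,dt$ are the modified Bessel functions of the first and second kind. Write $\tilde h(x)=h(x)-\mathbb{E}h(Z)$. The $\mathrm{SVG}(r,\sigma,\mu)$ Stein equation is $$\sigma^2(x-\mu)f''(x)+\sigma^2 r f'(x)-(x-\mu)f(x)=\tilde h(x),$$ and its solution $f_h$ is defined, with $y=x-\mu$ and $\nu=\frac{r-1}{2}$, by $$f_h(x)=-\frac{K_\nu(|y|/\sigma)}{\sigma^2|y|^\nu}\int_0^y|t|^\nu I_\nu(|t|/\sigma)\tilde h(t+\mu)\,dt-\frac{I_\nu(|y|/\sigma)}{\sigma^2|y|^\nu}\int_y^\infty|t|^\nu K_\nu(|t|/\sigma)\tilde h(t+\mu)\,dt.$$ $\|\cdot\|$ denotes the supremum norm over $\mathbb{R}$; for Lipschitz $h$, $\|h'\|$ denotes its Lipschitz constant (the sup norm of its a.e. derivative). Expressions such as $\|(x-\mu)f(x)\|$ denote the sup norm of the function $x\mapsto(x-\mu)f(x)$. *)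

theory Defs
  imports "HOL-Analysis.Analysis"
begin

text \<open>Modified Bessel function of the first kind (series definition; used for x > 0).\<close>
definition bessel_I :: "real \<Rightarrow> real \<Rightarrow> real" where
  "bessel_I \<nu> x = (\<Sum>k. (x / 2) powr (\<nu> + 2 * real k) / (Gamma (\<nu> + real k + 1) * fact k))"

definition bessel_K :: "real \<Rightarrow> real \<Rightarrow> real" where
  "bessel_K \<nu> x = (LINT t:{0..}|lborel. exp (- x * cosh t) * cosh (\<nu> * t))"

definition svg_pdf :: "real \<Rightarrow> real \<Rightarrow> real \<Rightarrow> real \<Rightarrow> real" where
  "svg_pdf r \<sigma> \<mu> x =
     1 / (\<sigma> * sqrt pi * Gamma (r / 2)) * (\<bar>x - \<mu>\<bar> / (2 * \<sigma>)) powr ((r - 1) / 2)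
       * bessel_K ((r - 1) / 2) (\<bar>x - \<mu>\<bar> / \<sigma>)"

definition svg_expect :: "real \<Rightarrow> real \<Rightarrow> real \<Rightarrow> (real \<Rightarrow> real) \<Rightarrow> real" where
  "svg_expect r \<sigma> \<mu> h = (LINT x|lborel. svg_pdf r \<sigma> \<mu> x * h x)"

text \<open>The defining formula of the Stein solution, valid for x \<noteq> mu.\<close>
definition svg_stein_formula :: "real \<Rightarrow> real \<Rightarrow> real \<Rightarrow> (real \<Rightarrow> real) \<Rightarrow> real \<Rightarrow> real" where
  "svg_stein_formula r \<sigma> \<mu> h x =
     (let y = x - \<mu>; \<nu> = (r - 1) / 2; ht = (\<lambda>t. h t - svg_expect r \<sigma> \<mu> h) in
      - (bessel_K \<nu> (\<bar>y\<bar> / \<sigma>) / (\<sigma>\<^sup>2 * \<bar>y\<bar> powr \<nu>))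
          * (LBINT t=ereal 0..ereal y. \<bar>t\<bar> powr \<nu> * bessel_I \<nu> (\<bar>t\<bar> / \<sigma>) * ht (t + \<mu>))
      - (bessel_I \<nu> (\<bar>y\<bar> / \<sigma>) / (\<sigma>\<^sup>2 * \<bar>y\<bar> powr \<nu>))
          * (LBINT t=ereal y..PInfty. \<bar>t\<bar> powr \<nu> * bessel_K \<nu> (\<bar>t\<bar> / \<sigma>) * ht (t + \<mu>)))"

definition svg_stein_sol :: "real \<Rightarrow> real \<Rightarrow> real \<Rightarrow> (real \<Rightarrow> real) \<Rightarrow> real \<Rightarrow> real" where
  "svg_stein_sol r \<sigma> \<mu> h x =
     (if x = \<mu> then Lim (at \<mu>) (svg_stein_formula r \<sigma> \<mu> h) else svg_stein_formula r \<sigma> \<mu> h x)"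

fun has_nth_deriv :: "(real \<Rightarrow> real) \<Rightarrow> nat \<Rightarrow> real \<Rightarrow> real \<Rightarrow> bool" where
  "has_nth_deriv f 0 x D = (D = f x)"
| "has_nth_deriv f (Suc n) x D =
     (\<exists>g. (\<forall>\<^sub>F t in nhds x. has_nth_deriv f n t (g t)) \<and> (g has_real_derivative D) (at x))"

end

theory Submission
  imports Defs
begin

text \<open>
  Put \<open>\<nu> = (r - 1) / 2\<close>. After centring and rescaling, both half-lines are treated alike: on \<open>x > 0\<close> the
  solution is \<open>G k = - b X - a Y\<close>, where \<open>a = x\<^sup>-\<^sup>\<nu> I\<^sub>\<nu>\<close> and \<open>b = x\<^sup>-\<^sup>\<nu> K\<^sub>\<nu>\<close> solve the homogeneous equation
  \<open>x u'' + r u' - x u = 0\<close> and \<open>X\<close>, \<open>Y\<close> are the integrals of \<open>t\<^sup>r\<^sup>-\<^sup>1 a k\<close> over \<open>(0, x]\<close> and of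
  \<open>t\<^sup>r\<^sup>-\<^sup>1 b k\<close> over \<open>(x, \<infinity>)\<close>. The left half-line uses that the centred test function has mean zero.

  The function \<open>E(x) = 1/2 \<integral>\<^sub>0\<^sup>1 v\<^sup>-\<^sup>1\<^sup>/\<^sup>2 (1 - v)\<^sup>r\<^sup>/\<^sup>2\<^sup>-\<^sup>1 exp (- x \<surd>v) dv\<close> solves
  \<open>x E'' + r E' - x E = - 1\<close>, so \<open>E = - G 1\<close>, and Lagrange's identity expresses the integrals
  \<open>P\<close> of \<open>t\<^sup>r\<^sup>-\<^sup>1 a\<close> and \<open>Q\<close> of \<open>t\<^sup>r\<^sup>-\<^sup>1 b\<close> through \<open>E\<close>; in particular the density has mass one and the mean absolute
  value of the standardised law is \<open>1 / E(0)\<close>. Part (a) then follows from the Wronskian, elementary monotonicity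
  bounds for \<open>P\<close> and \<open>Q\<close>, and \<open>x I\<^sub>\<nu>\<^sub>+\<^sub>1 K\<^sub>\<nu>\<^sub>+\<^sub>1 \<le> 1/2\<close>.

  For Lipschitz \<open>h\<close> one has \<open>|k(t)| \<le> \<lambda> (t + 1 / E(0))\<close>, and \<open>G\<close> maps \<open>t\<close> to the constant \<open>- 1\<close>, hence
  \<open>|f| \<le> 2 \<lambda>\<close>. The derivative \<open>f'\<close> solves the equation of order \<open>r + 1\<close> with right-hand side \<open>k' + f\<close>, so part (a)
  with \<open>r + 1\<close> bounds it and its derivatives; \<open>k\<close> is first made differentiable by averaging over short intervals.
\<close>

subsection \<open>Differentiation under the integral sign and the fundamental theorem of calculus\<close>

text \<open>A right-hand side \<open>k\<close> that is only bounded and measurable makes the two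
  integrals locally Lipschitz, but neither \<open>greenX\<close> nor \<open>greenY\<close> need be
  differentiable. Since \<open>a\<close> and \<open>b\<close> are nonnegative, the worst right-hand
  side of size one for \<open>G\<close> is the constant 1; hence \<open>E\<close> controls
  \<open>G\<close>. Second-order bounds come from solving the equation for its top term. In (a) this
  gives 4 = 1 + 2 + 1, from the right-hand side, \<open>r |G'|\<close> and \<open>x |G|\<close>. In
  (b) the differentiated equation has right-hand side at most 1 + 2 = 3 times the Lipschitz
  constant. Derivatives of the smoothed solutions are not known to converge, so the third-order
  bound is carried to the limit on increments. At the centre no formula for the derivatives is
  available, and bounds arrive there by the mean value theorem.\<close>

lemma laplace_deriv:
  fixes w c :: "real \<Rightarrow> real"
  assumes int: "\<And>x. x > 0 \<Longrightarrow> integrable M (\<lambda>t. w t * exp (- x * c t))"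
    and c: "\<And>t. w t \<noteq> 0 \<Longrightarrow> 0 \<le> c t"
    and [measurable]: "w \<in> borel_measurable M" "c \<in> borel_measurable M"
    and x: "x > 0"
  shows laplace_deriv_integrable: "integrable M (\<lambda>t. w t * c t * exp (- x * c t))"
    and has_real_derivative_laplace: "((\<lambda>x. \<integral>t. w t * exp (- x * c t) \<partial>M) has_real_derivative
        - (\<integral>t. w t * c t * exp (- x * c t) \<partial>M)) (at x)"
proof -
  have lin: "u \<le> exp u" for u :: real
    using exp_ge_add_one_self[of u] by linarith
  have e1: "\<bar>exp u - 1\<bar> \<le> \<bar>u\<bar> * exp \<bar>u\<bar>" for u :: real
  proof -
    have "exp u - 1 \<le> u * exp u"
      using mult_right_mono[OF exp_ge_add_one_self[of "-u"], of "exp u"]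
      by (simp add: algebra_simps flip: exp_add)
    moreover have "1 - exp u \<le> - u" using exp_ge_add_one_self[of u] by linarith
    moreover have "- u \<le> \<bar>u\<bar> * exp \<bar>u\<bar>"
      using mult_left_mono[of 1 "exp \<bar>u\<bar>" "\<bar>u\<bar>"] by auto
    moreover have "u * exp u \<le> \<bar>u\<bar> * exp \<bar>u\<bar>" by (intro mult_mono) auto
    ultimately show ?thesis by linarith
  qed
  have e2: "\<bar>exp u - 1 - u\<bar> \<le> u\<^sup>2 * exp \<bar>u\<bar>" for u :: real
  proof -
    have "exp u - 1 \<le> u * exp u"
      using mult_right_mono[OF exp_ge_add_one_self[of "-u"], of "exp u"]
      by (simp add: algebra_simps flip: exp_add)
    then have "exp u - 1 - u \<le> u * (exp u - 1)" by (simp add: algebra_simps)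
    also have "\<dots> \<le> \<bar>u\<bar> * \<bar>exp u - 1\<bar>" by (metis abs_mult abs_ge_self)
    also have "\<dots> \<le> \<bar>u\<bar> * (\<bar>u\<bar> * exp \<bar>u\<bar>)" by (intro mult_left_mono e1) auto
    finally show ?thesis using exp_ge_add_one_self[of u] by (simp add: power2_eq_square abs_mult algebra_simps)
  qed
  show *: "integrable M (\<lambda>t. w t * c t * exp (- x * c t))"
  proof (rule Bochner_Integration.integrable_bound)
    show "integrable M (\<lambda>t. 2 / x * (w t * exp (- (x / 2) * c t)))"
      using int[of "x/2"] x by (intro integrable_mult_right) simp
    show "AE t in M. norm (w t * c t * exp (- x * c t)) \<le> norm (2 / x * (w t * exp (- (x / 2) * c t)))"
    proof (rule AE_I2)
      fix t
      show "norm (w t * c t * exp (- x * c t)) \<le> norm (2 / x * (w t * exp (- (x / 2) * c t)))"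
      proof (cases "w t = 0")
        case False
        then have c0: "c t \<ge> 0" by (rule c)
        have "x / 2 * c t * exp (- x * c t) \<le> exp (x / 2 * c t) * exp (- x * c t)"
          by (intro mult_right_mono lin) auto
        also have "\<dots> = exp (- (x / 2) * c t)" by (simp add: field_simps flip: exp_add)
        finally have "c t * exp (- x * c t) \<le> 2 / x * exp (- (x / 2) * c t)"
          using x by (simp add: field_simps)
        from mult_left_mono[OF this, of "\<bar>w t\<bar>"] c0 x show ?thesis
          by (simp add: abs_mult algebra_simps)
      qed simp
    qed
  qed measurable
  let ?F = "\<lambda>x. \<integral>t. w t * exp (- x * c t) \<partial>M"
  let ?D = "\<integral>t. w t * c t * exp (- x * c t) \<partial>M"
  \<comment> \<open>The exponential budget: for \<open>|h| \<le> x / 2\<close> the quadratic Taylor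
    remainder costs \<open>exp (x / 2 * c t)\<close>, and absorbing \<open>(c t)^2\<close> costs
    another \<open>exp (x / 4 * c t)\<close> together with the factor \<open>(8 / x)^2\<close>. Out
    of \<open>exp (- x * c t)\<close> there remains \<open>exp (- (x / 4) * c t)\<close>, integrable
    by hypothesis at \<open>x / 4\<close>.\<close>
  define C where "C = (\<integral>t. 64 / x\<^sup>2 * \<bar>w t * exp (- (x / 4) * c t)\<bar> \<partial>M)"
  have bound: "\<bar>?F (x + h) - ?F x + h * ?D\<bar> \<le> h\<^sup>2 * C" if h: "\<bar>h\<bar> \<le> x / 2" "h \<noteq> 0" for h
  proof -
    have h': "x + h > 0" using h x by linarith
    let ?R = "\<lambda>t. w t * exp (- (x + h) * c t) - w t * exp (- x * c t) + h * (w t * c t * exp (- x * c t))"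
    have eq: "?F (x + h) - ?F x + h * ?D = (\<integral>t. w t * exp (- (x + h) * c t) - w t * exp (- x * c t) + h * (w t * c t * exp (- x * c t)) \<partial>M)"
      using int[OF h'] int[OF x] * by simp
    have le: "norm (\<integral>t. ?R t \<partial>M) \<le> (\<integral>t. h\<^sup>2 * (64 / x\<^sup>2 * \<bar>w t * exp (- (x / 4) * c t)\<bar>) \<partial>M)"
    proof (rule Bochner_Integration.integral_norm_bound_integral)
      show "integrable M (\<lambda>t. h\<^sup>2 * (64 / x\<^sup>2 * \<bar>w t * exp (- (x / 4) * c t)\<bar>))"
        using int[of "x/4"] x by (intro integrable_mult_right integrable_abs) simp
      show "integrable M (\<lambda>t. w t * exp (- (x + h) * c t) - w t * exp (- x * c t) + h * (w t * c t * exp (- x * c t)))"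
        using int[OF h'] int[OF x] * by (intro Bochner_Integration.integrable_add Bochner_Integration.integrable_diff integrable_mult_right)
      fix t
      show "norm (w t * exp (- (x + h) * c t) - w t * exp (- x * c t) + h * (w t * c t * exp (- x * c t)))
          \<le> h\<^sup>2 * (64 / x\<^sup>2 * \<bar>w t * exp (- (x / 4) * c t)\<bar>)"
      proof (cases "w t = 0")
        case False
        then have c0: "c t \<ge> 0" by (rule c)
        have "w t * exp (- (x + h) * c t) - w t * exp (- x * c t) + h * (w t * c t * exp (- x * c t))
            = w t * exp (- x * c t) * (exp (- h * c t) - 1 - (- h * c t))"
          by (simp add: algebra_simps flip: exp_add)
        also have "\<bar>\<dots>\<bar> = \<bar>w t\<bar> * exp (- x * c t) * \<bar>exp (- h * c t) - 1 - (- h * c t)\<bar>"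
          by (simp add: abs_mult)
        also have "\<dots> \<le> \<bar>w t\<bar> * exp (- x * c t) * ((- h * c t)\<^sup>2 * exp \<bar>- h * c t\<bar>)"
          by (intro mult_left_mono e2) auto
        also have "\<dots> \<le> \<bar>w t\<bar> * exp (- x * c t) * ((- h * c t)\<^sup>2 * exp (x / 2 * c t))"
        proof -
          have "\<bar>h\<bar> * c t \<le> x / 2 * c t" using h c0 by (intro mult_right_mono) auto
          then have "\<bar>- h * c t\<bar> \<le> x / 2 * c t" using c0 by (simp add: abs_mult)
          then show ?thesis by (intro mult_left_mono) auto
        qed
        also have "\<dots> = \<bar>w t\<bar> * h\<^sup>2 * ((c t)\<^sup>2 * exp (- (x / 2) * c t))"
        proof -
          have "exp (- x * c t) * exp (x / 2 * c t) = exp (- (x / 2) * c t)"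
            by (simp add: field_simps flip: exp_add)
          then show ?thesis by (simp add: power_mult_distrib ac_simps)
        qed
        also have "\<dots> \<le> \<bar>w t\<bar> * h\<^sup>2 * (64 / x\<^sup>2 * exp (- (x / 4) * c t))"
        proof (intro mult_left_mono)
          have "(x / 8 * c t)\<^sup>2 \<le> (exp (x / 8 * c t))\<^sup>2"
            using lin x c0 by (intro power_mono) auto
          also have "\<dots> = exp (x / 4 * c t)" by (simp flip: exp_double)
          finally have "(c t)\<^sup>2 \<le> 64 / x\<^sup>2 * exp (x / 4 * c t)" using x by (simp add: field_simps power2_eq_square)
          then have "(c t)\<^sup>2 * exp (- (x / 2) * c t) \<le> 64 / x\<^sup>2 * exp (x / 4 * c t) * exp (- (x / 2) * c t)"
            by (intro mult_right_mono) auto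
          also have "\<dots> = 64 / x\<^sup>2 * (exp (x / 4 * c t) * exp (- (x / 2) * c t))" by simp
          also have "exp (x / 4 * c t) * exp (- (x / 2) * c t) = exp (- (x / 4) * c t)"
            by (simp add: field_simps flip: exp_add)
          finally show "(c t)\<^sup>2 * exp (- (x / 2) * c t) \<le> 64 / x\<^sup>2 * exp (- (x / 4) * c t)" .
        qed auto
        also have "\<dots> = h\<^sup>2 * (64 / x\<^sup>2 * \<bar>w t * exp (- (x / 4) * c t)\<bar>)"
          by (simp only: abs_mult abs_exp_cancel ac_simps)
        finally show ?thesis by (simp only: real_norm_def)
      qed simp
    qed
    have C: "(\<integral>t. h\<^sup>2 * (64 / x\<^sup>2 * \<bar>w t * exp (- (x / 4) * c t)\<bar>) \<partial>M) = h\<^sup>2 * C"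
      unfolding C_def by (rule integral_mult_right_zero)
    show ?thesis using le unfolding C eq real_norm_def .
  qed
  have "((\<lambda>h. (?F (x + h) - ?F x) / h - (- ?D)) \<longlongrightarrow> 0) (at 0)"
  proof (rule Lim_null_comparison)
    show "((\<lambda>h. \<bar>h\<bar> * C) \<longlongrightarrow> 0) (at 0)" by (auto intro!: tendsto_eq_intros)
    have "\<forall>\<^sub>F h in at 0. \<bar>h\<bar> \<le> x / 2 \<and> h \<noteq> 0"
      unfolding eventually_at using x by (intro exI[of _ "x/2"]) (auto simp: dist_real_def)
    then show "\<forall>\<^sub>F h in at 0. norm ((?F (x + h) - ?F x) / h - (- ?D)) \<le> \<bar>h\<bar> * C"
    proof eventually_elim
      case (elim h)
      have "(?F (x + h) - ?F x) / h - (- ?D) = (?F (x + h) - ?F x + h * ?D) / h"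
        using elim by (simp add: field_simps)
      also have "norm \<dots> \<le> h\<^sup>2 * C / \<bar>h\<bar>"
        using bound[of h] elim by (auto simp: abs_divide intro!: divide_right_mono)
      also have "\<dots> = \<bar>h\<bar> * C" using elim by (simp add: field_simps power2_eq_square)
      finally show ?case .
    qed
  qed
  then show "(?F has_real_derivative - ?D) (at x)"
    unfolding DERIV_def by (rule LIM_zero_cancel)
qed

section \<open>Comparison of functions through derivatives and limits at an endpoint\<close>

lemma nondecreasing_ge_lim_at_right:
  fixes f f' :: "real \<Rightarrow> real"
  assumes "\<And>x. x > a \<Longrightarrow> (f has_real_derivative f' x) (at x)" "\<And>x. x > a \<Longrightarrow> f' x \<ge> 0"
    and "(f \<longlongrightarrow> l) (at_right a)" "x > a"
  shows "l \<le> f x"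
proof (rule tendsto_upperbound[OF assms(3)])
  show "\<forall>\<^sub>F t in at_right a. f t \<le> f x"
    using eventually_at_right_real[OF \<open>x > a\<close>]
  proof eventually_elim
    case (elim t)
    then show ?case
      by (intro DERIV_nonneg_imp_nondecreasing[of t x f]) (use assms in \<open>auto intro: less_le_trans\<close>)
  qed
qed simp

lemma nonincreasing_ge_lim_at_top:
  fixes f f' :: "real \<Rightarrow> real"
  assumes "\<And>x. x > a \<Longrightarrow> (f has_real_derivative f' x) (at x)" "\<And>x. x > a \<Longrightarrow> f' x \<le> 0"
    and "(f \<longlongrightarrow> l) at_top" "x > a"
  shows "l \<le> f x"
proof (rule tendsto_upperbound[OF assms(3)])
  show "\<forall>\<^sub>F t in at_top. f t \<le> f x"
    using eventually_gt_at_top[of x]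
  proof eventually_elim
    case (elim t)
    then show ?case
      by (intro DERIV_nonpos_imp_nonincreasing[of x t f]) (use assms in \<open>auto intro: less_le_trans\<close>)
  qed
qed simp

text \<open>Turns increment estimates into a bound for a derivative that is merely assumed to exist.
  The Lipschitz factor may depend on \<open>z\<close>, which is needed when it degenerates away from
  \<open>x\<close>.\<close>

lemma deriv_abs_le_limit:
  fixes f g :: "real \<Rightarrow> real"
  assumes D: "(f has_real_derivative D) (at x)" and g: "(g \<longlongrightarrow> M) (at x)"
    and le: "\<forall>\<^sub>F z in at x. \<bar>f z - f x\<bar> \<le> g z * \<bar>z - x\<bar>"
  shows "\<bar>D\<bar> \<le> M"
proof (rule tendsto_le[OF _ g])
  show "((\<lambda>z. \<bar>(f z - f x) / (z - x)\<bar>) \<longlongrightarrow> \<bar>D\<bar>) (at x)"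
    using D unfolding has_field_derivative_iff by (rule tendsto_rabs)
  show "\<forall>\<^sub>F z in at x. \<bar>(f z - f x) / (z - x)\<bar> \<le> g z"
    using le eventually_neq_at_within[of x x UNIV] by eventually_elim (simp add: abs_divide field_simps)
qed simp

lemma abs_le_of_deriv_at_right:
  fixes f g f' g' :: "real \<Rightarrow> real"
  assumes f: "\<And>x. x > a \<Longrightarrow> (f has_real_derivative f' x) (at x)" "(f \<longlongrightarrow> 0) (at_right a)"
    and g: "\<And>x. x > a \<Longrightarrow> (g has_real_derivative g' x) (at x)" "(g \<longlongrightarrow> 0) (at_right a)"
    and le: "\<And>x. x > a \<Longrightarrow> \<bar>f' x\<bar> \<le> g' x" and x: "x > a"
  shows "\<bar>f x\<bar> \<le> g x"
proof -
  have "0 \<le> g x - f x"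
    by (rule nondecreasing_ge_lim_at_right[where f = "\<lambda>x. g x - f x" and f' = "\<lambda>x. g' x - f' x", OF DERIV_diff[OF g(1) f(1)] _ _ x])
      (use tendsto_diff[OF g(2) f(2)] in simp_all, smt (verit) le)
  moreover have "0 \<le> g x + f x"
    by (rule nondecreasing_ge_lim_at_right[where f = "\<lambda>x. g x + f x" and f' = "\<lambda>x. g' x + f' x", OF DERIV_add[OF g(1) f(1)] _ _ x])
      (use tendsto_add[OF g(2) f(2)] in simp_all, smt (verit) le)
  ultimately show ?thesis by linarith
qed

lemma abs_le_of_deriv_at_top:
  fixes f g f' g' :: "real \<Rightarrow> real"
  assumes f: "\<And>x. x > a \<Longrightarrow> (f has_real_derivative f' x) (at x)" "(f \<longlongrightarrow> 0) at_top"
    and g: "\<And>x. x > a \<Longrightarrow> (g has_real_derivative - g' x) (at x)" "(g \<longlongrightarrow> 0) at_top"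
    and le: "\<And>x. x > a \<Longrightarrow> \<bar>f' x\<bar> \<le> g' x" and x: "x > a"
  shows "\<bar>f x\<bar> \<le> g x"
proof -
  have "0 \<le> g x - f x"
    by (rule nonincreasing_ge_lim_at_top[where f = "\<lambda>x. g x - f x" and f' = "\<lambda>x. - g' x - f' x", OF DERIV_diff[OF g(1) f(1)] _ _ x])
      (use tendsto_diff[OF g(2) f(2)] in simp_all, smt (verit) le)
  moreover have "0 \<le> g x + f x"
    by (rule nonincreasing_ge_lim_at_top[where f = "\<lambda>x. g x + f x" and f' = "\<lambda>x. - g' x + f' x", OF DERIV_add[OF g(1) f(1)] _ _ x])
      (use tendsto_add[OF g(2) f(2)] in simp_all, smt (verit) le)
  ultimately show ?thesis by linarith
qed

text \<open>Nonnegativity of \<open>f\<close> yields integrability up to 0, where \<open>f\<close>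
  may be unbounded; continuity of \<open>F\<close> at \<open>x\<close> closes the right end.\<close>

lemma set_integral_FTC_from_0:
  fixes F f :: "real \<Rightarrow> real"
  assumes "\<And>x. x > 0 \<Longrightarrow> (F has_real_derivative f x) (at x)" "\<And>x. x > 0 \<Longrightarrow> isCont f x"
    "\<And>x. x > 0 \<Longrightarrow> f x \<ge> 0" "(F \<longlongrightarrow> 0) (at_right 0)" "x > 0"
  shows "set_integrable lborel {0<..x} f" "(LINT t:{0<..x}|lborel. f t) = F x"
proof -
  have "isCont F x" using assms(1)[OF \<open>x > 0\<close>] by (rule DERIV_isCont)
  then have "(F \<longlongrightarrow> F x) (at_left x)" by (simp add: isCont_def filterlim_at_split)
  then have "set_integrable lborel (einterval (ereal 0) (ereal x)) f"
    and *: "(LBINT t=ereal 0..ereal x. f t) = F x - 0"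
    using assms by (intro interval_integral_FTC_nonneg; auto simp: ereal_tendsto_simps)+
  then have "set_integrable lborel {0<..<x} f" by simp
  moreover have "set_integrable lborel {x} f"
    using borel_integrable_compact[of "{x}" f]
    by (simp add: set_integrable_def indicator_def if_distrib)
  ultimately have "set_integrable lborel ({0<..<x} \<union> {x}) f"
    by (intro set_integrable_Un) auto
  moreover have "{0<..<x} \<union> {x} = {0<..x}" using \<open>x > 0\<close> by auto
  ultimately show "set_integrable lborel {0<..x} f" by simp
  show "(LINT t:{0<..x}|lborel. f t) = F x"
    using * \<open>x > 0\<close> by (simp add: interval_integral_Ioc)
qed

lemma set_integral_FTC_to_top:
  fixes F f :: "real \<Rightarrow> real"
  assumes "\<And>x. x > a \<Longrightarrow> (F has_real_derivative - f x) (at x)" "\<And>x. x > a \<Longrightarrow> isCont f x"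
    "\<And>x. x > a \<Longrightarrow> f x \<ge> 0" "(F \<longlongrightarrow> l) (at_right a)" "(F \<longlongrightarrow> 0) at_top"
  shows "set_integrable lborel {a<..} f" "(LINT t:{a<..}|lborel. f t) = l"
proof -
  have 1: "((\<lambda>x. - F x) has_real_derivative f x) (at x)" if "x > a" for x
    using assms(1)[OF that] by (auto intro!: derivative_eq_intros)
  have 2: "((\<lambda>x. - F x) \<longlongrightarrow> - l) (at_right a)" "((\<lambda>x. - F x) \<longlongrightarrow> 0) at_top"
    using assms(4) assms(5) by (auto intro!: tendsto_eq_intros)
  have "set_integrable lborel (einterval (ereal a) \<infinity>) f"
    "(LBINT t=ereal a..\<infinity>. f t) = 0 - (- l)"
    using assms 1 2 by (intro interval_integral_FTC_nonneg[where F = "\<lambda>x. - F x"]; auto simp: ereal_tendsto_simps)+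
  then show "set_integrable lborel {a<..} f" "(LINT t:{a<..}|lborel. f t) = l"
    by (simp_all add: interval_lebesgue_integral_def)
qed

subsection \<open>The modified Bessel function of the second kind\<close>

lemma set_integral_Ici_eq_Ioi:
  fixes f :: "real \<Rightarrow> real"
  assumes "f \<in> borel_measurable borel"
  shows "(LINT t:{a..}|lborel. f t) = (LINT t:{a<..}|lborel. f t)"
  unfolding set_lebesgue_integral_def
proof (rule integral_cong_AE)
  show "AE x in lborel. indicat_real {a..} x *\<^sub>R f x = indicat_real {a<..} x *\<^sub>R f x"
    using AE_lborel_singleton[of a] by eventually_elim (auto simp: indicator_def)
qed (use assms in auto)

lemma lborel_integral_split_reflect:
  fixes f :: "real \<Rightarrow> real"
  assumes f: "integrable lborel f"
  shows "set_integrable lborel {0<..} f" "set_integrable lborel {0<..} (\<lambda>t. f (- t))"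
    "(LINT t|lborel. f t) = (LINT t:{0<..}|lborel. f t) + (LINT t:{0<..}|lborel. f (- t))"
proof -
  have [measurable]: "f \<in> borel_measurable borel" using f by auto
  show 1: "set_integrable lborel {0<..} f"
    unfolding set_integrable_def using f by (intro integrable_mult_indicator) auto
  have 2: "integrable lborel (\<lambda>t. indicator {..<0} t * f t)"
    using integrable_mult_indicator[OF _ f, of "{..<0}"] by simp
  have eq: "indicator {..<0} (0 + (-1) * t) * f (0 + (-1) * t) = indicator {0<..} t *\<^sub>R f (- t)" for t :: real
    by (auto simp: indicator_def)
  show 3: "set_integrable lborel {0<..} (\<lambda>t. f (- t))"
    using lborel_integrable_real_affine[OF 2, of "-1" 0] unfolding eq set_integrable_def by simp
  have "(LINT t|lborel. f t) = (LINT t|lborel. indicator {0<..} t *\<^sub>R f t + indicator {..<0} t * f t)"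
  proof (rule integral_cong_AE)
    show "AE x in lborel. f x = indicat_real {0<..} x *\<^sub>R f x + indicat_real {..<0} x * f x"
      using AE_lborel_singleton[of 0] by eventually_elim (auto simp: indicator_def)
  qed auto
  also have "\<dots> = (LINT t:{0<..}|lborel. f t) + (LINT t|lborel. indicator {..<0} t * f t)"
    using 1 2 unfolding set_integrable_def set_lebesgue_integral_def by (subst Bochner_Integration.integral_add) auto
  also have "(LINT t|lborel. indicator {..<0} t * f t) = (LINT t:{0<..}|lborel. f (- t))"
    using lborel_integral_real_affine[of "-1" "\<lambda>t. indicator {..<0} t * f t" 0] unfolding eq set_lebesgue_integral_def by simp
  finally show "(LINT t|lborel. f t) = (LINT t:{0<..}|lborel. f t) + (LINT t:{0<..}|lborel. f (- t))" .
qed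

lemma set_integrable_exp_minus: "set_integrable lborel {0<..} (\<lambda>t::real. exp (- t))"
proof (rule set_integral_FTC_to_top(1)[where F = "\<lambda>t. exp (- t)" and l = 1])
  show "((\<lambda>t::real. exp (- t)) \<longlongrightarrow> 1) (at_right 0)"
    by (auto intro!: tendsto_eq_intros)
  show "((\<lambda>t::real. exp (- t)) \<longlongrightarrow> 0) at_top"
    by (rule filterlim_compose[OF exp_at_bot filterlim_uminus_at_bot_at_top])
qed (auto intro!: derivative_eq_intros continuous_intros)

lemma exp_cosh_bound:
  fixes x \<nu> :: real
  assumes x: "x > 0"
  obtains C where "\<And>t. t \<ge> 0 \<Longrightarrow> exp (- x * cosh t) * cosh (\<nu> * t) \<le> C * exp (- t)"
proof -
  \<comment> \<open>One unit more than
    \<open>cosh (\<nu> * t) \<le> exp (\<bar>\<nu>\<bar> * t)\<close> consumes, so that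
    \<open>exp (- t)\<close> is left over. The shift \<open>c\<close> solves
    \<open>x * exp c / 2 = n\<close>, whence
    \<open>x * cosh t \<ge> n * exp (t - c) \<ge> n * (1 + t - c)\<close>.\<close>
  define n where "n = \<bar>\<nu>\<bar> + 1"
  have n: "n > 0" unfolding n_def by simp
  define c where "c = ln (2 * n / x)"
  have ec: "exp c = 2 * n / x" unfolding c_def using n x by simp
  show thesis
  proof
    fix t :: real assume t: "t \<ge> 0"
    have "exp t / 2 \<le> cosh t" by (simp add: cosh_def)
    moreover have "exp t = exp c * exp (t - c)" by (simp flip: exp_add)
    moreover have "exp (t - c) \<ge> 1 + (t - c)" by (rule exp_ge_add_one_self)
    ultimately have "x * cosh t \<ge> x * (exp c * exp (t - c) / 2)" using x by (intro mult_left_mono) auto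
    also have "x * (exp c * exp (t - c) / 2) = n * exp (t - c)" unfolding ec using x by simp
    finally have "x * cosh t \<ge> n * (1 + (t - c))" using \<open>exp (t - c) \<ge> 1 + (t - c)\<close> n
      by (smt (verit) mult_left_mono)
    then have 1: "exp (- x * cosh t) \<le> exp (- n * (1 + (t - c)))" by simp
    have "cosh (\<nu> * t) \<le> exp (\<bar>\<nu>\<bar> * t)"
    proof -
      have "\<nu> * t \<le> \<bar>\<nu>\<bar> * t" "- (\<nu> * t) \<le> \<bar>\<nu>\<bar> * t" using t
        by (auto simp: mult_right_mono abs_if mult_nonneg_nonneg mult_nonpos_nonneg)
      then have "exp (\<nu> * t) \<le> exp (\<bar>\<nu>\<bar> * t)" "exp (- (\<nu> * t)) \<le> exp (\<bar>\<nu>\<bar> * t)"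
        by (auto simp only: exp_le_cancel_iff)
      moreover have "(A + B) / 2 \<le> C" if "A \<le> C" "B \<le> C" for A B C :: real using that by (simp add: field_simps)
      ultimately show ?thesis unfolding cosh_field_def by blast
    qed
    with 1 have "exp (- x * cosh t) * cosh (\<nu> * t) \<le> exp (- n * (1 + (t - c))) * exp (\<bar>\<nu>\<bar> * t)"
      by (intro mult_mono) auto
    also have "\<dots> = exp (- n * (1 - c)) * exp (- t)"
      unfolding n_def by (simp add: algebra_simps flip: exp_add)
    finally show "exp (- x * cosh t) * cosh (\<nu> * t) \<le> exp (- n * (1 - c)) * exp (- t)" .
  qed
qed

lemma cosh_borel_measurable [measurable]: "(cosh :: real \<Rightarrow> real) \<in> borel_measurable borel"
  by (intro borel_measurable_continuous_onI continuous_intros)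

lemma bessel_K_integrable:
  fixes x \<nu> :: real
  assumes "x > 0"
  shows "set_integrable lborel {0<..} (\<lambda>t. exp (- x * cosh t) * cosh (\<nu> * t))"
proof -
  from exp_cosh_bound[OF assms] obtain C where C: "\<And>t. t \<ge> 0 \<Longrightarrow> exp (- x * cosh t) * cosh (\<nu> * t) \<le> C * exp (- t)"
    by blast
  show ?thesis
  proof (rule set_integrable_bound)
    show "set_integrable lborel {0<..} (\<lambda>t. C * exp (- t))"
      by (intro set_integrable_mult_right set_integrable_exp_minus)
    show "AE t in lborel. t \<in> {0<..} \<longrightarrow> norm (exp (- x * cosh t) * cosh (\<nu> * t)) \<le> norm (C * exp (- t))"
    proof (intro AE_I2 impI)
      fix t :: real assume "t \<in> {0<..}"
      then have "exp (- x * cosh t) * cosh (\<nu> * t) \<le> C * exp (- t)" by (intro C) auto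
      also have "\<dots> \<le> \<bar>C * exp (- t)\<bar>" by (rule abs_ge_self)
      finally show "norm (exp (- x * cosh t) * cosh (\<nu> * t)) \<le> norm (C * exp (- t))"
        by (simp add: abs_mult)
    qed
  qed (auto simp: set_borel_measurable_def)
qed

lemma bessel_K_altdef: "bessel_K \<nu> x = (LINT t:{0<..}|lborel. exp (- x * cosh t) * cosh (\<nu> * t))"
  unfolding bessel_K_def by (rule set_integral_Ici_eq_Ioi) measurable

lemma bessel_K_minus: "bessel_K (- \<nu>) x = bessel_K \<nu> x"
  unfolding bessel_K_def by simp

lemma bessel_K_mono_order:
  assumes "x > 0" "\<bar>\<nu>\<bar> \<le> \<bar>\<mu>\<bar>"
  shows "bessel_K \<nu> x \<le> bessel_K \<mu> x"
  unfolding bessel_K_altdef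
proof (rule set_integral_mono)
  fix t :: real assume t: "t \<in> {0<..}"
  have "cosh \<bar>\<nu> * t\<bar> \<le> cosh \<bar>\<mu> * t\<bar>" using assms t by (subst cosh_real_nonneg_le_iff) (auto simp: abs_mult)
  then show "exp (- x * cosh t) * cosh (\<nu> * t) \<le> exp (- x * cosh t) * cosh (\<mu> * t)" by simp
qed (rule bessel_K_integrable[OF \<open>x > 0\<close>])+

lemma bessel_K_nonneg: "bessel_K \<nu> x \<ge> 0"
  unfolding bessel_K_def set_lebesgue_integral_def by (intro Bochner_Integration.integral_nonneg) simp

lemma bessel_K_decay:
  assumes "x \<ge> 1"
  shows "bessel_K \<nu> x \<le> exp (1 - x) * bessel_K \<nu> 1"
proof -
  have "bessel_K \<nu> x \<le> (LINT t:{0<..}|lborel. exp (1 - x) * (exp (- 1 * cosh t) * cosh (\<nu> * t)))"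
    unfolding bessel_K_altdef
  proof (rule set_integral_mono)
    fix t :: real assume t: "t \<in> {0<..}"
    have "(x - 1) * 1 \<le> (x - 1) * cosh t" using assms cosh_real_ge_1[of t] by (intro mult_left_mono) auto
    then have "exp (- x * cosh t) \<le> exp (1 - x) * exp (- 1 * cosh t)"
      by (simp add: algebra_simps flip: exp_add)
    then show "exp (- x * cosh t) * cosh (\<nu> * t) \<le> exp (1 - x) * (exp (- 1 * cosh t) * cosh (\<nu> * t))"
      by (simp flip: mult.assoc)
  next
    show "set_integrable lborel {0<..} (\<lambda>t. exp (- x * cosh t) * cosh (\<nu> * t))"
      using assms by (intro bessel_K_integrable) auto
    show "set_integrable lborel {0<..} (\<lambda>t. exp (1 - x) * (exp (- 1 * cosh t) * cosh (\<nu> * t)))"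
      using bessel_K_integrable[of 1 \<nu>] by (intro set_integrable_mult_right) simp
  qed
  also have "\<dots> = exp (1 - x) * bessel_K \<nu> 1"
    unfolding bessel_K_altdef by (rule set_integral_mult_right)
  finally show ?thesis .
qed

lemma bessel_K_deriv:
  assumes x: "x > 0"
  shows "(bessel_K \<nu> has_real_derivative \<nu> / x * bessel_K \<nu> x - bessel_K (\<nu> + 1) x) (at x)"
proof -
  have xn: "x \<noteq> 0" using x by simp
  define w where "w = (\<lambda>t. indicator {0<..} t * cosh (\<nu> * t) :: real)"
  have w1: "w \<in> borel_measurable lborel" unfolding w_def by measurable
  have w2: "integrable lborel (\<lambda>t. w t * exp (- z * cosh t))" if "z > 0" for z
    using bessel_K_integrable[OF that, of \<nu>] unfolding w_def set_integrable_def
    by (simp add: ac_simps)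
  have w3: "bessel_K \<nu> = (\<lambda>x. \<integral>t. w t * exp (- x * cosh t) \<partial>lborel)"
    unfolding bessel_K_altdef w_def set_lebesgue_integral_def
    by (simp add: ac_simps)
  have D: "(bessel_K \<nu> has_real_derivative - (\<integral>t. w t * cosh t * exp (- x * cosh t) \<partial>lborel)) (at x)"
    unfolding w3 using w1 w2 x by (intro has_real_derivative_laplace) auto
  have I: "integrable lborel (\<lambda>t. w t * cosh t * exp (- x * cosh t))"
    using w1 w2 x by (intro laplace_deriv_integrable) auto
  then have I1: "set_integrable lborel {0<..} (\<lambda>t. exp (- x * cosh t) * (cosh t * cosh (\<nu> * t)))"
    unfolding w_def set_integrable_def by (simp add: ac_simps)
  have DI: "(\<integral>t. w t * cosh t * exp (- x * cosh t) \<partial>lborel) = (LINT t:{0<..}|lborel. exp (- x * cosh t) * (cosh t * cosh (\<nu> * t)))"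
    unfolding w_def set_lebesgue_integral_def by (simp add: ac_simps)
  note I2 = bessel_K_integrable[OF x, of "\<nu> + 1"] and I3 = bessel_K_integrable[OF x, of \<nu>]
  let ?f = "\<lambda>t. exp (- x * cosh t) * cosh ((\<nu> + 1) * t) - exp (- x * cosh t) * (cosh t * cosh (\<nu> * t)) - \<nu> / x * (exp (- x * cosh t) * cosh (\<nu> * t))"
  have I4: "set_integrable lborel {0<..} ?f"
    using I1 I2 I3 by (intro set_integral_diff set_integrable_mult_right)
  from exp_cosh_bound[OF x] obtain C where C: "\<And>t. t \<ge> 0 \<Longrightarrow> exp (- x * cosh t) * cosh (\<nu> * t) \<le> C * exp (- t)"
    by blast
  \<comment> \<open>Integration by parts in disguise:
    \<open>cosh ((\<nu> + 1) * t) - cosh t * cosh (\<nu> * t)\<close> is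
    \<open>sinh t * sinh (\<nu> * t)\<close>, so \<open>?f\<close> is a total derivative whose
    primitive vanishes at 0 and at infinity. This trades the factor \<open>cosh t\<close> from
    differentiation for the order \<open>\<nu> + 1\<close>.\<close>
  have "(LBINT t=ereal 0..\<infinity>. ?f t) = 0 - 0"
  proof (rule interval_integral_FTC_integrable[where F = "\<lambda>t. - (1 / x) * (exp (- x * cosh t) * sinh (\<nu> * t))"])
    fix t :: real
    have "cosh ((\<nu> + 1) * t) = cosh t * cosh (\<nu> * t) + sinh t * sinh (\<nu> * t)"
      using cosh_add[of t "\<nu> * t"] by (simp add: algebra_simps)
    then have "?f t = exp (- x * cosh t) * sinh t * sinh (\<nu> * t) - \<nu> / x * (exp (- x * cosh t) * cosh (\<nu> * t))"
      by (simp add: algebra_simps)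
    moreover have "((\<lambda>t. - (1 / x) * (exp (- x * cosh t) * sinh (\<nu> * t))) has_real_derivative
        exp (- x * cosh t) * sinh t * sinh (\<nu> * t) - \<nu> / x * (exp (- x * cosh t) * cosh (\<nu> * t))) (at t)"
      using xn by (auto intro!: derivative_eq_intros simp: field_simps)
    ultimately show "((\<lambda>t. - (1 / x) * (exp (- x * cosh t) * sinh (\<nu> * t))) has_vector_derivative ?f t) (at t)"
      by (simp only: has_real_derivative_iff_has_vector_derivative)
    show "isCont ?f t" by (intro continuous_intros)
  next
    show "set_integrable lborel (einterval (ereal 0) \<infinity>) ?f" using I4 by simp
    show "(((\<lambda>t. - (1 / x) * (exp (- x * cosh t) * sinh (\<nu> * t))) \<circ> real_of_ereal) \<longlongrightarrow> 0) (at_right (ereal 0))"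
      unfolding ereal_tendsto_simps using xn by (auto intro!: tendsto_eq_intros)
    have "((\<lambda>t. exp (- x * cosh t) * sinh (\<nu> * t)) \<longlongrightarrow> 0) at_top"
    proof (rule Lim_null_comparison)
      show "((\<lambda>t. C * exp (- t)) \<longlongrightarrow> 0) at_top"
        by (intro tendsto_mult_right_zero filterlim_compose[OF exp_at_bot filterlim_uminus_at_bot_at_top])
      show "\<forall>\<^sub>F t in at_top. norm (exp (- x * cosh t) * sinh (\<nu> * t)) \<le> C * exp (- t)"
        using eventually_ge_at_top[of 0]
      proof eventually_elim
        case (elim t)
        have "\<bar>sinh (\<nu> * t)\<bar> \<le> cosh (\<nu> * t)"
          by (simp add: sinh_def cosh_def abs_le_iff field_simps)
        then have "exp (- x * cosh t) * \<bar>sinh (\<nu> * t)\<bar> \<le> exp (- x * cosh t) * cosh (\<nu> * t)"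
          by (intro mult_left_mono) auto
        also have "\<dots> \<le> C * exp (- t)" by (rule C[OF elim])
        finally show ?case by (simp add: abs_mult)
      qed
    qed
    then show "(((\<lambda>t. - (1 / x) * (exp (- x * cosh t) * sinh (\<nu> * t))) \<circ> real_of_ereal) \<longlongrightarrow> 0) (at_left \<infinity>)"
      unfolding ereal_tendsto_simps by (intro tendsto_mult_right_zero)
  qed simp
  then have "(LINT t:{0<..}|lborel. ?f t) = 0" by (simp add: interval_lebesgue_integral_def)
  also have "(LINT t:{0<..}|lborel. ?f t) = bessel_K (\<nu> + 1) x - (LINT t:{0<..}|lborel. exp (- x * cosh t) * (cosh t * cosh (\<nu> * t))) - \<nu> / x * bessel_K \<nu> x"
    unfolding bessel_K_altdef
    by (subst set_integral_diff(2), (intro set_integral_diff set_integrable_mult_right I1 I2 I3)+,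
        subst set_integral_diff(2), (intro I1 I2)+, subst set_integral_mult_right, rule refl)
  finally have "- (\<integral>t. w t * cosh t * exp (- x * cosh t) \<partial>lborel) = \<nu> / x * bessel_K \<nu> x - bessel_K (\<nu> + 1) x"
    unfolding DI by linarith
  with D show ?thesis by simp
qed

section \<open>A Gamma-type integral for K and its singularity at the origin\<close>

lemma Gamma_set_integral:
  fixes \<mu> :: real
  assumes "\<mu> > 0"
  shows "set_integrable lborel {0<..} (\<lambda>s. s powr (\<mu> - 1) * exp (- s))"
    "(LINT s:{0<..}|lborel. s powr (\<mu> - 1) * exp (- s)) = Gamma \<mu>"
proof -
  have "has_bochner_integral lborel (\<lambda>s. indicator {0<..} s *\<^sub>R (s powr (\<mu> - 1) * exp (- s))) (Gamma \<mu>)"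
  proof (rule has_bochner_integral_nn_integral)
    have "ennreal (Gamma \<mu>) = (\<integral>\<^sup>+s. ennreal (indicator {0..} s * s powr (\<mu> - 1) / exp s) \<partial>lborel)"
      using Gamma_conv_nn_integral_real[OF assms] by (simp add: nn_integral_completion)
    also have "\<dots> = (\<integral>\<^sup>+s. ennreal (indicator {0<..} s *\<^sub>R (s powr (\<mu> - 1) * exp (- s))) \<partial>lborel)"
      by (intro nn_integral_cong) (auto simp: indicator_def exp_minus field_simps)
    finally show "(\<integral>\<^sup>+s. ennreal (indicator {0<..} s *\<^sub>R (s powr (\<mu> - 1) * exp (- s))) \<partial>lborel) = ennreal (Gamma \<mu>)" ..
  qed (use assms in \<open>auto intro!: AE_I2 simp: less_imp_le Gamma_real_pos\<close>)
  then show "set_integrable lborel {0<..} (\<lambda>s. s powr (\<mu> - 1) * exp (- s))"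
    "(LINT s:{0<..}|lborel. s powr (\<mu> - 1) * exp (- s)) = Gamma \<mu>"
    unfolding set_integrable_def set_lebesgue_integral_def by (auto simp: has_bochner_integral_iff)
qed

lemma bessel_K_Gamma_form_integrable:
  fixes \<mu> x :: real
  assumes "\<mu> > 0"
  shows "set_integrable lborel {0<..} (\<lambda>s. s powr (\<mu> - 1) * exp (- s - x\<^sup>2 / (4 * s)))"
proof (rule set_integrable_bound[OF Gamma_set_integral(1)[OF assms]])
  show "AE s in lborel. s \<in> {0<..} \<longrightarrow> norm (s powr (\<mu> - 1) * exp (- s - x\<^sup>2 / (4 * s))) \<le> norm (s powr (\<mu> - 1) * exp (- s))"
    by (intro AE_I2 impI) (auto simp: abs_mult intro!: mult_left_mono)
qed (auto simp: set_borel_measurable_def)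

text \<open>By evenness, K is half the integral of \<open>exp (- x * cosh t + \<mu> * t)\<close>
  over the whole line; then substitute \<open>s = x * exp t / 2\<close>. The form isolates the
  singularity at \<open>x = 0\<close>: the remaining integral is dominated by that of
  \<open>Gamma \<mu>\<close> and converges to it.\<close>

lemma bessel_K_Gamma_form:
  fixes \<mu> x :: real
  assumes \<mu>: "\<mu> > 0" and x: "x > 0"
  shows "x powr \<mu> * bessel_K \<mu> x = 2 powr (\<mu> - 1) * (LINT s:{0<..}|lborel. s powr (\<mu> - 1) * exp (- s - x\<^sup>2 / (4 * s)))"
proof -
  let ?f = "\<lambda>t. exp (- x * cosh t + \<mu> * t)"
  let ?g = "\<lambda>s. ln (2 * s / x)"
  have fg: "?f (?g s) * (1 / s) = (2 / x) powr \<mu> * (s powr (\<mu> - 1) * exp (- s - x\<^sup>2 / (4 * s)))" if s: "s > 0" for s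
  proof -
    have "cosh (?g s) = (2 * s / x + x / (2 * s)) / 2"
      using s x by (simp add: cosh_field_def exp_minus)
    then have "- x * cosh (?g s) = - s - x\<^sup>2 / (4 * s)"
      using s x by (simp add: field_simps power2_eq_square)
    moreover have "exp (\<mu> * ?g s) = (2 / x) powr \<mu> * s powr \<mu>"
      using s x by (simp add: powr_def ln_mult ln_div field_simps flip: exp_add)
    moreover have "s powr \<mu> * (1 / s) = s powr (\<mu> - 1)"
      using s by (simp add: powr_diff)
    ultimately show ?thesis by (simp only: exp_add mult.assoc) simp
  qed
  have d: "(?g has_real_derivative 1 / s) (at s)" if "ereal 0 < ereal s" for s
    using that x by (auto intro!: derivative_eq_intros simp: field_simps)
  have c: "isCont ?f (?g s)" for s by (intro continuous_intros)
  have c': "isCont (\<lambda>s. 1 / s) s" if "ereal 0 < ereal s" for s :: real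
    using that by (intro continuous_intros) auto
  have nn: "0 \<le> 1 / s" if "ereal 0 \<le> ereal s" for s :: real using that by simp
  have "filterlim ?g at_bot (at_right 0)"
  proof (rule filterlim_compose[OF ln_at_0])
    have "filterlim (\<lambda>s::real. 2 * s / x) (nhds 0) (at_right 0)"
      using x by (auto intro!: tendsto_eq_intros)
    then show "filterlim (\<lambda>s::real. 2 * s / x) (at_right 0) (at_right 0)"
      using x by (auto simp: filterlim_at eventually_at_filter)
  qed
  then have A: "((ereal \<circ> ?g \<circ> real_of_ereal) \<longlongrightarrow> - \<infinity>) (at_right (ereal 0))"
    by (simp add: ereal_tendsto_simps)
  have "filterlim ?g at_top at_top"
  proof (rule filterlim_compose[OF ln_at_top])
    show "filterlim (\<lambda>s::real. 2 * s / x) at_top at_top"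
      using filterlim_tendsto_pos_mult_at_top[of "\<lambda>_. 2 / x" "2 / x" at_top "\<lambda>s::real. s"] x
      by (simp add: filterlim_ident)
  qed
  then have B: "((ereal \<circ> ?g \<circ> real_of_ereal) \<longlongrightarrow> \<infinity>) (at_left \<infinity>)"
    by (simp add: ereal_tendsto_simps)
  have "set_integrable lborel {0<..} (\<lambda>s. (2 / x) powr \<mu> * (s powr (\<mu> - 1) * exp (- s - x\<^sup>2 / (4 * s))))"
    by (intro set_integrable_mult_right bessel_K_Gamma_form_integrable \<mu>)
  also have "?this \<longleftrightarrow> set_integrable lborel {0<..} (\<lambda>s. ?f (?g s) * (1 / s))"
    by (intro set_integrable_cong refl fg[symmetric]) auto
  finally have I: "set_integrable lborel (einterval (ereal 0) \<infinity>) (\<lambda>s. ?f (?g s) * (1 / s))" by simp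
  note subst = interval_integral_substitution_nonneg[where f = ?f, OF _ d c c' _ nn A B I, simplified]
  have f: "integrable lborel ?f"
    using subst(1) x by (simp add: set_integrable_def einterval_def)
  have "2 * bessel_K \<mu> x = (LINT t:{0<..}|lborel. 2 * (exp (- x * cosh t) * cosh (\<mu> * t)))"
    unfolding bessel_K_altdef by (rule set_integral_mult_right[symmetric])
  also have "\<dots> = (LINT t:{0<..}|lborel. ?f t + ?f (- t))"
    by (intro arg_cong[where f = "set_lebesgue_integral lborel {0<..}"] ext)
      (simp add: cosh_field_def[of "\<mu> * _"] distrib_left flip: exp_add)
  also have "\<dots> = (LINT t:{0<..}|lborel. ?f t) + (LINT t:{0<..}|lborel. ?f (- t))"
    using lborel_integral_split_reflect(1,2)[OF f] by (rule set_integral_add)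
  also have "\<dots> = (LINT t|lborel. ?f t)"
    by (rule lborel_integral_split_reflect(3)[OF f, symmetric])
  also have "\<dots> = (LBINT t=-\<infinity>..\<infinity>. ?f t)"
    by (simp add: interval_lebesgue_integral_def einterval_def set_lebesgue_integral_def)
  also have "\<dots> = (LBINT s=ereal 0..\<infinity>. ?f (?g s) * (1 / s))" using subst(2) x by simp
  also have "\<dots> = (LINT s:{0<..}|lborel. ?f (?g s) * (1 / s))"
    by (simp add: interval_lebesgue_integral_def)
  also have "\<dots> = (LINT s:{0<..}|lborel. (2 / x) powr \<mu> * (s powr (\<mu> - 1) * exp (- s - x\<^sup>2 / (4 * s))))"
    by (rule set_lebesgue_integral_cong) (simp, intro allI impI fg, simp)
  also have "\<dots> = (2 / x) powr \<mu> * (LINT s:{0<..}|lborel. s powr (\<mu> - 1) * exp (- s - x\<^sup>2 / (4 * s)))"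
    by (rule set_integral_mult_right)
  finally show ?thesis using x by (simp add: powr_divide powr_diff field_simps)
qed

lemma bessel_K_le_Gamma:
  fixes \<mu> x :: real
  assumes \<mu>: "\<mu> > 0" and x: "x > 0"
  shows "x powr \<mu> * bessel_K \<mu> x \<le> 2 powr (\<mu> - 1) * Gamma \<mu>"
  unfolding bessel_K_Gamma_form[OF assms]
proof (intro mult_left_mono)
  show "(LINT s:{0<..}|lborel. s powr (\<mu> - 1) * exp (- s - x\<^sup>2 / (4 * s))) \<le> Gamma \<mu>"
    unfolding Gamma_set_integral(2)[OF \<mu>, symmetric]
    by (intro set_integral_mono bessel_K_Gamma_form_integrable Gamma_set_integral \<mu>) (auto intro!: mult_left_mono)
qed auto

lemma bessel_K_at_0:
  fixes \<mu> :: real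
  assumes \<mu>: "\<mu> > 0"
  shows "((\<lambda>x. x powr \<mu> * bessel_K \<mu> x) \<longlongrightarrow> 2 powr (\<mu> - 1) * Gamma \<mu>) (at_right 0)"
proof -
  let ?J = "\<lambda>x. (LINT s:{0<..}|lborel. s powr (\<mu> - 1) * exp (- s - x\<^sup>2 / (4 * s)))"
  have "(?J \<longlongrightarrow> Gamma \<mu>) (at_right 0)"
    unfolding tendsto_at_iff_sequentially
  proof safe
    fix X :: "nat \<Rightarrow> real" assume X: "X \<longlonglongrightarrow> 0"
    show "(?J \<circ> X) \<longlonglongrightarrow> Gamma \<mu>"
      unfolding Gamma_set_integral(2)[OF \<mu>, symmetric] o_def set_lebesgue_integral_def
    proof (rule integral_dominated_convergence)
      show "integrable lborel (\<lambda>s. indicator {0<..} s *\<^sub>R (s powr (\<mu> - 1) * exp (- s)))"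
        using Gamma_set_integral(1)[OF \<mu>] by (simp add: set_integrable_def)
      show "AE s in lborel. (\<lambda>i. indicat_real {0<..} s *\<^sub>R (s powr (\<mu> - 1) * exp (- s - (X i)\<^sup>2 / (4 * s))))
         \<longlonglongrightarrow> indicat_real {0<..} s *\<^sub>R (s powr (\<mu> - 1) * exp (- s))"
      proof (rule AE_I2)
        fix s :: real
        have "(\<lambda>i. - s - (X i)\<^sup>2 / (4 * s)) \<longlonglongrightarrow> - s - 0\<^sup>2 / (4 * s)" if "s > 0"
          using that by (intro tendsto_intros X) auto
        then have "(\<lambda>i. exp (- s - (X i)\<^sup>2 / (4 * s))) \<longlonglongrightarrow> exp (- s)" if "s > 0"
          using that tendsto_exp by fastforce
        then show "(\<lambda>i. indicat_real {0<..} s *\<^sub>R (s powr (\<mu> - 1) * exp (- s - (X i)\<^sup>2 / (4 * s))))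
         \<longlonglongrightarrow> indicat_real {0<..} s *\<^sub>R (s powr (\<mu> - 1) * exp (- s))"
          by (cases "s > 0") (auto simp: indicator_def intro!: tendsto_mult)
      qed
      show "AE s in lborel. norm (indicat_real {0<..} s *\<^sub>R (s powr (\<mu> - 1) * exp (- s - (X i)\<^sup>2 / (4 * s))))
         \<le> indicat_real {0<..} s *\<^sub>R (s powr (\<mu> - 1) * exp (- s))" for i
        by (intro AE_I2) (auto simp: indicator_def abs_mult intro!: mult_left_mono)
    qed auto
  qed
  then have "((\<lambda>x. 2 powr (\<mu> - 1) * ?J x) \<longlongrightarrow> 2 powr (\<mu> - 1) * Gamma \<mu>) (at_right 0)"
    by (intro tendsto_intros)
  moreover have "\<forall>\<^sub>F x in at_right 0. 2 powr (\<mu> - 1) * ?J x = x powr \<mu> * bessel_K \<mu> x"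
    using eventually_at_right_less[of 0] by eventually_elim (simp add: bessel_K_Gamma_form[OF \<mu>])
  ultimately show ?thesis by (rule Lim_transform_eventually)
qed

subsection \<open>The rescaled Bessel functions\<close>

text \<open>
  With \<open>\<nu> = (r - 1) / 2\<close>, the functions \<open>besA r\<close> and \<open>besB r\<close> are \<open>x\<^sup>-\<^sup>\<nu> I\<^sub>\<nu>\<close> and \<open>x\<^sup>-\<^sup>\<nu> K\<^sub>\<nu>\<close>; raising
  \<open>\<nu>\<close> by one raises \<open>r\<close> by two. At \<open>x = 0\<close> the series gives the limit of \<open>x\<^sup>-\<^sup>\<nu> I\<^sub>\<nu>\<close>, but \<open>besB r 0 = 0\<close> is a junk value.
\<close>

definition besA_coef :: "real \<Rightarrow> nat \<Rightarrow> real" where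
  "besA_coef r k = 2 powr ((1 - r) / 2) / (4 ^ k * Gamma ((r + 1) / 2 + real k) * fact k)"

definition besA :: "real \<Rightarrow> real \<Rightarrow> real" where
  "besA r x = (\<Sum>k. besA_coef r k * (x\<^sup>2) ^ k)"

definition besB :: "real \<Rightarrow> real \<Rightarrow> real" where
  "besB r x = x powr ((1 - r) / 2) * bessel_K ((r - 1) / 2) x"

lemma besA_coef_pos: "r > 0 \<Longrightarrow> besA_coef r k > 0"
  unfolding besA_coef_def by (intro divide_pos_pos mult_pos_pos Gamma_real_pos) (auto intro: add_pos_nonneg)

lemma Gamma_plus1_real: "x > 0 \<Longrightarrow> Gamma (x + 1) = x * Gamma (x :: real)"
  by (rule Gamma_plus1) (auto elim!: nonpos_Ints_cases)

lemma besA_coef_Suc: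
  assumes "r > 0"
  shows "besA_coef r (Suc k) = besA_coef r k / (4 * ((r + 1) / 2 + real k) * real (Suc k))"
proof -
  have "Gamma ((r + 1) / 2 + real (Suc k)) = ((r + 1) / 2 + real k) * Gamma ((r + 1) / 2 + real k)"
    using Gamma_plus1_real[of "(r + 1) / 2 + real k"] assms by (simp add: add_ac add_nonneg_pos)
  then show ?thesis unfolding besA_coef_def fact_Suc power_Suc by (simp del: of_nat_Suc add: ac_simps)
qed

lemma besA_coef_order:
  assumes "r > 0"
  shows "real (Suc k) * besA_coef r (Suc k) = besA_coef (r + 2) k / 2"
proof -
  have 1: "2 powr ((1 - (r + 2)) / 2) = 2 powr ((1 - r) / 2) / (2 :: real)"
    using powr_diff[of 2 "(1 - r) / 2" 1] by (simp add: field_simps)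
  have 2: "(r + 2 + 1) / 2 + real k = (r + 1) / 2 + real (Suc k)" by (simp add: field_simps)
  show ?thesis unfolding besA_coef_def 1 2 fact_Suc power_Suc by (simp add: field_simps del: of_nat_Suc)
qed

lemma besA_summable:
  assumes "r > 0"
  shows "summable (\<lambda>k. besA_coef r k * z ^ k)"
proof (rule summable_comparison_test')
  have le: "besA_coef r k \<le> besA_coef r 0 / fact k" for k
  proof (induction k)
    case (Suc k)
    have 1: "4 * ((r + 1) / 2 + real k) \<ge> 1" using assms by (simp add: field_simps)
    have "besA_coef r (Suc k) = besA_coef r k / real (Suc k) / (4 * ((r + 1) / 2 + real k))"
      unfolding besA_coef_Suc[OF assms] by (simp add: ac_simps)
    also have "\<dots> \<le> besA_coef r k / real (Suc k) / 1"
      using besA_coef_pos[OF assms, of k] 1 by (intro divide_left_mono) auto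
    also have "\<dots> \<le> (besA_coef r 0 / fact k) / real (Suc k)"
      using divide_right_mono[OF Suc, of "real (Suc k)"] by simp
    finally show ?case by (simp add: field_simps)
  qed simp
  show "summable (\<lambda>k. besA_coef r 0 * (inverse (fact k) * \<bar>z\<bar> ^ k))"
    by (intro summable_mult summable_exp)
  show "norm (besA_coef r k * z ^ k) \<le> besA_coef r 0 * (inverse (fact k) * \<bar>z\<bar> ^ k)" if "k \<ge> 0" for k
  proof -
    have "besA_coef r k * \<bar>z\<bar> ^ k \<le> (besA_coef r 0 / fact k) * \<bar>z\<bar> ^ k"
      by (intro mult_right_mono le) auto
    then show ?thesis using besA_coef_pos[OF assms, of k] by (simp add: abs_mult power_abs field_simps)
  qed
qed

lemma besA_deriv:
  assumes "r > 0"
  shows "(besA r has_real_derivative x * besA (r + 2) x) (at x)"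
proof -
  have "((\<lambda>z. \<Sum>k. besA_coef r k * z ^ k) has_real_derivative (\<Sum>k. diffs (besA_coef r) k * (x\<^sup>2) ^ k)) (at (x\<^sup>2))"
    by (rule termdiffs_strong_converges_everywhere) (rule besA_summable[OF assms])
  also have "(\<Sum>k. diffs (besA_coef r) k * (x\<^sup>2) ^ k) = (\<Sum>k. 1 / 2 * (besA_coef (r + 2) k * (x\<^sup>2) ^ k))"
    unfolding diffs_def besA_coef_order[OF assms] by simp
  also have "\<dots> = 1 / 2 * besA (r + 2) x"
    unfolding besA_def using assms by (intro suminf_mult besA_summable) auto
  finally have "((\<lambda>x. \<Sum>k. besA_coef r k * (x\<^sup>2) ^ k) has_real_derivative 1 / 2 * besA (r + 2) x * (2 * x)) (at x)"
    by (rule DERIV_chain2) (auto intro!: derivative_eq_intros)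
  then show ?thesis unfolding besA_def by (simp add: ac_simps)
qed

text \<open>The contiguous relation between I of orders nu, nu + 1 and nu + 2, proved on
  coefficients. Combined with \<open>besA_deriv\<close> used twice, it is the homogeneous equation
  \<open>x a'' + r a' - x a = 0\<close>.\<close>

lemma besA_rec:
  assumes r: "r > 0"
  shows "besA r x = (r + 1) * besA (r + 2) x + x\<^sup>2 * besA (r + 4) x"
proof -
  let ?z = "x\<^sup>2"
  have r': "r + 2 > 0" "r + 4 > 0" using r by auto
  have c0: "besA_coef r 0 = (r + 1) * besA_coef (r + 2) 0"
    using besA_coef_order[OF r, of 0] besA_coef_Suc[OF r, of 0] r by (simp add: field_simps)
  have cS: "besA_coef r (Suc k) = (r + 1) * besA_coef (r + 2) (Suc k) + besA_coef (r + 4) k" for k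
  proof -
    have o1: "besA_coef (r + 2) k = 2 * (real (Suc k) * besA_coef r (Suc k))"
      using besA_coef_order[OF r, of k] by linarith
    have o2: "besA_coef (r + 4) k = 2 * (real (Suc k) * besA_coef (r + 2) (Suc k))"
      using besA_coef_order[OF r'(1), of k] by (simp add: add.assoc)
    have "besA_coef (r + 2) (Suc k) * (2 * (r + 3 + 2 * real k) * real (Suc k)) = besA_coef (r + 2) k"
    proof -
      have e: "4 * ((r + 2 + 1) / 2 + real k) * real (Suc k) = 2 * (r + 3 + 2 * real k) * real (Suc k)" by (simp add: field_simps)
      have "2 * (r + 3 + 2 * real k) * real (Suc k) \<noteq> 0" using r by simp
      then show ?thesis unfolding besA_coef_Suc[OF r'(1)] e by simp
    qed
    then have "real (Suc k) * besA_coef r (Suc k) = real (Suc k) * (besA_coef (r + 2) (Suc k) * (r + 3 + 2 * real k))"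
      unfolding o1 by (simp add: algebra_simps)
    then have "besA_coef r (Suc k) = besA_coef (r + 2) (Suc k) * (r + 3 + 2 * real k)"
      unfolding mult_cancel_left by simp
    then show ?thesis unfolding o2 by (simp add: algebra_simps)
  qed
  have s1: "summable (\<lambda>k. besA_coef (r + 2) (Suc k) * ?z ^ Suc k)"
    using besA_summable[OF r'(1), of ?z] by (subst summable_Suc_iff)
  have "besA r x = besA_coef r 0 + (\<Sum>k. besA_coef r (Suc k) * ?z ^ Suc k)"
    unfolding besA_def using suminf_split_head[OF besA_summable[OF r, of ?z]] by simp
  also have "(\<lambda>k. besA_coef r (Suc k) * ?z ^ Suc k) = (\<lambda>k. (r + 1) * (besA_coef (r + 2) (Suc k) * ?z ^ Suc k) + ?z * (besA_coef (r + 4) k * ?z ^ k))"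
    unfolding cS by (simp add: algebra_simps)
  also have "(\<Sum>k. (r + 1) * (besA_coef (r + 2) (Suc k) * ?z ^ Suc k) + ?z * (besA_coef (r + 4) k * ?z ^ k))
     = (r + 1) * (\<Sum>k. besA_coef (r + 2) (Suc k) * ?z ^ Suc k) + ?z * besA (r + 4) x"
    unfolding besA_def
    by (subst suminf_add[symmetric], intro summable_mult s1, intro summable_mult besA_summable r',
        subst suminf_mult[OF s1], subst suminf_mult[OF besA_summable[OF r'(2)]], rule refl)
  also have "(\<Sum>k. besA_coef (r + 2) (Suc k) * ?z ^ Suc k) = besA (r + 2) x - besA_coef (r + 2) 0"
    unfolding besA_def using suminf_split_head[OF besA_summable[OF r'(1), of ?z]] by simp
  finally show ?thesis unfolding c0 by (simp add: algebra_simps)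
qed

lemma besA_0: "besA r 0 = besA_coef r 0"
  unfolding besA_def by (simp add: powser_zero)

lemma besA_pos:
  assumes "r > 0"
  shows "besA r x > 0"
proof -
  have "0 < besA_coef r 0" by (rule besA_coef_pos[OF assms])
  also have "\<dots> = (\<Sum>k<1. besA_coef r k * (x\<^sup>2) ^ k)" by simp
  also have "\<dots> \<le> besA r x"
    unfolding besA_def using besA_coef_pos[OF assms]
    by (intro sum_le_suminf besA_summable assms) (auto simp: less_imp_le)
  finally show ?thesis .
qed

lemma bessel_I_eq_besA:
  assumes "r > 0" "x > 0"
  shows "bessel_I ((r - 1) / 2) x = x powr ((r - 1) / 2) * besA r x"
proof -
  have "(x / 2) powr ((r - 1) / 2 + 2 * real k) / (Gamma ((r - 1) / 2 + real k + 1) * fact k)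
      = x powr ((r - 1) / 2) * (besA_coef r k * (x\<^sup>2) ^ k)" for k
  proof -
    have "(x / 2) powr ((r - 1) / 2 + 2 * real k) = (x / 2) powr ((r - 1) / 2) * ((x / 2) ^ (2 * k))"
      using assms by (simp add: powr_add powr_realpow[symmetric])
    also have "(x / 2) powr ((r - 1) / 2) = x powr ((r - 1) / 2) * 2 powr ((1 - r) / 2)"
      using assms powr_minus_divide[of 2 "(r - 1) / 2"] by (simp add: powr_divide minus_divide_left)
    also have "(x / 2) ^ (2 * k) = (x\<^sup>2) ^ k / 4 ^ k"
      by (simp add: power_mult power_divide)
    finally have 1: "(x / 2) powr ((r - 1) / 2 + 2 * real k) = x powr ((r - 1) / 2) * 2 powr ((1 - r) / 2) * ((x\<^sup>2) ^ k / 4 ^ k)" .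
    have 2: "(r - 1) / 2 + real k + 1 = (r + 1) / 2 + real k" by (simp add: field_simps)
    show ?thesis unfolding besA_coef_def 1 2 by simp
  qed
  then show ?thesis
    unfolding bessel_I_def besA_def by (simp add: suminf_mult[OF besA_summable[OF assms(1)]])
qed

section \<open>The decaying solution: recurrence, decay and behaviour at the origin\<close>

lemma besB_nonneg: "besB r x \<ge> 0"
  unfolding besB_def by (intro mult_nonneg_nonneg bessel_K_nonneg) auto

lemma besB_order:
  assumes "x > 0"
  shows "x * besB (r + 2) x = x powr ((1 - r) / 2) * bessel_K ((r - 1) / 2 + 1) x"
proof -
  have "x * x powr ((1 - (r + 2)) / 2) = x powr ((1 - r) / 2)"
    using assms powr_diff[of x "(1 - r) / 2" 1] by (simp add: field_simps)
  moreover have "(r + 2 - 1) / 2 = (r - 1) / 2 + 1" by (simp add: field_simps)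
  ultimately show ?thesis unfolding besB_def by (simp only: mult.assoc[symmetric])
qed

lemma besB_deriv:
  assumes x: "x > 0"
  shows "(besB r has_real_derivative - (x * besB (r + 2) x)) (at x)"
proof -
  define n where "n = (r - 1) / 2"
  have n: "(1 - r) / 2 = - n" unfolding n_def by (simp add: field_simps)
  have "((\<lambda>x. x powr (- n) * bessel_K n x) has_real_derivative
     (- n * x powr (- n - 1)) * bessel_K n x + (n / x * bessel_K n x - bessel_K (n + 1) x) * x powr (- n)) (at x)"
    using x by (intro DERIV_mult has_real_derivative_powr bessel_K_deriv)
  moreover have "x powr (- n - 1) = x powr (- n) / x" using x by (simp add: powr_diff)
  ultimately have "((\<lambda>x. x powr (- n) * bessel_K n x) has_real_derivative - (x powr (- n) * bessel_K (n + 1) x)) (at x)"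
    by (simp add: algebra_simps)
  then show ?thesis unfolding besB_order[OF x] unfolding besB_def[abs_def] n n_def[symmetric] .
qed

text \<open>K is even in its order, so the derivative formula at order -(nu + 1) gives a second
  expression for the derivative of K of order nu + 1, now through order nu. Equating it with the
  first gives the three-term recurrence.\<close>

lemma besB_rec:
  assumes x: "x > 0"
  shows "x\<^sup>2 * besB (r + 4) x = besB r x + (r + 1) * besB (r + 2) x"
proof -
  let ?n = "(r - 1) / 2"
  have "(bessel_K (?n + 1) has_real_derivative (?n + 1) / x * bessel_K (?n + 1) x - bessel_K (?n + 1 + 1) x) (at x)"
    by (rule bessel_K_deriv[OF x])
  moreover have "(bessel_K (?n + 1) has_real_derivative - (?n + 1) / x * bessel_K (?n + 1) x - bessel_K ?n x) (at x)"
  proof -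
    have e: "bessel_K (- (?n + 1)) = bessel_K (?n + 1)" by (rule ext) (rule bessel_K_minus)
    have "- (?n + 1) + 1 = - ?n" by simp
    then show ?thesis using bessel_K_deriv[OF x, of "- (?n + 1)"] unfolding e by (simp only: bessel_K_minus)
  qed
  ultimately have "(?n + 1) / x * bessel_K (?n + 1) x - bessel_K (?n + 1 + 1) x = - (?n + 1) / x * bessel_K (?n + 1) x - bessel_K ?n x"
    by (rule DERIV_unique)
  then have "bessel_K (?n + 1 + 1) x = bessel_K ?n x + (r + 1) / x * bessel_K (?n + 1) x"
    using x by (simp add: field_simps)
  moreover have "x\<^sup>2 * besB (r + 4) x = x powr ((1 - r) / 2) * bessel_K (?n + 1 + 1) x"
  proof -
    have "x * besB (r + 4) x = x powr ((1 - (r + 2)) / 2) * bessel_K (?n + 1 + 1) x"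
      using besB_order[OF x, of "r + 2"] by (simp add: add_divide_distrib diff_divide_distrib add.commute[of 4])
    moreover have "x * x powr ((1 - (r + 2)) / 2) = x powr ((1 - r) / 2)"
      using assms powr_diff[of x "(1 - r) / 2" 1] by (simp add: field_simps)
    ultimately show ?thesis by (simp add: power2_eq_square mult.assoc)
  qed
  moreover have "besB (r + 2) x = x powr ((1 - r) / 2) * bessel_K (?n + 1) x / x"
    using besB_order[OF x, of r] x by (simp add: field_simps)
  ultimately show ?thesis unfolding besB_def[of r] by (simp add: algebra_simps)
qed

text \<open>Monotonicity of K in the absolute order: \<open>|nu| \<le> |nu + 1|\<close> means nu at
  least -1/2, which is \<open>r \<ge> 0\<close>.\<close>

lemma besB_le_besB_order:
  assumes "x > 0" "r \<ge> 0"
  shows "besB r x \<le> x * besB (r + 2) x"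
  unfolding besB_order[OF assms(1)] unfolding besB_def
  using assms by (intro mult_left_mono bessel_K_mono_order) (auto simp: abs_if field_simps)

lemma besB_decay: "((\<lambda>x. x powr p * besB r x) \<longlongrightarrow> 0) at_top"
proof -
  obtain n :: nat where n: "p + (1 - r) / 2 \<le> real n" using real_arch_simple by blast
  let ?C = "exp 1 * bessel_K ((r - 1) / 2) 1"
  show ?thesis
  proof (rule Lim_null_comparison)
    show "((\<lambda>x. ?C * (x ^ n / exp x)) \<longlongrightarrow> 0) at_top"
      by (intro tendsto_mult_right_zero tendsto_power_div_exp_0)
    show "\<forall>\<^sub>F x in at_top. norm (x powr p * besB r x) \<le> ?C * (x ^ n / exp x)"
      using eventually_ge_at_top[of 1]
    proof eventually_elim
      case (elim x)
      have "x powr p * besB r x = x powr (p + (1 - r) / 2) * bessel_K ((r - 1) / 2) x"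
        unfolding besB_def by (simp add: powr_add)
      also have "\<dots> \<le> x ^ n * (exp (1 - x) * bessel_K ((r - 1) / 2) 1)"
      proof (intro mult_mono bessel_K_decay elim)
        show "x powr (p + (1 - r) / 2) \<le> x ^ n"
          using powr_mono[OF n elim] elim by (simp add: powr_realpow)
      qed (use elim in \<open>auto simp: bessel_K_nonneg\<close>)
      also have "\<dots> = ?C * (x ^ n / exp x)" by (simp add: exp_diff)
      finally show ?case using besB_nonneg[of r x] by simp
    qed
  qed
qed

lemma besB_at_0:
  assumes "r > 0"
  shows "((\<lambda>x. x powr r * besB r x) \<longlongrightarrow> 0) (at_right 0)"
proof -
  define n where "n = (r - 1) / 2"
  \<comment> \<open>A positive order with \<open>|n| \<le> m < n + 1\<close>. Replacing K of order
    \<open>n\<close> by the larger K of order \<open>m\<close>, which is \<open>O(x^-m)\<close>,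
    leaves the positive power \<open>x^(n + 1 - m)\<close>. This treats negative orders and the
    logarithmic case \<open>n = 0\<close> together with the rest.\<close>
  define m where "m = (\<bar>n\<bar> + (n + 1)) / 2"
  have n: "\<bar>n\<bar> < n + 1" unfolding n_def using assms by (auto simp: abs_if field_simps)
  then have m: "m > 0" "\<bar>n\<bar> \<le> m" "m < n + 1" unfolding m_def by auto
  let ?C = "2 powr (m - 1) * Gamma m"
  show ?thesis
  proof (rule Lim_null_comparison)
    show "((\<lambda>x. ?C * x powr (n + 1 - m)) \<longlongrightarrow> 0) (at_right 0)"
      using m by (intro tendsto_mult_right_zero tendsto_eq_intros) (auto intro!: tendsto_eq_intros eventually_at_rightI[of 0 1])
    show "\<forall>\<^sub>F x in at_right 0. norm (x powr r * besB r x) \<le> ?C * x powr (n + 1 - m)"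
      using eventually_at_right_less[of 0]
    proof eventually_elim
      case (elim x)
      have "x powr r * besB r x = x powr (n + 1) * bessel_K n x"
        unfolding besB_def n_def by (simp add: powr_add[symmetric] mult.assoc[symmetric] field_simps)
      also have "\<dots> = x powr (n + 1 - m) * (x powr m * bessel_K n x)"
        by (simp add: powr_add[symmetric] mult.assoc[symmetric])
      also have "\<dots> \<le> x powr (n + 1 - m) * (x powr m * bessel_K m x)"
        using m elim by (intro mult_left_mono bessel_K_mono_order) auto
      also have "\<dots> \<le> x powr (n + 1 - m) * ?C"
        using m elim by (intro mult_left_mono bessel_K_le_Gamma) auto
      finally show ?case using besB_nonneg[of r x] by (simp add: ac_simps)
    qed
  qed
qed

text \<open>The limit is \<open>2^nu * Gamma (nu + 1)\<close>; written as a reciprocal of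
  \<open>besA r 0\<close> it shows that the Wronskian is normalised to one.\<close>

lemma besB_order_at_0:
  assumes "r > 0"
  shows "((\<lambda>x. x powr (r + 1) * besB (r + 2) x) \<longlongrightarrow> 1 / besA r 0) (at_right 0)"
proof -
  define n where "n = (r - 1) / 2"
  have n: "n + 1 > 0" using assms unfolding n_def by (simp add: field_simps)
  have n1: "n + 1 = (r + 1) / 2" unfolding n_def by (simp add: field_simps)
  have "1 / besA r 0 = 2 powr n * Gamma (n + 1)"
    unfolding besA_0 besA_coef_def n1 unfolding n_def using powr_minus_divide[of 2 "(r - 1) / 2"] by (simp add: minus_divide_left)
  then have "((\<lambda>x. x powr (n + 1) * bessel_K (n + 1) x) \<longlongrightarrow> 1 / besA r 0) (at_right 0)"
    using bessel_K_at_0[OF n] by simp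
  moreover have "\<forall>\<^sub>F x in at_right 0. x powr (n + 1) * bessel_K (n + 1) x = x powr (r + 1) * besB (r + 2) x"
    using eventually_at_right_less[of 0]
  proof eventually_elim
    case (elim x)
    have "(r + 2 - 1) / 2 = n + 1" "r + 1 + (1 - (r + 2)) / 2 = n + 1" unfolding n_def by (simp_all add: field_simps)
    then show ?case unfolding besB_def by (simp only: powr_add[symmetric] mult.assoc[symmetric])
  qed
  ultimately show ?thesis by (rule Lim_transform_eventually)
qed

subsection \<open>The solution of the Stein equation with constant right-hand side\<close>

text \<open>The measure \<open>(1 - u^2)^(r/2 - 1) du\<close> on (0, 1), transported by
  \<open>v = u^2\<close> so that its mass is half a Beta value. Its Laplace transform in
  \<open>u\<close> is, up to a constant factor, \<open>x^-nu (I - L)\<close> with I and L the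
  modified Bessel and Struve functions of order nu.\<close>

definition svgW :: "real \<Rightarrow> real \<Rightarrow> real" where
  "svgW r v = indicator {0<..<1} v * (v powr (-1/2) * (1 - v) powr (r / 2 - 1)) / 2"

text \<open>
  \<open>svgE 0 r\<close> is the function \<open>E\<close> of the introduction and \<open>svgE n r\<close> is \<open>(- 1)\<^sup>n\<close> times its \<open>n\<close>-th derivative.
\<close>

definition svgE :: "nat \<Rightarrow> real \<Rightarrow> real \<Rightarrow> real" where
  "svgE n r x = (LINT v|lborel. svgW r v * sqrt v ^ n * exp (- x * sqrt v))"

lemma svgW_measurable [measurable]: "svgW r \<in> borel_measurable borel"
  unfolding svgW_def by measurable

lemma svgW_nonneg: "svgW r v \<ge> 0"
  unfolding svgW_def by simp

lemma svgW_integral: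
  assumes "r > 0"
  shows "integrable lborel (svgW r)" "(LINT v|lborel. svgW r v) = Beta (1 / 2) (r / 2) / 2"
proof -
  have B: "((\<lambda>t. t powr (1/2 - 1) * (1 - t) powr (r / 2 - 1)) has_integral Beta (1 / 2) (r / 2)) {0..1}"
    using assms by (intro has_integral_Beta_real) auto
  have "has_bochner_integral lborel (\<lambda>v. indicator {0..1} v * (v powr (-1/2) * (1 - v) powr (r / 2 - 1))) (Beta (1 / 2) (r / 2))"
  proof (rule has_bochner_integral_nn_integral)
    show "(\<integral>\<^sup>+v. ennreal (indicator {0..1} v * (v powr (-1/2) * (1 - v) powr (r / 2 - 1))) \<partial>lborel) = ennreal (Beta (1 / 2) (r / 2))"
      using nn_integral_has_integral_lebesgue[OF _ B] by simp
    show "Beta (1 / 2) (r / 2) \<ge> 0"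
      using assms by (auto simp: Beta_def intro!: divide_nonneg_nonneg mult_nonneg_nonneg Gamma_real_nonneg)
  qed auto
  then have "has_bochner_integral lborel (\<lambda>v. indicator {0..1} v * (v powr (-1/2) * (1 - v) powr (r / 2 - 1)) / 2) (Beta (1 / 2) (r / 2) / 2)"
    by (rule has_bochner_integral_divide_zero)
  also have "(\<lambda>v. indicator {0..1} v * (v powr (-1/2) * (1 - v) powr (r / 2 - 1)) / 2) = svgW r"
    unfolding svgW_def by (auto simp: fun_eq_iff indicator_def)
  finally show "integrable lborel (svgW r)" "(LINT v|lborel. svgW r v) = Beta (1 / 2) (r / 2) / 2"
    by (auto simp: has_bochner_integral_iff)
qed

lemma svgW_sqrt: "svgW r v \<noteq> 0 \<Longrightarrow> 0 < v \<and> v < 1 \<and> 0 < sqrt v \<and> sqrt v < 1"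
  unfolding svgW_def by (auto simp: indicator_def split: if_splits)

lemma svgE_integrand_le:
  assumes "x \<ge> 0"
  shows "0 \<le> svgW r v * sqrt v ^ n * exp (- x * sqrt v)"
    "svgW r v * sqrt v ^ n * exp (- x * sqrt v) \<le> svgW r v"
proof -
  have "0 \<le> svgW r v * sqrt v ^ n * exp (- x * sqrt v) \<and> svgW r v * sqrt v ^ n * exp (- x * sqrt v) \<le> svgW r v"
  proof (cases "svgW r v = 0")
    case False
    from svgW_sqrt[OF this] have s: "0 < sqrt v" "sqrt v < 1" by auto
    then have "sqrt v ^ n \<le> 1" by (intro power_le_one) auto
    moreover have "exp (- x * sqrt v) \<le> 1" using s assms by simp
    ultimately have "sqrt v ^ n * exp (- x * sqrt v) \<le> 1" using s by (intro mult_le_one) auto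
    with mult_left_mono[OF this svgW_nonneg[of r v]] svgW_nonneg[of r v] s show ?thesis
      by (auto simp: mult.assoc)
  qed simp
  then show "0 \<le> svgW r v * sqrt v ^ n * exp (- x * sqrt v)"
    "svgW r v * sqrt v ^ n * exp (- x * sqrt v) \<le> svgW r v" by auto
qed

lemma svgE_integrable:
  assumes "r > 0" "x \<ge> 0"
  shows "integrable lborel (\<lambda>v. svgW r v * sqrt v ^ n * exp (- x * sqrt v))"
  using svgE_integrand_le[OF assms(2)] svgW_nonneg
  by (intro Bochner_Integration.integrable_bound[OF svgW_integral(1)[OF assms(1)]]) (auto intro!: AE_I2)

lemma svgE_nonneg: "x \<ge> 0 \<Longrightarrow> svgE n r x \<ge> 0"
  unfolding svgE_def by (intro Bochner_Integration.integral_nonneg svgE_integrand_le)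

lemma svgE_0: "r > 0 \<Longrightarrow> svgE 0 r 0 = Beta (1 / 2) (r / 2) / 2"
  unfolding svgE_def using svgW_integral(2) by simp

lemma svgE_le:
  assumes "r > 0" "x \<ge> 0"
  shows "svgE n r x \<le> svgE 0 r 0"
  unfolding svgE_def using svgE_integrable[OF assms] svgE_integrable[OF assms(1), of 0 0] svgE_integrand_le(2)[OF assms(2)]
  by (intro integral_mono) auto

lemma svgE_0_pos: "r > 0 \<Longrightarrow> svgE 0 r 0 > 0"
  by (simp add: svgE_0 Beta_def Gamma_real_pos)

lemma svgE_deriv:
  assumes "r > 0" "x > 0"
  shows "(svgE n r has_real_derivative - svgE (Suc n) r x) (at x)"
proof -
  have "((\<lambda>x. LINT v|lborel. (svgW r v * sqrt v ^ n) * exp (- x * sqrt v)) has_real_derivative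
     - (LINT v|lborel. (svgW r v * sqrt v ^ n) * sqrt v * exp (- x * sqrt v))) (at x)"
    using assms svgE_integrable[OF assms(1)]
    by (intro has_real_derivative_laplace) (auto dest: svgW_sqrt)
  then show ?thesis unfolding svgE_def by (simp add: mult.assoc mult.commute[of "sqrt _" "sqrt _ ^ _"])
qed

lemma svgE_tendsto_0:
  assumes "r > 0"
  shows "(svgE 0 r \<longlongrightarrow> svgE 0 r 0) (at_right 0)"
proof -
  have "((\<lambda>x. svgE 0 r x - svgE 0 r 0) \<longlongrightarrow> 0) (at_right 0)"
  proof (rule Lim_null_comparison)
    show "((\<lambda>x. x * svgE 0 r 0) \<longlongrightarrow> 0) (at_right 0)" by (auto intro!: tendsto_eq_intros)
    show "\<forall>\<^sub>F x in at_right 0. norm (svgE 0 r x - svgE 0 r 0) \<le> x * svgE 0 r 0"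
      using eventually_at_right_less[of 0]
    proof eventually_elim
      case (elim x)
      then have x: "x \<ge> 0" by simp
      have "svgE 0 r 0 - svgE 0 r x = (LINT v|lborel. svgW r v * sqrt v ^ 0 * exp (- 0 * sqrt v) - svgW r v * sqrt v ^ 0 * exp (- x * sqrt v))"
        unfolding svgE_def using assms x
        by (intro Bochner_Integration.integral_diff[symmetric] svgE_integrable) auto
      also have "\<dots> \<le> (LINT v|lborel. x * (svgW r v * sqrt v ^ 0 * exp (- 0 * sqrt v)))"
      proof (intro integral_mono)
        fix v
        show "svgW r v * sqrt v ^ 0 * exp (- 0 * sqrt v) - svgW r v * sqrt v ^ 0 * exp (- x * sqrt v) \<le> x * (svgW r v * sqrt v ^ 0 * exp (- 0 * sqrt v))"
        proof (cases "svgW r v = 0")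
          case False
          from svgW_sqrt[OF this] have s: "0 < sqrt v" "sqrt v < 1" by auto
          have "1 - exp (- x * sqrt v) \<le> x * sqrt v" using exp_ge_add_one_self[of "- x * sqrt v"] by simp
          also have "\<dots> \<le> x" using s x by (simp add: mult_left_le)
          finally show ?thesis using mult_left_mono[OF _ svgW_nonneg[of r v], of "1 - exp (- x * sqrt v)" x]
            by (simp add: algebra_simps)
        qed simp
      qed (use svgE_integrable[OF assms x, of 0] svgE_integrable[OF assms, of 0 0] in \<open>auto intro!: integrable_mult_right Bochner_Integration.integrable_diff\<close>)
      also have "\<dots> = x * svgE 0 r 0" unfolding svgE_def by (rule integral_mult_right_zero)
      finally show ?case using svgE_le[OF assms x, of 0] by simp
    qed
  qed
  then show ?thesis by (simp add: LIM_zero_iff)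
qed

text \<open>The constant 1 is the boundary term at \<open>v = 0\<close> of the total derivative of
  \<open>- (1 - v)^(r/2) exp (- x sqrt v)\<close>; at \<open>v = 1\<close> the positive power kills
  it. Writing \<open>(1 - v)^(r/2)\<close> as \<open>(1 - v)\<close> times the weight's own power
  produces the difference of the moments of order 0 and 2.\<close>

lemma svgE_ode:
  assumes r: "r > 0" and x: "x > 0"
  shows "r * svgE 1 r x - x * svgE 2 r x = 1 - x * svgE 0 r x"
proof -
  let ?e = "\<lambda>v. exp (- x * sqrt v)"
  let ?F = "\<lambda>v. - ((1 - v) powr (r / 2) * ?e v)"
  let ?f = "\<lambda>v. r / 2 * (1 - v) powr (r / 2 - 1) * ?e v + (1 - v) powr (r / 2) * (?e v * (x / (2 * sqrt v)))"
  have e: "?f v = x * (v powr (-1/2) * (1 - v) powr (r / 2 - 1) / 2 * sqrt v ^ 0 * ?e v) - x * (v powr (-1/2) * (1 - v) powr (r / 2 - 1) / 2 * sqrt v ^ 2 * ?e v)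
      + r * (v powr (-1/2) * (1 - v) powr (r / 2 - 1) / 2 * sqrt v ^ 1 * ?e v)" if v: "0 < v" "v < 1" for v
  proof -
    have 1: "(1 - v) powr (r / 2) = (1 - v) * (1 - v) powr (r / 2 - 1)" using v by (simp add: powr_diff)
    have 2: "v powr (-1/2) = 1 / sqrt v" using v by (simp add: powr_minus_divide powr_half_sqrt)
    have 3: "sqrt v ^ 2 = v" using v by simp
    show ?thesis unfolding 1 2 3 using v by (simp add: field_simps)
  qed
  have "(LBINT v=ereal 0..ereal 1. ?f v) = 0 - (-1)"
  proof (rule interval_integral_FTC_nonneg(2)[where F = ?F])
    fix v assume "ereal 0 < ereal v" "ereal v < ereal 1"
    then have v: "0 < v" "v < 1" by auto
    show "(?F has_real_derivative ?f v) (at v)"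
      using v by (auto intro!: derivative_eq_intros simp: field_simps)
    show "isCont ?f v" using v by (intro continuous_intros) auto
  next
    show "AE v in lborel. ereal 0 < ereal v \<longrightarrow> ereal v < ereal 1 \<longrightarrow> 0 \<le> ?f v"
      using r x by (intro AE_I2) auto
    have "(?F \<longlongrightarrow> - ((1 - 0) powr (r / 2) * exp (- x * sqrt 0))) (at_right 0)"
      by (intro tendsto_intros) auto
    then show "((?F \<circ> real_of_ereal) \<longlongrightarrow> -1) (at_right (ereal 0))"
      by (simp add: ereal_tendsto_simps)
    have "((\<lambda>v. (1 - v) powr (r / 2)) \<longlongrightarrow> 0) (at_left 1)"
    proof (rule tendsto_zero_powrI)
      show "((\<lambda>v::real. 1 - v) \<longlongrightarrow> 0) (at_left 1)" by (auto intro!: tendsto_eq_intros)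
      show "\<forall>\<^sub>F v::real in at_left 1. 0 \<le> 1 - v" by (rule eventually_at_leftI[of 0]) auto
      show "((\<lambda>v::real. r / 2) \<longlongrightarrow> r / 2) (at_left 1)" by simp
    qed (use r in simp)
    then have "(?F \<longlongrightarrow> - (0 * exp (- x * sqrt 1))) (at_left 1)"
      by (intro tendsto_intros)
    then show "((?F \<circ> real_of_ereal) \<longlongrightarrow> 0) (at_left (ereal 1))"
      by (simp add: ereal_tendsto_simps)
  qed simp
  then have "1 = (LINT v:{0<..<1}|lborel. ?f v)" by (simp add: interval_lebesgue_integral_def)
  also have "\<dots> = (LINT v|lborel. x * (svgW r v * sqrt v ^ 0 * ?e v) - x * (svgW r v * sqrt v ^ 2 * ?e v) + r * (svgW r v * sqrt v ^ 1 * ?e v))"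
    unfolding set_lebesgue_integral_def
  proof (intro Bochner_Integration.integral_cong refl)
    fix v :: real
    show "indicat_real {0<..<1} v *\<^sub>R ?f v = x * (svgW r v * sqrt v ^ 0 * ?e v) - x * (svgW r v * sqrt v ^ 2 * ?e v) + r * (svgW r v * sqrt v ^ 1 * ?e v)"
    proof (cases "0 < v \<and> v < 1")
      case True
      then show ?thesis using e[of v] unfolding svgW_def by (simp only: indicator_def greaterThanLessThan_iff) simp
    qed (auto simp: svgW_def indicator_def)
  qed
  also have "\<dots> = x * svgE 0 r x - x * svgE 2 r x + r * svgE 1 r x"
    unfolding svgE_def
    by (simp only: Bochner_Integration.integral_add Bochner_Integration.integral_diff integral_mult_right_zero
        integrable_mult_right Bochner_Integration.integrable_diff svgE_integrable[OF r less_imp_le[OF x]] simp_thms)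
  finally show ?thesis by linarith
qed

subsection \<open>Wronskian and monotonicity bounds\<close>

lemma powr_add1: "x > 0 \<Longrightarrow> x powr (r + 1) = x * x powr r" for x r :: real
  by (simp add: powr_add)

lemma powr_deriv:
  fixes x :: real
  assumes "x > 0"
  shows "((\<lambda>x. x powr r) has_real_derivative r * x powr r / x) (at x)"
  using has_real_derivative_powr[OF assms, of r] assms by (simp add: powr_diff)

text \<open>The self-adjoint form \<open>(x^r a')' = x^r a\<close> of the homogeneous equation,
  since \<open>a' = x * besA (r + 2) x\<close>. The analogous statement for \<open>besB\<close>
  carries a sign from \<open>b' = - x * besB (r + 2) x\<close>.\<close>

lemma besA_weighted_deriv:
  assumes "r > 0" "x > 0"
  shows "((\<lambda>x. x powr (r + 1) * besA (r + 2) x) has_real_derivative x powr r * besA r x) (at x)"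
proof -
  have r: "r + 2 > 0" using assms by simp
  have "((\<lambda>x. x powr (r + 1) * besA (r + 2) x) has_real_derivative
     ((r + 1) * x powr (r + 1) / x) * besA (r + 2) x + (x * besA (r + 2 + 2) x) * x powr (r + 1)) (at x)"
    by (intro DERIV_mult powr_deriv besA_deriv assms r)
  also have "r + 2 + 2 = r + 4" by simp
  also have "((r + 1) * x powr (r + 1) / x) * besA (r + 2) x + (x * besA (r + 4) x) * x powr (r + 1) = x powr r * besA r x"
    unfolding besA_rec[OF assms(1), of x] powr_add1[OF assms(2)] using assms by (simp add: field_simps power2_eq_square)
  finally show ?thesis .
qed

lemma besB_weighted_deriv:
  assumes "x > 0"
  shows "((\<lambda>x. x powr (r + 1) * besB (r + 2) x) has_real_derivative - (x powr r * besB r x)) (at x)"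
proof -
  have "((\<lambda>x. x powr (r + 1) * besB (r + 2) x) has_real_derivative
     ((r + 1) * x powr (r + 1) / x) * besB (r + 2) x + (- (x * besB (r + 2 + 2) x)) * x powr (r + 1)) (at x)"
    by (intro DERIV_mult powr_deriv besB_deriv assms)
  also have "r + 2 + 2 = r + 4" by simp
  also have "((r + 1) * x powr (r + 1) / x) * besB (r + 2) x + (- (x * besB (r + 4) x)) * x powr (r + 1) = x powr r * ((r + 1) * besB (r + 2) x - x\<^sup>2 * besB (r + 4) x)"
    unfolding powr_add1[OF assms] using assms by (simp add: field_simps power2_eq_square)
  also have "\<dots> = - (x powr r * besB r x)"
    unfolding besB_rec[OF assms] by (simp add: algebra_simps)
  finally show ?thesis .
qed

lemma besA_isCont: "r > 0 \<Longrightarrow> isCont (besA r) x"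
  by (rule DERIV_isCont[OF besA_deriv])

lemma besB_isCont: "x > 0 \<Longrightarrow> isCont (besB r) x"
  by (rule DERIV_isCont[OF besB_deriv])

lemma besA_tendsto_0: "r > 0 \<Longrightarrow> (besA r \<longlongrightarrow> besA r 0) (at_right 0)"
  using besA_isCont[of r 0] by (simp add: isCont_def filterlim_at_split)

lemma powr_tendsto_0: "r > 0 \<Longrightarrow> ((\<lambda>x::real. x powr r) \<longlongrightarrow> 0) (at_right 0)"
  by (rule tendsto_zero_powrI) (auto intro!: tendsto_eq_intros eventually_at_rightI[of 0 1])

text \<open>Constant by the self-adjoint equations. The constant is read off at the origin, where
  the first product vanishes by \<open>besB_at_0\<close> and the second tends to 1 by
  \<open>besB_order_at_0\<close>.\<close>

lemma wronskian:
  assumes r: "r > 0" and x: "x > 0"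
  shows "x powr (r + 1) * (besA (r + 2) x * besB r x + besA r x * besB (r + 2) x) = 1"
proof -
  let ?W = "\<lambda>x. (x powr (r + 1) * besA (r + 2) x) * besB r x + besA r x * (x powr (r + 1) * besB (r + 2) x)"
  have d: "(?W has_real_derivative 0) (at x)" if "x > 0" for x
  proof -
    have "(?W has_real_derivative
       (x powr r * besA r x) * besB r x + (- (x * besB (r + 2) x)) * (x powr (r + 1) * besA (r + 2) x) +
       ((x * besA (r + 2) x) * (x powr (r + 1) * besB (r + 2) x) + (- (x powr r * besB r x)) * besA r x)) (at x)"
      by (intro DERIV_add DERIV_mult besA_weighted_deriv besB_weighted_deriv besA_deriv besB_deriv r that)
    then show ?thesis by (simp add: algebra_simps)
  qed
  have "((\<lambda>x. x * besA (r + 2) x * (x powr r * besB r x) + besA r x * (x powr (r + 1) * besB (r + 2) x)) \<longlongrightarrow>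
     0 * besA (r + 2) 0 * 0 + besA r 0 * (1 / besA r 0)) (at_right 0)"
    using r by (intro tendsto_intros besA_tendsto_0 besB_at_0 besB_order_at_0) auto
  moreover have "\<forall>\<^sub>F x in at_right 0. x * besA (r + 2) x * (x powr r * besB r x) + besA r x * (x powr (r + 1) * besB (r + 2) x) = ?W x"
    using eventually_at_right_less[of 0] by eventually_elim (simp add: powr_add1)
  ultimately have l: "(?W \<longlongrightarrow> 0 * besA (r + 2) 0 * 0 + besA r 0 * (1 / besA r 0)) (at_right 0)"
    by (rule Lim_transform_eventually)
  then have l1: "(?W \<longlongrightarrow> 1) (at_right 0)" using besA_pos[OF r, of 0] by simp
  have "\<bar>?W x - 1\<bar> \<le> 0"
  proof (rule abs_le_of_deriv_at_right[where a = 0 and f = "\<lambda>x. ?W x - 1" and f' = "\<lambda>_. 0" and g = "\<lambda>_. 0" and g' = "\<lambda>_. 0"])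
    show "((\<lambda>x. ?W x - 1) has_real_derivative 0) (at x)" if "x > 0" for x
      using DERIV_diff[OF d[OF that] DERIV_const[of 1]] by simp
    show "((\<lambda>x. ?W x - 1) \<longlongrightarrow> 0) (at_right 0)" using l1 by (rule LIM_zero)
  qed (use x in auto)
  then show ?thesis by (simp add: algebra_simps)
qed

text \<open>
  By Lagrange's identity for \<open>E\<close> and the homogeneous solutions, \<open>svgP r\<close> and \<open>svgQ r\<close> are the closed forms of
  \<open>P\<close> and \<open>Q\<close>.
\<close>

definition svgP :: "real \<Rightarrow> real \<Rightarrow> real" where
  "svgP r x = x powr (r + 1) * besA (r + 2) x * svgE 0 r x + x powr r * svgE 1 r x * besA r x"

definition svgQ :: "real \<Rightarrow> real \<Rightarrow> real" where
  "svgQ r x = x powr (r + 1) * besB (r + 2) x * svgE 0 r x - x powr r * svgE 1 r x * besB r x"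

lemma svgE1_weighted_deriv:
  assumes "r > 0" "x > 0"
  shows "((\<lambda>x. x powr r * svgE 1 r x) has_real_derivative x powr r / x * (1 - x * svgE 0 r x)) (at x)"
proof -
  have "((\<lambda>x. x powr r * svgE 1 r x) has_real_derivative (r * x powr r / x) * svgE 1 r x + (- svgE (Suc 1) r x) * x powr r) (at x)"
    by (intro DERIV_mult powr_deriv svgE_deriv assms)
  moreover have "Suc 1 = 2" by simp
  moreover have "(r * x powr r / x) * svgE 1 r x + (- svgE 2 r x) * x powr r = x powr r / x * (r * svgE 1 r x - x * svgE 2 r x)"
    using assms by (simp add: field_simps)
  ultimately show ?thesis unfolding svgE_ode[OF assms, symmetric] by metis
qed

lemma svgE0_deriv: "r > 0 \<Longrightarrow> x > 0 \<Longrightarrow> (svgE 0 r has_real_derivative - svgE 1 r x) (at x)"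
  using svgE_deriv[of r x 0] by simp

lemma svgP_deriv:
  assumes "r > 0" "x > 0"
  shows "(svgP r has_real_derivative x powr (r - 1) * besA r x) (at x)"
proof -
  have "(svgP r has_real_derivative
     (x powr r * besA r x) * svgE 0 r x + (- svgE 1 r x) * (x powr (r + 1) * besA (r + 2) x) +
     ((x powr r / x * (1 - x * svgE 0 r x)) * besA r x + (x * besA (r + 2) x) * (x powr r * svgE 1 r x))) (at x)"
    unfolding svgP_def[abs_def]
    by (intro DERIV_add DERIV_mult besA_weighted_deriv svgE1_weighted_deriv svgE0_deriv besA_deriv assms)
  then show ?thesis unfolding powr_add1[OF assms(2)] using assms by (simp add: powr_diff field_simps)
qed

lemma svgQ_deriv:
  assumes "r > 0" "x > 0"
  shows "(svgQ r has_real_derivative - (x powr (r - 1) * besB r x)) (at x)"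
proof -
  have "(svgQ r has_real_derivative
     (- (x powr r * besB r x)) * svgE 0 r x + (- svgE 1 r x) * (x powr (r + 1) * besB (r + 2) x) -
     ((x powr r / x * (1 - x * svgE 0 r x)) * besB r x + (- (x * besB (r + 2) x)) * (x powr r * svgE 1 r x))) (at x)"
    unfolding svgQ_def[abs_def]
    by (intro DERIV_diff DERIV_mult besB_weighted_deriv svgE1_weighted_deriv svgE0_deriv besB_deriv assms)
  then show ?thesis unfolding powr_add1[OF assms(2)] using assms by (simp add: powr_diff field_simps)
qed

lemma svgE_Bfun_0:
  assumes "r > 0" shows "Bfun (svgE n r) (at_right 0)"
  unfolding Bfun_def using svgE_0_pos[OF assms] svgE_le[OF assms] svgE_nonneg
  by (intro exI[of _ "svgE 0 r 0"] conjI eventually_at_rightI[of 0 1]) auto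

lemma svgE_Bfun_top:
  assumes "r > 0" shows "Bfun (svgE n r) at_top"
  unfolding Bfun_def using svgE_0_pos[OF assms] svgE_le[OF assms] svgE_nonneg
  by (intro exI[of _ "svgE 0 r 0"] conjI eventually_at_top_linorderI[of 0]) auto

lemma tendsto_0_mult_Bfun:
  fixes f g :: "real \<Rightarrow> real"
  assumes "(f \<longlongrightarrow> 0) F" "Bfun g F"
  shows "((\<lambda>x. f x * g x) \<longlongrightarrow> 0) F"
  using assms bounded_bilinear.Zfun_prod_Bfun[OF bounded_bilinear_mult, of f F g] by (simp add: tendsto_Zfun_iff)

lemma svgP_at_0:
  assumes "r > 0" shows "(svgP r \<longlongrightarrow> 0) (at_right 0)"
proof -
  have "((\<lambda>x. x powr (r + 1) * besA (r + 2) x) \<longlongrightarrow> 0 * besA (r + 2) 0) (at_right 0)"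
    using assms by (intro tendsto_intros powr_tendsto_0 besA_tendsto_0) auto
  then have "((\<lambda>x. x powr (r + 1) * besA (r + 2) x * svgE 0 r x) \<longlongrightarrow> 0) (at_right 0)"
    by (intro tendsto_0_mult_Bfun[of "\<lambda>x. x powr (r + 1) * besA (r + 2) x"] svgE_Bfun_0 assms) simp
  moreover have "((\<lambda>x. (x powr r * svgE 1 r x) * besA r x) \<longlongrightarrow> 0 * besA r 0) (at_right 0)"
    by (intro tendsto_intros tendsto_0_mult_Bfun svgE_Bfun_0 assms besA_tendsto_0 powr_tendsto_0)
  ultimately have "(svgP r \<longlongrightarrow> 0 + 0 * besA r 0) (at_right 0)"
    unfolding svgP_def[abs_def] by (rule tendsto_add)
  then show ?thesis by simp
qed

lemma svgQ_at_top:
  assumes "r > 0" shows "(svgQ r \<longlongrightarrow> 0) at_top"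
proof -
  have "((\<lambda>x. x powr (r + 1) * besB (r + 2) x * svgE 0 r x) \<longlongrightarrow> 0) at_top"
    by (intro tendsto_0_mult_Bfun svgE_Bfun_top assms besB_decay)
  moreover have "((\<lambda>x. x powr r * besB r x * svgE 1 r x) \<longlongrightarrow> 0) at_top"
    by (intro tendsto_0_mult_Bfun svgE_Bfun_top assms besB_decay)
  ultimately have "((\<lambda>x. x powr (r + 1) * besB (r + 2) x * svgE 0 r x - x powr r * besB r x * svgE 1 r x) \<longlongrightarrow> 0 - 0) at_top"
    by (rule tendsto_diff)
  then show ?thesis unfolding svgQ_def[abs_def] by (simp add: ac_simps)
qed

lemma svgQ_at_0:
  assumes "r > 0" shows "(svgQ r \<longlongrightarrow> svgE 0 r 0 / besA r 0) (at_right 0)"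
proof -
  have "((\<lambda>x. x powr (r + 1) * besB (r + 2) x * svgE 0 r x) \<longlongrightarrow> 1 / besA r 0 * svgE 0 r 0) (at_right 0)"
    by (intro tendsto_intros besB_order_at_0 svgE_tendsto_0 assms)
  moreover have "((\<lambda>x. x powr r * besB r x * svgE 1 r x) \<longlongrightarrow> 0) (at_right 0)"
    by (intro tendsto_0_mult_Bfun svgE_Bfun_0 assms besB_at_0)
  ultimately have "((\<lambda>x. x powr (r + 1) * besB (r + 2) x * svgE 0 r x - x powr r * besB r x * svgE 1 r x) \<longlongrightarrow> 1 / besA r 0 * svgE 0 r 0 - 0) (at_right 0)"
    by (rule tendsto_diff)
  then show ?thesis unfolding svgQ_def[abs_def] by (simp add: ac_simps)
qed

text \<open>The terms with the derivative of \<open>E\<close> cancel and the Wronskian multiplies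
  what is left. This is \<open>G 1 = - E\<close>, and the reason \<open>E\<close> bounds
  \<open>G\<close> for every right-hand side of size one.\<close>

lemma svgE_eq:
  assumes "r > 0" "x > 0"
  shows "besB r x * svgP r x + besA r x * svgQ r x = svgE 0 r x"
proof -
  have "besB r x * svgP r x + besA r x * svgQ r x =
      x powr (r + 1) * (besA (r + 2) x * besB r x + besA r x * besB (r + 2) x) * svgE 0 r x"
    unfolding svgP_def svgQ_def by (simp add: algebra_simps)
  then show ?thesis by (simp add: wronskian[OF assms])
qed

section \<open>Upper bounds for P, Q and the product of the two Bessel functions\<close>

lemma besA_order_le:
  assumes "r > 0" shows "(r + 1) * besA (r + 2) x \<le> besA r x"
  using besA_rec[OF assms, of x] besA_pos[of "r + 4" x] assms by simp

text \<open>As \<open>a\<close> increases, it can be pulled out of the integral of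
  \<open>t^(r-1)\<close> at its value in \<open>x\<close>.\<close>

lemma svgP_le1:
  assumes r: "r > 0" and x: "x > 0"
  shows "svgP r x \<le> x powr r * besA r x / r"
proof -
  let ?f = "\<lambda>x. x powr r * besA r x / r - svgP r x"
  have "0 \<le> ?f x"
  proof (rule nondecreasing_ge_lim_at_right[where a = 0 and f = ?f and f' = "\<lambda>x. x powr r * (x * besA (r + 2) x) / r"])
    fix x :: real assume x: "x > 0"
    have "(?f has_real_derivative ((r * x powr r / x) * besA r x + (x * besA (r + 2) x) * x powr r) / r - x powr (r - 1) * besA r x) (at x)"
      by (intro DERIV_diff DERIV_cdivide DERIV_mult powr_deriv besA_deriv svgP_deriv r x)
    then show "(?f has_real_derivative x powr r * (x * besA (r + 2) x) / r) (at x)"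
      using r x by (simp add: powr_diff field_simps)
    show "x powr r * (x * besA (r + 2) x) / r \<ge> 0" using x r besA_pos[of "r + 2" x] by simp
  next
    have "(?f \<longlongrightarrow> 0 * besA r 0 / r - 0) (at_right 0)"
      using r by (intro tendsto_intros powr_tendsto_0 besA_tendsto_0 svgP_at_0) auto
    then show "(?f \<longlongrightarrow> 0) (at_right 0)" by simp
  qed fact
  then show ?thesis by simp
qed

text \<open>Bounds P through \<open>a'\<close> instead of \<open>a\<close>, which brings
  \<open>bessel_product_bound\<close> into play when an extra factor \<open>x\<close> has to be
  controlled. The coefficient is chosen so that \<open>(1 + 1/r) * r = r + 1\<close>: all terms with
  \<open>besA (r + 2)\<close> then cancel in the derivative of the difference.\<close>

lemma svgP_le2:
  assumes r: "r > 0" and x: "x > 0"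
  shows "svgP r x \<le> (1 + 1 / r) * (x powr r * besA (r + 2) x)"
proof -
  let ?f = "\<lambda>x. (1 + 1 / r) * (x powr r * besA (r + 2) x) - svgP r x"
  have r2: "r + 2 > 0" using r by simp
  have "0 \<le> ?f x"
  proof (rule nondecreasing_ge_lim_at_right[where a = 0 and f = ?f and f' = "\<lambda>x. x powr r * (x * besA (r + 4) x) / r"])
    fix x :: real assume x: "x > 0"
    have "(?f has_real_derivative (1 + 1 / r) * ((r * x powr r / x) * besA (r + 2) x + (x * besA (r + 2 + 2) x) * x powr r) - x powr (r - 1) * besA r x) (at x)"
      by (intro DERIV_diff DERIV_cmult DERIV_mult powr_deriv besA_deriv svgP_deriv r r2 x)
    also have "r + 2 + 2 = r + 4" by simp
    also have "(1 + 1 / r) * ((r * x powr r / x) * besA (r + 2) x + (x * besA (r + 4) x) * x powr r) - x powr (r - 1) * besA r x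
       = x powr r * (x * besA (r + 4) x) / r"
      unfolding besA_rec[OF r, of x] using r x by (simp add: powr_diff field_simps power2_eq_square)
    finally show "(?f has_real_derivative x powr r * (x * besA (r + 4) x) / r) (at x)" .
    show "x powr r * (x * besA (r + 4) x) / r \<ge> 0" using x r besA_pos[of "r + 4" x] by simp
  next
    have "(?f \<longlongrightarrow> (1 + 1 / r) * (0 * besA (r + 2) 0) - 0) (at_right 0)"
      using r by (intro tendsto_intros powr_tendsto_0 besA_tendsto_0 svgP_at_0) auto
    then show "(?f \<longlongrightarrow> 0) (at_right 0)" by simp
  qed fact
  then show ?thesis by simp
qed

lemma svgQ_le:
  assumes r: "r > 0" and x: "x > 0"
  shows "svgQ r x \<le> x powr r * besB (r + 2) x"
proof -
  let ?f = "\<lambda>x. x powr r * besB (r + 2) x - svgQ r x"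
  have "0 \<le> ?f x"
  proof (rule nonincreasing_ge_lim_at_top[where a = 0 and f = ?f and f' = "\<lambda>x. - (x powr r * besB (r + 2) x / x)"])
    fix x :: real assume x: "x > 0"
    have "(?f has_real_derivative ((r * x powr r / x) * besB (r + 2) x + (- (x * besB (r + 2 + 2) x)) * x powr r) - - (x powr (r - 1) * besB r x)) (at x)"
      by (intro DERIV_diff DERIV_mult powr_deriv besB_deriv svgQ_deriv r x)
    also have "r + 2 + 2 = r + 4" by simp
    also have "((r * x powr r / x) * besB (r + 2) x + (- (x * besB (r + 4) x)) * x powr r) - - (x powr (r - 1) * besB r x)
      = x powr r / x * (r * besB (r + 2) x - x\<^sup>2 * besB (r + 4) x + besB r x)"
      using x by (simp add: powr_diff field_simps power2_eq_square)
    also have "\<dots> = - (x powr r * besB (r + 2) x / x)"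
      unfolding besB_rec[OF x] using x by (simp add: field_simps)
    finally show "(?f has_real_derivative - (x powr r * besB (r + 2) x / x)) (at x)" .
    show "- (x powr r * besB (r + 2) x / x) \<le> 0" using x besB_nonneg[of "r + 2" x] by simp
  next
    have "(?f \<longlongrightarrow> 0 - 0) at_top"
      by (intro tendsto_diff besB_decay svgQ_at_top r)
    then show "(?f \<longlongrightarrow> 0) at_top" by simp
  qed fact
  then show ?thesis by simp
qed

text \<open>
  The next two bounds say that \<open>p = x\<^sup>1\<^sup>/\<^sup>2 I\<^sub>\<nu>\<^sub>+\<^sub>1\<close> and \<open>q = x\<^sup>1\<^sup>/\<^sup>2 K\<^sub>\<nu>\<^sub>+\<^sub>1\<close> satisfy \<open>p' \<ge> p\<close> and \<open>q' \<le> - q\<close>: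
  both solve \<open>u'' = V u\<close> with \<open>V \<ge> 1\<close>. As \<open>p' q - p q' = 1\<close>, this gives \<open>p q \<le> 1/2\<close>.
\<close>

lemma besA_ratio_bound:
  assumes r: "r > 0" and x: "x > 0"
  shows "(x + r / 2) * besA (r + 2) x \<le> besA r x"
proof -
  \<comment> \<open>With \<open>p = x^(r/2 + 1) * besA (r + 2) x\<close> this is
    \<open>exp x * (p' - p)\<close>, whose derivative is
    \<open>exp x * (p'' - p) = exp x * (V - 1) * p\<close>. Here
    \<open>V - 1 = ((nu + 1)^2 - 1/4) / x^2\<close>, and the numerator is
    \<open>r / 2 + r^2 / 4\<close>.\<close>
  let ?f = "\<lambda>x. (exp x * x powr (r / 2)) * (besA r x - (x + r / 2) * besA (r + 2) x)"
  let ?f' = "\<lambda>x. (exp x * x powr (r / 2)) * (besA (r + 2) x * (r / 2 + r\<^sup>2 / 4) / x)"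
  have r2: "r + 2 > 0" using r by simp
  have "0 \<le> ?f x"
  proof (rule nondecreasing_ge_lim_at_right[where a = 0 and f = ?f and f' = ?f'])
    fix x :: real assume x: "x > 0"
    have d: "(?f has_real_derivative (exp x * x powr (r / 2) + (r / 2 * x powr (r / 2) / x) * exp x) * (besA r x - (x + r / 2) * besA (r + 2) x)
        + (x * besA (r + 2) x - ((1 + 0) * besA (r + 2) x + (x * besA (r + 2 + 2) x) * (x + r / 2))) * (exp x * x powr (r / 2))) (at x)"
      by (intro DERIV_diff DERIV_mult DERIV_exp powr_deriv besA_deriv DERIV_add DERIV_ident DERIV_const r r2 x)
    have a4: "besA (r + 2 + 2) x = (besA r x - (r + 1) * besA (r + 2) x) / x\<^sup>2"
      using besA_rec[OF r, of x] x by (simp add: field_simps)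
    show "(?f has_real_derivative ?f' x) (at x)"
      by (rule DERIV_cong[OF d]) (unfold a4, use x in \<open>simp add: field_simps power2_eq_square\<close>)
    show "?f' x \<ge> 0" using x r besA_pos[of "r + 2" x] by simp
  next
    have "(?f \<longlongrightarrow> (exp 0 * 0) * (besA r 0 - (0 + r / 2) * besA (r + 2) 0)) (at_right 0)"
      using r by (intro tendsto_intros powr_tendsto_0 besA_tendsto_0) auto
    then show "(?f \<longlongrightarrow> 0) (at_right 0)" by simp
  qed fact
  moreover have "exp x * x powr (r / 2) > 0" using x by simp
  ultimately have "0 \<le> besA r x - (x + r / 2) * besA (r + 2) x" by (simp add: zero_le_mult_iff)
  then show ?thesis by simp
qed

lemma besB_ratio_bound:
  assumes r: "r > 0" and x: "x > 0"
  shows "(x - r / 2) * besB (r + 2) x \<le> besB r x"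
proof -
  \<comment> \<open>With \<open>q = x^(r/2 + 1) * besB (r + 2) x\<close> this is
    \<open>exp (- x) * (- q' - q)\<close>, with derivative \<open>- exp (- x) * (V - 1) * q\<close>.
    The function decreases to 0 at infinity, so it is nonnegative.\<close>
  let ?f = "\<lambda>x. (exp (- x) * x powr (r / 2)) * (besB r x - (x - r / 2) * besB (r + 2) x)"
  let ?f' = "\<lambda>x. - ((exp (- x) * x powr (r / 2)) * (besB (r + 2) x * (r / 2 + r\<^sup>2 / 4) / x))"
  have "0 \<le> ?f x"
  proof (rule nonincreasing_ge_lim_at_top[where a = 0 and f = ?f and f' = ?f'])
    fix x :: real assume x: "x > 0"
    have d: "(?f has_real_derivative ((exp (- x) * - 1) * x powr (r / 2) + (r / 2 * x powr (r / 2) / x) * exp (- x)) * (besB r x - (x - r / 2) * besB (r + 2) x)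
        + (- (x * besB (r + 2) x) - ((1 - 0) * besB (r + 2) x + (- (x * besB (r + 2 + 2) x)) * (x - r / 2))) * (exp (- x) * x powr (r / 2))) (at x)"
      by (intro DERIV_diff DERIV_mult DERIV_fun_exp DERIV_minus powr_deriv besB_deriv DERIV_ident DERIV_const x)
    have b4: "besB (r + 2 + 2) x = (besB r x + (r + 1) * besB (r + 2) x) / x\<^sup>2"
      using besB_rec[OF x, of r] x by (simp add: field_simps)
    show "(?f has_real_derivative ?f' x) (at x)"
      by (rule DERIV_cong[OF d]) (unfold b4, use x in \<open>simp add: field_simps power2_eq_square\<close>)
    show "?f' x \<le> 0" using x r besB_nonneg[of "r + 2" x] by simp
  next
    have e: "((\<lambda>x::real. exp (- x)) \<longlongrightarrow> 0) at_top"
      by (rule filterlim_compose[OF exp_at_bot filterlim_uminus_at_bot_at_top])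
    have "((\<lambda>x. exp (- x) * (x powr (r / 2) * besB r x - x powr (r / 2 + 1) * besB (r + 2) x + r / 2 * (x powr (r / 2) * besB (r + 2) x))) \<longlongrightarrow> 0 * (0 - 0 + r / 2 * 0)) at_top"
      by (intro tendsto_intros besB_decay e)
    moreover have "\<forall>\<^sub>F x in at_top. exp (- x) * (x powr (r / 2) * besB r x - x powr (r / 2 + 1) * besB (r + 2) x + r / 2 * (x powr (r / 2) * besB (r + 2) x)) = ?f x"
      using eventually_gt_at_top[of 0] by eventually_elim (simp add: powr_add algebra_simps)
    ultimately have "(?f \<longlongrightarrow> 0 * (0 - 0 + r / 2 * 0)) at_top" by (rule Lim_transform_eventually)
    then show "(?f \<longlongrightarrow> 0) at_top" by simp
  qed fact
  moreover have "exp (- x) * x powr (r / 2) > 0" using x by simp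
  ultimately have "0 \<le> besB r x - (x - r / 2) * besB (r + 2) x" by (simp add: zero_le_mult_iff)
  then show ?thesis by simp
qed

text \<open>The left side is \<open>x I K\<close> at order nu + 1. In the cross-multiplied sum of
  the two ratio bounds the terms \<open>r / 2\<close> cancel, leaving \<open>2 x\<close> times the
  product against the Wronskian.\<close>

lemma bessel_product_bound:
  assumes r: "r > 0" and x: "x > 0"
  shows "x\<^sup>2 * x powr r * (besA (r + 2) x * besB (r + 2) x) \<le> 1 / 2"
proof -
  have a: "besA (r + 2) x \<ge> 0" using besA_pos[of "r + 2" x] r by simp
  have b: "besB (r + 2) x \<ge> 0" by (rule besB_nonneg)
  have "besA (r + 2) x * ((x - r / 2) * besB (r + 2) x) + (x + r / 2) * besA (r + 2) x * besB (r + 2) x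
     \<le> besA (r + 2) x * besB r x + besA r x * besB (r + 2) x"
    by (intro add_mono mult_left_mono mult_right_mono besA_ratio_bound besB_ratio_bound a b r x)
  then have "x powr (r + 1) * (2 * x * (besA (r + 2) x * besB (r + 2) x)) \<le> x powr (r + 1) * (besA (r + 2) x * besB r x + besA r x * besB (r + 2) x)"
    by (intro mult_left_mono) (auto simp: algebra_simps)
  then show ?thesis unfolding wronskian[OF r x] unfolding powr_add1[OF x] by (simp add: power2_eq_square ac_simps)
qed

subsection \<open>The Green operator\<close>

text \<open>The Wronskian accounts for the 1. The surplus comes from the coefficient
  \<open>1 + 1/r\<close> in \<open>svgP_le2\<close>; after
  \<open>besB r x \<le> x * besB (r + 2) x\<close> it is the Bessel product, at most 1/2, divided by
  \<open>r\<close>.\<close>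

lemma svgE_weighted_le:
  assumes r: "r > 0" and x: "x > 0"
  shows "x * svgE 0 r x \<le> 1 + 1 / (2 * r)"
proof -
  let ?a = "besA r x" and ?a2 = "besA (r + 2) x" and ?b = "besB r x" and ?b2 = "besB (r + 2) x" and ?p = "x powr r"
  have a: "?a > 0" "?a2 > 0" "?b \<ge> 0" "?b2 \<ge> 0" using r by (auto intro: besA_pos besB_nonneg)
  have W: "x * ?p * (?a2 * ?b + ?a * ?b2) = 1"
    using wronskian[OF r x] unfolding powr_add1[OF x] .
  have "svgE 0 r x \<le> ?b * ((1 + 1 / r) * (?p * ?a2)) + ?a * (?p * ?b2)"
    unfolding svgE_eq[OF r x, symmetric] using a
    by (intro add_mono mult_left_mono svgP_le2 svgQ_le r x) auto
  then have "x * svgE 0 r x \<le> x * (?b * ((1 + 1 / r) * (?p * ?a2)) + ?a * (?p * ?b2))"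
    using x by (intro mult_left_mono) auto
  also have "\<dots> = x * ?p * (?a2 * ?b + ?a * ?b2) + x * ?p * ?a2 * ?b / r"
    by (simp add: algebra_simps add_divide_distrib)
  also have "\<dots> \<le> 1 + (1 / 2) / r"
  proof -
    have "x * ?p * ?a2 * ?b \<le> x * ?p * ?a2 * (x * ?b2)"
      using x a r by (intro mult_left_mono besB_le_besB_order) auto
    also have "\<dots> \<le> 1 / 2" using bessel_product_bound[OF r x] by (simp add: power2_eq_square ac_simps)
    finally show ?thesis unfolding W using r by (intro add_left_mono divide_right_mono) auto
  qed
  finally show ?thesis by simp
qed

text \<open>This is \<open>- b' P + a' Q\<close>, the kernel of \<open>G'\<close> integrated in
  absolute value. It plays for \<open>G'\<close> the role that \<open>E\<close> plays for
  \<open>G\<close>.\<close>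

definition svgS :: "real \<Rightarrow> real \<Rightarrow> real" where
  "svgS r x = x * besB (r + 2) x * svgP r x + x * besA (r + 2) x * svgQ r x"

text \<open>For the first bound \<open>svgP_le1\<close> and \<open>besA_order_le\<close> reduce both
  summands to one part of the Wronskian, giving \<open>1 / r + 1 / (r + 1)\<close>. For the second,
  \<open>svgP_le2\<close> and \<open>svgQ_le\<close> make both summands multiples of the Bessel
  product, with total coefficient \<open>2 + 1 / r\<close>.\<close>

lemma svgS_le:
  assumes r: "r > 0" and x: "x > 0"
  shows "svgS r x \<le> 2 / r" "x * svgS r x \<le> 1 + 1 / (2 * r)"
proof -
  let ?a = "besA r x" and ?a2 = "besA (r + 2) x" and ?b = "besB r x" and ?b2 = "besB (r + 2) x" and ?p = "x powr r"
  have a: "?a > 0" "?a2 > 0" "?b \<ge> 0" "?b2 \<ge> 0" using r by (auto intro: besA_pos besB_nonneg)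
  have W: "x * ?p * (?a2 * ?b + ?a * ?b2) = 1"
    using wronskian[OF r x] unfolding powr_add1[OF x] .
  have W1: "x * ?p * (?a * ?b2) \<le> 1"
    using W a x by (simp add: distrib_left) (smt (verit) mult_nonneg_nonneg powr_ge_zero)
  have "svgS r x \<le> x * ?b2 * (?p * ?a / r) + x * ?a2 * (?p * ?b2)"
    unfolding svgS_def using a x by (intro add_mono mult_left_mono svgP_le1 svgQ_le r) auto
  also have "x * ?a2 * (?p * ?b2) \<le> x * (?a / (r + 1)) * (?p * ?b2)"
    using besA_order_le[OF r, of x] x a r by (intro mult_left_mono mult_right_mono) (auto simp: field_simps)
  also have "x * ?b2 * (?p * ?a / r) + x * (?a / (r + 1)) * (?p * ?b2) = x * ?p * (?a * ?b2) * (1 / r + 1 / (r + 1))"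
    by (simp add: field_simps)
  also have "\<dots> \<le> 1 * (1 / r + 1 / (r + 1))"
    using W1 r by (intro mult_right_mono) auto
  also have "1 / (r + 1) \<le> 1 / r" using r by (simp add: frac_le)
  finally show "svgS r x \<le> 2 / r" by simp
  have "svgS r x \<le> x * ?b2 * ((1 + 1 / r) * (?p * ?a2)) + x * ?a2 * (?p * ?b2)"
    unfolding svgS_def using a x by (intro add_mono mult_left_mono svgP_le2 svgQ_le r) auto
  then have "x * svgS r x \<le> x * (x * ?b2 * ((1 + 1 / r) * (?p * ?a2)) + x * ?a2 * (?p * ?b2))"
    using x by (intro mult_left_mono) auto
  also have "\<dots> = x\<^sup>2 * ?p * (?a2 * ?b2) * (2 + 1 / r)"
    by (simp add: algebra_simps power2_eq_square)
  also have "\<dots> \<le> 1 / 2 * (2 + 1 / r)"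
    using bessel_product_bound[OF r x] r by (intro mult_right_mono) auto
  finally show "x * svgS r x \<le> 1 + 1 / (2 * r)" by (simp add: field_simps)
qed

definition greenX :: "real \<Rightarrow> (real \<Rightarrow> real) \<Rightarrow> real \<Rightarrow> real" where
  "greenX r k x = (LINT t:{0<..x}|lborel. t powr (r - 1) * besA r t * k t)"

definition greenY :: "real \<Rightarrow> (real \<Rightarrow> real) \<Rightarrow> real \<Rightarrow> real" where
  "greenY r k x = (LINT t:{x<..}|lborel. t powr (r - 1) * besB r t * k t)"

definition green :: "real \<Rightarrow> (real \<Rightarrow> real) \<Rightarrow> real \<Rightarrow> real" where
  "green r k x = - besB r x * greenX r k x - besA r x * greenY r k x"

text \<open>Only the outer factors are differentiated: the contributions of the moving limits of
  integration cancel.\<close>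

definition green' :: "real \<Rightarrow> (real \<Rightarrow> real) \<Rightarrow> real \<Rightarrow> real" where
  "green' r k x = x * besB (r + 2) x * greenX r k x - x * besA (r + 2) x * greenY r k x"

text \<open>Confined to \<open>t > 0\<close> because each half-line is mapped there.
  \<open>B = 0\<close> is the bounded case; Lipschitz functions have a positive slope
  \<open>B\<close>.\<close>

definition growth :: "real \<Rightarrow> real \<Rightarrow> (real \<Rightarrow> real) \<Rightarrow> bool" where
  "growth A B k \<longleftrightarrow> k \<in> borel_measurable borel \<and> 0 \<le> A \<and> 0 \<le> B \<and> (\<forall>t>0. \<bar>k t\<bar> \<le> A + B * t)"

section \<open>Integrability and absolute bounds for the Green potential\<close>

lemma besA_measurable [measurable]: "r > 0 \<Longrightarrow> besA r \<in> borel_measurable borel"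
  by (intro borel_measurable_continuous_onI continuous_at_imp_continuous_on ballI besA_isCont)

lemma besB_measurable [measurable]: "besB r \<in> borel_measurable borel"
  unfolding besB_def[abs_def] bessel_K_def[abs_def] set_lebesgue_integral_def by measurable

lemma set_integral_abs_bound:
  fixes f g :: "real \<Rightarrow> real"
  assumes g: "set_integrable lborel S g" and [measurable]: "f \<in> borel_measurable borel" "S \<in> sets borel"
    and le: "\<And>t. t \<in> S \<Longrightarrow> \<bar>f t\<bar> \<le> g t"
  shows "set_integrable lborel S f" "\<bar>LINT t:S|lborel. f t\<bar> \<le> (LINT t:S|lborel. g t)"
proof -
  show f: "set_integrable lborel S f"
    by (rule set_integrable_bound[OF g]) (auto simp: set_borel_measurable_def dest!: le)
  show "\<bar>LINT t:S|lborel. f t\<bar> \<le> (LINT t:S|lborel. g t)"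
    unfolding set_lebesgue_integral_def real_norm_def[symmetric]
    using f g unfolding set_integrable_def
    by (intro Bochner_Integration.integral_norm_bound_integral) (auto simp: indicator_def dest: le)
qed

lemma besA_integral:
  assumes "r > 0" "x > 0"
  shows "set_integrable lborel {0<..x} (\<lambda>t. t powr (r - 1) * besA r t)"
    "(LINT t:{0<..x}|lborel. t powr (r - 1) * besA r t) = svgP r x"
    "set_integrable lborel {0<..x} (\<lambda>t. t powr r * besA r t)"
    "(LINT t:{0<..x}|lborel. t powr r * besA r t) = x powr (r + 1) * besA (r + 2) x"
proof -
  have c: "isCont (\<lambda>t. t powr p * besA r t) t" if "t > 0" for t p
    using that assms by (intro continuous_intros besA_isCont) auto
  have n: "t powr p * besA r t \<ge> 0" for t p using besA_pos[OF assms(1), of t] by simp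
  have l: "((\<lambda>x. x powr (r + 1) * besA (r + 2) x) \<longlongrightarrow> 0) (at_right 0)"
    using tendsto_mult[OF powr_tendsto_0[of "r + 1"] besA_tendsto_0[of "r + 2"]] assms by simp
  show "set_integrable lborel {0<..x} (\<lambda>t. t powr (r - 1) * besA r t)"
    "(LINT t:{0<..x}|lborel. t powr (r - 1) * besA r t) = svgP r x"
    by (rule set_integral_FTC_from_0[where F = "svgP r"]; intro svgP_deriv svgP_at_0 assms c n; assumption)+
  show "set_integrable lborel {0<..x} (\<lambda>t. t powr r * besA r t)"
    "(LINT t:{0<..x}|lborel. t powr r * besA r t) = x powr (r + 1) * besA (r + 2) x"
    by (rule set_integral_FTC_from_0[where F = "\<lambda>x. x powr (r + 1) * besA (r + 2) x"]; intro besA_weighted_deriv l assms c n; assumption)+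
qed

text \<open>The endpoint values enter as right limits so that \<open>x = 0\<close> is covered: there
  \<open>svgQ r\<close> and \<open>x powr (r + 1) * besB (r + 2) x\<close> evaluate to the default
  0, not to their limits.\<close>

lemma besB_integral_general:
  assumes r: "r > 0" and x: "x \<ge> 0" and l1: "(svgQ r \<longlongrightarrow> l1) (at_right x)"
    and l2: "((\<lambda>x. x powr (r + 1) * besB (r + 2) x) \<longlongrightarrow> l2) (at_right x)"
  shows "set_integrable lborel {x<..} (\<lambda>t. t powr (r - 1) * besB r t)"
    "(LINT t:{x<..}|lborel. t powr (r - 1) * besB r t) = l1"
    "set_integrable lborel {x<..} (\<lambda>t. t powr r * besB r t)"
    "(LINT t:{x<..}|lborel. t powr r * besB r t) = l2"
proof -
  have c: "isCont (\<lambda>t. t powr p * besB r t) t" if "t > x" for t p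
    using that x by (intro continuous_intros besB_isCont) auto
  have n: "t powr p * besB r t \<ge> 0" for t p using besB_nonneg[of r t] by simp
  have d1: "(svgQ r has_real_derivative - (t powr (r - 1) * besB r t)) (at t)" if "t > x" for t
    using that x by (intro svgQ_deriv r) auto
  have d2: "((\<lambda>x. x powr (r + 1) * besB (r + 2) x) has_real_derivative - (t powr r * besB r t)) (at t)" if "t > x" for t
    using that x by (intro besB_weighted_deriv) auto
  show "set_integrable lborel {x<..} (\<lambda>t. t powr (r - 1) * besB r t)"
    "(LINT t:{x<..}|lborel. t powr (r - 1) * besB r t) = l1"
    by (rule set_integral_FTC_to_top[OF d1 c n l1 svgQ_at_top[OF r]]; assumption)+
  show "set_integrable lborel {x<..} (\<lambda>t. t powr r * besB r t)"
    "(LINT t:{x<..}|lborel. t powr r * besB r t) = l2"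
    by (rule set_integral_FTC_to_top[OF d2 c n l2 besB_decay]; assumption)+
qed

lemma besB_integral:
  assumes "r > 0" "x > 0"
  shows "set_integrable lborel {x<..} (\<lambda>t. t powr (r - 1) * besB r t)"
    "(LINT t:{x<..}|lborel. t powr (r - 1) * besB r t) = svgQ r x"
    "set_integrable lborel {x<..} (\<lambda>t. t powr r * besB r t)"
    "(LINT t:{x<..}|lborel. t powr r * besB r t) = x powr (r + 1) * besB (r + 2) x"
proof -
  have 1: "(svgQ r \<longlongrightarrow> svgQ r x) (at_right x)"
    using DERIV_isCont[OF svgQ_deriv[OF assms]] by (simp add: isCont_def filterlim_at_split)
  have 2: "((\<lambda>x. x powr (r + 1) * besB (r + 2) x) \<longlongrightarrow> x powr (r + 1) * besB (r + 2) x) (at_right x)"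
    using DERIV_isCont[OF besB_weighted_deriv[OF assms(2)]] by (simp add: isCont_def filterlim_at_split)
  show "set_integrable lborel {x<..} (\<lambda>t. t powr (r - 1) * besB r t)"
    "(LINT t:{x<..}|lborel. t powr (r - 1) * besB r t) = svgQ r x"
    "set_integrable lborel {x<..} (\<lambda>t. t powr r * besB r t)"
    "(LINT t:{x<..}|lborel. t powr r * besB r t) = x powr (r + 1) * besB (r + 2) x"
    using besB_integral_general[OF assms(1) _ 1 2] assms(2) by simp_all
qed

lemmas besB_integral_0 = besB_integral_general[OF _ order_refl svgQ_at_0 besB_order_at_0]

lemma growth_set_integral:
  fixes w k :: "real \<Rightarrow> real"
  assumes k: "growth A B k" and w: "w \<in> borel_measurable borel" "\<And>t. w t \<ge> 0"
    and S: "S \<in> sets borel" "S \<subseteq> {0<..}"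
    and i: "set_integrable lborel S (\<lambda>t. t powr (r - 1) * w t)" "set_integrable lborel S (\<lambda>t. t powr r * w t)"
  shows "set_integrable lborel S (\<lambda>t. t powr (r - 1) * w t * k t)"
    "\<bar>LINT t:S|lborel. t powr (r - 1) * w t * k t\<bar> \<le>
       A * (LINT t:S|lborel. t powr (r - 1) * w t) + B * (LINT t:S|lborel. t powr r * w t)"
proof -
  note [measurable] = w(1) S(1)
  have [measurable]: "k \<in> borel_measurable borel" using k by (simp add: growth_def)
  let ?g = "\<lambda>t. A * (t powr (r - 1) * w t) + B * (t powr r * w t)"
  have g: "set_integrable lborel S ?g"
    by (intro set_integral_add(1) set_integrable_mult_right i)
  have g2: "(LINT t:S|lborel. ?g t) = A * (LINT t:S|lborel. t powr (r - 1) * w t) + B * (LINT t:S|lborel. t powr r * w t)"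
    by (subst set_integral_add(2), (intro set_integrable_mult_right i)+, simp only: set_integral_mult_right)
  have le: "\<bar>t powr (r - 1) * w t * k t\<bar> \<le> ?g t" if "t \<in> S" for t
  proof -
    have t: "t > 0" using that S by auto
    have "\<bar>t powr (r - 1) * w t * k t\<bar> = t powr (r - 1) * w t * \<bar>k t\<bar>"
      using w(2)[of t] by (simp add: abs_mult)
    also have "\<dots> \<le> t powr (r - 1) * w t * (A + B * t)"
      using k t w(2)[of t] by (intro mult_left_mono) (auto simp: growth_def)
    also have "\<dots> = ?g t" using t by (simp add: powr_diff field_simps)
    finally show ?thesis .
  qed
  show "set_integrable lborel S (\<lambda>t. t powr (r - 1) * w t * k t)"
    "\<bar>LINT t:S|lborel. t powr (r - 1) * w t * k t\<bar> \<le>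
       A * (LINT t:S|lborel. t powr (r - 1) * w t) + B * (LINT t:S|lborel. t powr r * w t)"
    unfolding g2[symmetric] by (rule set_integral_abs_bound[OF g]; measurable; rule le; assumption)+
qed

lemma greenX_bound:
  assumes "r > 0" "x > 0" "growth A B k"
  shows "set_integrable lborel {0<..x} (\<lambda>t. t powr (r - 1) * besA r t * k t)"
    "\<bar>greenX r k x\<bar> \<le> A * svgP r x + B * (x powr (r + 1) * besA (r + 2) x)"
proof -
  have n: "besA r t \<ge> 0" for t using besA_pos[OF assms(1), of t] by simp
  note G = growth_set_integral[OF assms(3) besA_measurable[OF assms(1)] n _ _ besA_integral(1,3)[OF assms(1,2)]]
  show "set_integrable lborel {0<..x} (\<lambda>t. t powr (r - 1) * besA r t * k t)"
    using G(1) by (auto simp: subset_iff)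
  show "\<bar>greenX r k x\<bar> \<le> A * svgP r x + B * (x powr (r + 1) * besA (r + 2) x)"
    using G(2) unfolding greenX_def besA_integral(2,4)[OF assms(1,2)] by (auto simp: subset_iff)
qed

lemma greenY_bound:
  assumes "r > 0" "x > 0" "growth A B k"
  shows "set_integrable lborel {x<..} (\<lambda>t. t powr (r - 1) * besB r t * k t)"
    "\<bar>greenY r k x\<bar> \<le> A * svgQ r x + B * (x powr (r + 1) * besB (r + 2) x)"
proof -
  note G = growth_set_integral[OF assms(3) besB_measurable besB_nonneg _ _ besB_integral(1,3)[OF assms(1,2)]]
  show "set_integrable lborel {x<..} (\<lambda>t. t powr (r - 1) * besB r t * k t)"
    using G(1) assms(2) by auto
  show "\<bar>greenY r k x\<bar> \<le> A * svgQ r x + B * (x powr (r + 1) * besB (r + 2) x)"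
    using G(2) assms(2) unfolding greenY_def besB_integral(2,4)[OF assms(1,2)] by auto
qed

lemma greenY_0_bound:
  assumes "r > 0" "growth A B k"
  shows "set_integrable lborel {0<..} (\<lambda>t. t powr (r - 1) * besB r t * k t)"
    "\<bar>greenY r k 0\<bar> \<le> A * (svgE 0 r 0 / besA r 0) + B * (1 / besA r 0)"
proof -
  note G = growth_set_integral[OF assms(2) besB_measurable besB_nonneg _ _ besB_integral_0(1,3)[OF assms(1) assms(1) assms(1)]]
  show "set_integrable lborel {0<..} (\<lambda>t. t powr (r - 1) * besB r t * k t)"
    using G(1) by auto
  show "\<bar>greenY r k 0\<bar> \<le> A * (svgE 0 r 0 / besA r 0) + B * (1 / besA r 0)"
    using G(2) unfolding greenY_def besB_integral_0(2,4)[OF assms(1) assms(1) assms(1)] by auto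
qed

lemma green_bound:
  assumes r: "r > 0" and x: "x > 0" and k: "growth A B k"
  shows "\<bar>green r k x\<bar> \<le> A * svgE 0 r x + B"
proof -
  have a: "besA r x \<ge> 0" "besB r x \<ge> 0" using besA_pos[OF r, of x] besB_nonneg[of r x] by auto
  have "\<bar>green r k x\<bar> \<le> \<bar>besB r x * greenX r k x\<bar> + \<bar>besA r x * greenY r k x\<bar>"
    unfolding green_def by linarith
  also have "\<dots> = besB r x * \<bar>greenX r k x\<bar> + besA r x * \<bar>greenY r k x\<bar>"
    using a by (simp add: abs_mult)
  also have "\<dots> \<le> besB r x * (A * svgP r x + B * (x powr (r + 1) * besA (r + 2) x)) + besA r x * (A * svgQ r x + B * (x powr (r + 1) * besB (r + 2) x))"
    by (intro add_mono mult_left_mono greenX_bound greenY_bound assms a)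
  also have "\<dots> = A * (besB r x * svgP r x + besA r x * svgQ r x) + B * (x powr (r + 1) * (besA (r + 2) x * besB r x + besA r x * besB (r + 2) x))"
    by (simp add: algebra_simps)
  also have "\<dots> = A * svgE 0 r x + B" unfolding svgE_eq[OF r x] wronskian[OF r x] by simp
  finally show ?thesis .
qed

lemma green'_bound:
  assumes r: "r > 0" and x: "x > 0" and k: "growth A B k"
  shows "\<bar>green' r k x\<bar> \<le> A * svgS r x + B"
proof -
  have a: "x * besA (r + 2) x \<ge> 0" "x * besB (r + 2) x \<ge> 0" using r x besA_pos[of "r + 2" x] besB_nonneg[of "r + 2" x] by auto
  have B: "B \<ge> 0" using k by (simp add: growth_def)
  have "\<bar>green' r k x\<bar> \<le> \<bar>x * besB (r + 2) x * greenX r k x\<bar> + \<bar>x * besA (r + 2) x * greenY r k x\<bar>"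
    unfolding green'_def by linarith
  also have "\<dots> = x * besB (r + 2) x * \<bar>greenX r k x\<bar> + x * besA (r + 2) x * \<bar>greenY r k x\<bar>"
    using a by (simp only: abs_mult[of "x * _"] abs_of_nonneg)
  also have "\<dots> \<le> x * besB (r + 2) x * (A * svgP r x + B * (x powr (r + 1) * besA (r + 2) x)) + x * besA (r + 2) x * (A * svgQ r x + B * (x powr (r + 1) * besB (r + 2) x))"
    by (intro add_mono mult_left_mono greenX_bound greenY_bound assms a)
  \<comment> \<open>For the right-hand side \<open>t\<close> the two parts of \<open>G'\<close> are
    equal and would cancel; taking absolute values separately turns this into twice the Bessel
    product, hence the contribution \<open>B\<close>.\<close>
  also have "\<dots> = A * svgS r x + B * (2 * (x\<^sup>2 * x powr r * (besA (r + 2) x * besB (r + 2) x)))"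
    unfolding svgS_def powr_add1[OF x] by (simp add: algebra_simps power2_eq_square)
  also have "\<dots> \<le> A * svgS r x + B * (2 * (1 / 2))"
    using bessel_product_bound[OF r x] B by (intro add_left_mono mult_left_mono) auto
  finally show ?thesis by simp
qed

text \<open>With fixed coefficients the increment is a single integral over the interval between
  \<open>x\<close> and \<open>z\<close>. The choice of \<open>c\<close> serves two purposes: the
  integrand's value at \<open>x\<close> gives derivatives, \<open>c = 0\<close> gives Lipschitz
  bounds.\<close>

lemma green_increment:
  assumes r: "r > 0" and k: "growth A B k" and x: "x > 0" and z: "z > 0"
    and le: "\<And>t. min x z \<le> t \<Longrightarrow> t \<le> max x z \<Longrightarrow> \<bar>t powr (r - 1) * (\<alpha> * besA r t - \<beta> * besB r t) * k t - c\<bar> \<le> e"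
  shows "\<bar>(\<alpha> * greenX r k z + \<beta> * greenY r k z) - (\<alpha> * greenX r k x + \<beta> * greenY r k x) - c * (z - x)\<bar> \<le> e * \<bar>z - x\<bar>"
  using x z le
proof (induction x z rule: linorder_wlog)
  case (le x z)
  note x = \<open>0 < x\<close> and z = \<open>0 < z\<close>
  let ?fa = "\<lambda>t. t powr (r - 1) * besA r t * k t" and ?fb = "\<lambda>t. t powr (r - 1) * besB r t * k t"
  have [measurable]: "k \<in> borel_measurable borel" using k by (simp add: growth_def)
  note [measurable] = besA_measurable[OF r]
  have S: "{0<..z} = {0<..x} \<union> {x<..z}" "{x<..} = {x<..z} \<union> {z<..}" using le x z by auto
  have ia: "set_integrable lborel {x<..z} ?fa"
    by (rule set_integrable_subset[OF greenX_bound(1)[OF r z k]]) (use x in auto)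
  have ib: "set_integrable lborel {x<..z} ?fb"
    by (rule set_integrable_subset[OF greenY_bound(1)[OF r x k]]) auto
  have X: "greenX r k z = greenX r k x + (LINT t:{x<..z}|lborel. ?fa t)"
    unfolding greenX_def S(1) by (rule set_integral_Un[OF _ greenX_bound(1)[OF r x k] ia]) auto
  have Y: "greenY r k x = (LINT t:{x<..z}|lborel. ?fb t) + greenY r k z"
    unfolding greenY_def S(2) by (rule set_integral_Un[OF _ ib greenY_bound(1)[OF r z k]]) auto
  let ?f = "\<lambda>t. t powr (r - 1) * (\<alpha> * besA r t - \<beta> * besB r t) * k t - c"
  have one: "set_integrable lborel {x<..z} (\<lambda>t. C::real)" "(LINT t:{x<..z}|lborel. C) = C * (z - x)" for C
    using le by (simp_all add: set_integrable_def set_lebesgue_integral_def)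
  have "(LINT t:{x<..z}|lborel. ?f t) = (LINT t:{x<..z}|lborel. \<alpha> * ?fa t - \<beta> * ?fb t - c)"
    by (simp add: algebra_simps)
  also have "\<dots> = \<alpha> * (LINT t:{x<..z}|lborel. ?fa t) - \<beta> * (LINT t:{x<..z}|lborel. ?fb t) - c * (z - x)"
    by (subst set_integral_diff(2), (intro set_integral_diff(1) set_integrable_mult_right ia ib one)+,
        subst set_integral_diff(2), (intro set_integrable_mult_right ia ib)+, simp only: set_integral_mult_right one)
  finally have eq: "(\<alpha> * greenX r k z + \<beta> * greenY r k z) - (\<alpha> * greenX r k x + \<beta> * greenY r k x) - c * (z - x) = (LINT t:{x<..z}|lborel. ?f t)"
    unfolding X Y by (simp add: algebra_simps)
  have "\<bar>LINT t:{x<..z}|lborel. ?f t\<bar> \<le> (LINT t:{x<..z}|lborel. e)"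
    by (rule set_integral_abs_bound(2)[OF one(1)]) (use le in auto)
  then show ?case unfolding eq one(2) using le by simp
next
  case (sym x z)
  show ?case using sym(1)[OF sym(3,2)] sym(4) by (simp add: min.commute max.commute abs_minus_commute algebra_simps)
qed

lemma has_real_derivative_epsI:
  fixes f :: "real \<Rightarrow> real"
  assumes "\<And>e. e > 0 \<Longrightarrow> \<forall>\<^sub>F z in at x. \<bar>f z - f x - c * (z - x)\<bar> \<le> e * \<bar>z - x\<bar>"
  shows "(f has_real_derivative c) (at x)"
  unfolding has_field_derivative_iff
proof (rule tendstoI)
  fix e :: real assume "e > 0"
  then have "\<forall>\<^sub>F z in at x. \<bar>f z - f x - c * (z - x)\<bar> \<le> e / 2 * \<bar>z - x\<bar>" by (intro assms) simp
  moreover have "\<forall>\<^sub>F z in at x. z \<noteq> x" by (simp add: eventually_at_filter)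
  ultimately show "\<forall>\<^sub>F z in at x. dist ((f z - f x) / (z - x)) c < e"
  proof eventually_elim
    case (elim z)
    have "(f z - f x) / (z - x) - c = (f z - f x - c * (z - x)) / (z - x)"
      using elim by (simp add: field_simps)
    then have "\<bar>(f z - f x) / (z - x) - c\<bar> \<le> e / 2"
      using elim by (simp add: abs_divide field_simps)
    then show ?case using \<open>e > 0\<close> by (simp add: dist_real_def)
  qed
qed

lemma green_combination_deriv:
  assumes r: "r > 0" and k: "growth A B k" and x: "x > 0"
    and c: "isCont (\<lambda>t. t powr (r - 1) * (\<alpha> * besA r t - \<beta> * besB r t) * k t) x"
  shows "((\<lambda>z. \<alpha> * greenX r k z + \<beta> * greenY r k z) has_real_derivative
     x powr (r - 1) * (\<alpha> * besA r x - \<beta> * besB r x) * k x) (at x)"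
proof (rule has_real_derivative_epsI)
  fix e :: real assume e: "e > 0"
  let ?f = "\<lambda>t. t powr (r - 1) * (\<alpha> * besA r t - \<beta> * besB r t) * k t"
  obtain d where d: "d > 0" "\<And>t. \<bar>t - x\<bar> < d \<Longrightarrow> \<bar>?f t - ?f x\<bar> < e"
    using c e unfolding continuous_at_eps_delta dist_real_def by blast
  have "\<forall>\<^sub>F z in at x. \<bar>z - x\<bar> < min d x"
    unfolding eventually_at using d x by (intro exI[of _ "min d x"]) (auto simp: dist_real_def)
  then show "\<forall>\<^sub>F z in at x. \<bar>(\<alpha> * greenX r k z + \<beta> * greenY r k z) - (\<alpha> * greenX r k x + \<beta> * greenY r k x) - ?f x * (z - x)\<bar> \<le> e * \<bar>z - x\<bar>"
  proof eventually_elim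
    case (elim z)
    show ?case
    proof (rule green_increment[OF r k x])
      show "z > 0" using elim x by linarith
      fix t assume "min x z \<le> t" "t \<le> max x z"
      then have "\<bar>t - x\<bar> < d" using elim by linarith
      then show "\<bar>?f t - ?f x\<bar> \<le> e" using d(2) less_imp_le by blast
    qed
  qed
qed

lemma green_combination_locally_lipschitz:
  assumes r: "r > 0" and k: "growth A B k" and x: "x > 0" and e: "e > 0"
  shows "\<forall>\<^sub>F z in at x. \<bar>(\<alpha> * greenX r k z + \<beta> * greenY r k z) - (\<alpha> * greenX r k x + \<beta> * greenY r k x)\<bar>
    \<le> (\<bar>x powr (r - 1) * (\<alpha> * besA r x - \<beta> * besB r x)\<bar> * (A + B * x) + e) * \<bar>z - x\<bar>"
proof -
  let ?P = "\<lambda>z. \<alpha> * greenX r k z + \<beta> * greenY r k z"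
  let ?f = "\<lambda>t. t powr (r - 1) * (\<alpha> * besA r t - \<beta> * besB r t)"
  \<comment> \<open>The growth bound stands in for \<open>|k|\<close>; unlike \<open>k\<close> it is
    continuous, so its value at \<open>x\<close> controls a neighbourhood.\<close>
  let ?g = "\<lambda>t. \<bar>?f t\<bar> * (A + B * t)"
  have "isCont ?g x" using x by (intro continuous_intros besA_isCont besB_isCont r) auto
  then obtain d where d: "d > 0" "\<And>t. \<bar>t - x\<bar> < d \<Longrightarrow> \<bar>?g t - ?g x\<bar> < e"
    using e unfolding continuous_at_eps_delta dist_real_def by blast
  have "\<forall>\<^sub>F z in at x. \<bar>z - x\<bar> < min d x"
    unfolding eventually_at using d x by (intro exI[of _ "min d x"]) (auto simp: dist_real_def)
  then show ?thesis
  proof eventually_elim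
    case (elim z)
    have "\<bar>?P z - ?P x - 0 * (z - x)\<bar> \<le> (?g x + e) * \<bar>z - x\<bar>"
    proof (rule green_increment[OF r k x])
      show z: "z > 0" using elim x by linarith
      fix t assume t: "min x z \<le> t" "t \<le> max x z"
      then have "\<bar>t - x\<bar> < d" using elim by linarith
      then have *: "?g t \<le> ?g x + e" using d(2)[of t] by linarith
      have "t > 0" using t x z by linarith
      then have "\<bar>?f t\<bar> * \<bar>k t\<bar> \<le> ?g t" using k by (intro mult_left_mono) (auto simp: growth_def)
      with * show "\<bar>?f t * k t - 0\<bar> \<le> ?g x + e" unfolding diff_0_right abs_mult[of _ "k t"] by linarith
    qed
    then show ?case by simp
  qed
qed

lemma green_combination_deriv_bound:
  assumes r: "r > 0" and k: "growth M 0 k" and x: "x > 0"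
    and D: "((\<lambda>z. \<alpha> * greenX r k z + \<beta> * greenY r k z) has_real_derivative D) (at x)"
  shows "\<bar>D\<bar> \<le> \<bar>x powr (r - 1) * (\<alpha> * besA r x - \<beta> * besB r x)\<bar> * M"
proof (rule field_le_epsilon)
  fix e :: real assume "e > 0"
  from deriv_abs_le_limit[OF D tendsto_const green_combination_locally_lipschitz[OF r k x this]]
  show "\<bar>D\<bar> \<le> \<bar>x powr (r - 1) * (\<alpha> * besA r x - \<beta> * besB r x)\<bar> * M + e" by simp
qed

lemma green_combination_isCont:
  assumes r: "r > 0" and k: "growth A B k" and x: "x > 0"
  shows "isCont (\<lambda>z. \<alpha> * greenX r k z + \<beta> * greenY r k z) x"
  unfolding isCont_def
proof (rule LIM_zero_cancel, rule Lim_null_comparison)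
  let ?c = "\<bar>x powr (r - 1) * (\<alpha> * besA r x - \<beta> * besB r x)\<bar> * (A + B * x) + 1"
  show "((\<lambda>z. ?c * \<bar>z - x\<bar>) \<longlongrightarrow> 0) (at x)" by (intro tendsto_mult_right_zero tendsto_rabs_zero LIM_zero tendsto_ident_at)
  show "\<forall>\<^sub>F z in at x. norm ((\<alpha> * greenX r k z + \<beta> * greenY r k z) - (\<alpha> * greenX r k x + \<beta> * greenY r k x)) \<le> ?c * \<bar>z - x\<bar>"
    unfolding real_norm_def by (rule green_combination_locally_lipschitz[OF r k x zero_less_one])
qed

lemma greenX_isCont: "r > 0 \<Longrightarrow> growth A B k \<Longrightarrow> x > 0 \<Longrightarrow> isCont (greenX r k) x"
  using green_combination_isCont[of r A B k x 1 0] by simp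

lemma greenY_isCont: "r > 0 \<Longrightarrow> growth A B k \<Longrightarrow> x > 0 \<Longrightarrow> isCont (greenY r k) x"
  using green_combination_isCont[of r A B k x 0 1] by simp

text \<open>Caratheodory's criterion: the first factor vanishes at \<open>x\<close>, so continuity
  of \<open>g\<close> suffices. This is what permits products with \<open>greenX\<close> and
  \<open>greenY\<close>.\<close>

lemma increment_mult_isCont_deriv:
  fixes f g :: "real \<Rightarrow> real"
  assumes "(f has_real_derivative D) (at x)" "isCont g x"
  shows "((\<lambda>z. (f z - f x) * g z) has_real_derivative D * g x) (at x)"
proof -
  obtain h where h: "\<And>z. f z - f x = h z * (z - x)" "isCont h x" "h x = D"
    using assms(1) unfolding CARAT_DERIV by blast
  show ?thesis unfolding CARAT_DERIV
    using h assms(2) by (intro exI[of _ "\<lambda>z. h z * g z"]) (auto intro!: continuous_intros)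
qed

lemma green_deriv:
  assumes r: "r > 0" and k: "growth A B k" and x: "x > 0"
  shows "(green r k has_real_derivative green' r k x) (at x)"
proof -
  let ?f = "\<lambda>t. t powr (r - 1) * (besB r x * besA r t - besA r x * besB r t)"
  let ?h = "\<lambda>t. t powr (r - 1) * (besB r x * besA r t - besA r x * besB r t) * k t"
  have "isCont (\<lambda>t. \<bar>?f t\<bar> * (A + B * t)) x"
    using x by (intro continuous_intros besA_isCont besB_isCont r) auto
  then have l0: "((\<lambda>t. \<bar>?f t\<bar> * (A + B * t)) \<longlongrightarrow> 0) (at x)"
    by (simp add: isCont_def mult.commute)
  have "(?h \<longlongrightarrow> 0) (at x)"
  proof (rule Lim_null_comparison[OF _ l0])
    show "\<forall>\<^sub>F t in at x. norm (?h t) \<le> \<bar>?f t\<bar> * (A + B * t)"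
      using eventually_at_in_open'[of "{0<..}" x] x
    proof (simp, elim eventually_mono)
      fix t :: real assume "t > 0"
      then show "\<bar>?h t\<bar> \<le> \<bar>?f t\<bar> * (A + B * t)"
        unfolding abs_mult[of _ "k t"] using k by (intro mult_left_mono) (auto simp: growth_def)
    qed
  qed
  then have c: "isCont ?h x" by (simp add: isCont_def mult.commute)
  have d1: "((\<lambda>z. besB r x * greenX r k z + besA r x * greenY r k z) has_real_derivative ?h x) (at x)"
    by (rule green_combination_deriv[OF r k x c])
  have *: "green r k = (\<lambda>z. - ((besB r z - besB r x) * greenX r k z) - (besA r z - besA r x) * greenY r k z
       - (besB r x * greenX r k z + besA r x * greenY r k z))"
    unfolding green_def by (auto simp: algebra_simps)
  have "((\<lambda>z. - ((besB r z - besB r x) * greenX r k z) - (besA r z - besA r x) * greenY r k z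
       - (besB r x * greenX r k z + besA r x * greenY r k z)) has_real_derivative
       - ((- (x * besB (r + 2) x)) * greenX r k x) - (x * besA (r + 2) x) * greenY r k x - ?h x) (at x)"
    by (intro DERIV_diff DERIV_minus d1 increment_mult_isCont_deriv besB_deriv besA_deriv r x greenX_isCont[OF r k] greenY_isCont[OF r k])
  then show ?thesis unfolding * green'_def by (simp add: algebra_simps)
qed

lemma besB_order_deriv:
  assumes "x > 0"
  shows "((\<lambda>x. x * besB (r + 2) x) has_real_derivative - (besB r x + r * besB (r + 2) x)) (at x)"
proof -
  have "((\<lambda>x. x * besB (r + 2) x) has_real_derivative 1 * besB (r + 2) x + (- (x * besB (r + 2 + 2) x)) * x) (at x)"
    by (intro DERIV_mult DERIV_ident besB_deriv assms)
  moreover have "1 * besB (r + 2) x + (- (x * besB (r + 2 + 2) x)) * x = - (besB r x + r * besB (r + 2) x)"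
    using besB_rec[OF assms, of r] by (simp add: power2_eq_square algebra_simps)
  ultimately show ?thesis by simp
qed

lemma besA_order_deriv:
  assumes "r > 0"
  shows "((\<lambda>x. x * besA (r + 2) x) has_real_derivative besA r x - r * besA (r + 2) x) (at x)"
proof -
  have "((\<lambda>x. x * besA (r + 2) x) has_real_derivative 1 * besA (r + 2) x + (x * besA (r + 2 + 2) x) * x) (at x)"
    using assms by (intro DERIV_mult DERIV_ident besA_deriv) auto
  moreover have "1 * besA (r + 2) x + (x * besA (r + 2 + 2) x) * x = besA r x - r * besA (r + 2) x"
    using besA_rec[OF assms, of x] by (simp add: power2_eq_square algebra_simps)
  ultimately show ?thesis by simp
qed

text \<open>Separates the part of \<open>G'\<close> that is differentiable for every admissible
  \<open>k\<close>. The subtracted combination, with coefficients frozen at \<open>x\<close>,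
  carries all dependence on the regularity of \<open>k\<close>.\<close>

lemma green'_split_deriv:
  assumes r: "r > 0" and k: "growth A B k" and x: "x > 0"
  shows "((\<lambda>z. green' r k z - (x * besB (r + 2) x * greenX r k z + - (x * besA (r + 2) x) * greenY r k z)) has_real_derivative
     green r k x - r / x * green' r k x) (at x)"
proof -
  let ?b = "\<lambda>z. z * besB (r + 2) z" and ?a = "\<lambda>z. z * besA (r + 2) z"
  have "((\<lambda>z. (?b z - ?b x) * greenX r k z - (?a z - ?a x) * greenY r k z) has_real_derivative
       (- (besB r x + r * besB (r + 2) x)) * greenX r k x - (besA r x - r * besA (r + 2) x) * greenY r k x) (at x)"
    by (intro DERIV_diff increment_mult_isCont_deriv besB_order_deriv besA_order_deriv r x greenX_isCont[OF r k] greenY_isCont[OF r k])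
  moreover have "(- (besB r x + r * besB (r + 2) x)) * greenX r k x - (besA r x - r * besA (r + 2) x) * greenY r k x
     = green r k x - r / x * green' r k x"
    unfolding green_def green'_def using x by (simp add: algebra_simps)
  moreover have "(\<lambda>z. (?b z - ?b x) * greenX r k z - (?a z - ?a x) * greenY r k z) =
     (\<lambda>z. green' r k z - (x * besB (r + 2) x * greenX r k z + - (x * besA (r + 2) x) * greenY r k z))"
    unfolding green'_def by (auto simp: algebra_simps)
  ultimately show ?thesis by simp
qed

lemma green_kernel_diag:
  assumes r: "r > 0" and x: "x > 0"
  shows "x powr (r - 1) * (x * besB (r + 2) x * besA r x - - (x * besA (r + 2) x) * besB r x) = 1 / x"
proof -
  have *: "x powr (r - 1) = x powr (r + 1) / (x * x)" using x by (simp add: powr_diff powr_add)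
  have "x powr (r - 1) * (x * besB (r + 2) x * besA r x - - (x * besA (r + 2) x) * besB r x) =
     x powr (r + 1) * (besA (r + 2) x * besB r x + besA r x * besB (r + 2) x) / x"
    unfolding * using x by (simp add: field_simps)
  then show ?thesis unfolding wronskian[OF r x] .
qed

lemma green'_deriv:
  assumes r: "r > 0" and k: "growth A B k" and x: "x > 0" and c: "isCont k x"
  shows "(green' r k has_real_derivative green r k x - r / x * green' r k x + k x / x) (at x)"
proof -
  let ?P = "\<lambda>z. x * besB (r + 2) x * greenX r k z + - (x * besA (r + 2) x) * greenY r k z"
  have "isCont (\<lambda>t. t powr (r - 1) * (x * besB (r + 2) x * besA r t - - (x * besA (r + 2) x) * besB r t) * k t) x"
    using x by (intro continuous_intros besA_isCont besB_isCont r c) auto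
  from green_combination_deriv[OF r k x this]
  have "(?P has_real_derivative 1 / x * k x) (at x)" unfolding green_kernel_diag[OF r x] .
  from DERIV_add[OF green'_split_deriv[OF r k x] this] show ?thesis by simp
qed

lemma green'_deriv_bound:
  assumes r: "r > 0" and k: "growth M 0 k" and x: "x > 0"
    and D: "(green' r k has_real_derivative D) (at x)"
  shows "\<bar>D - (green r k x - r / x * green' r k x)\<bar> \<le> M / x"
proof -
  let ?P = "\<lambda>z. x * besB (r + 2) x * greenX r k z + - (x * besA (r + 2) x) * greenY r k z"
  have "(?P has_real_derivative D - (green r k x - r / x * green' r k x)) (at x)"
    using DERIV_diff[OF D green'_split_deriv[OF r k x]] by simp
  from green_combination_deriv_bound[OF r k x this] show ?thesis
    unfolding green_kernel_diag[OF r x] using x by simp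
qed

subsection \<open>A priori bounds and the differentiated equation\<close>

text \<open>A quantitative uniqueness statement. \<open>U\<close> and \<open>V\<close> pair
  \<open>g\<close> with \<open>a\<close> and \<open>b\<close> by Lagrange's identity; the conditions
  at 0 and infinity give \<open>U\<close> and \<open>V\<close> zero limits there, so comparison of
  derivatives bounds them by \<open>M\<close> times P and Q. The Wronskian inverts the two relations
  for \<open>g\<close> and \<open>g1\<close>. Thus a solution can be estimated without first writing
  it as a Green potential.\<close>

lemma a_priori_bound:
  fixes g g1 g2 :: "real \<Rightarrow> real"
  assumes r: "r > 0"
    and d1: "\<And>x. x > 0 \<Longrightarrow> (g has_real_derivative g1 x) (at x)"
    and d2: "\<And>x. x > 0 \<Longrightarrow> (g1 has_real_derivative g2 x) (at x)"
    and ode: "\<And>x. x > 0 \<Longrightarrow> \<bar>x * g2 x + r * g1 x - x * g x\<bar> \<le> M"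
    and zero: "((\<lambda>x. x powr r * g1 x) \<longlongrightarrow> 0) (at_right 0)" "((\<lambda>x. x powr (r + 1) * g x) \<longlongrightarrow> 0) (at_right 0)"
    and top: "\<And>x. x \<ge> 1 \<Longrightarrow> \<bar>g x\<bar> \<le> C" "\<And>x. x \<ge> 1 \<Longrightarrow> \<bar>g1 x\<bar> \<le> C"
    and x: "x > 0"
  shows "\<bar>g x\<bar> \<le> M * svgE 0 r x" "\<bar>g1 x\<bar> \<le> M * svgS r x"
proof -
  define H where "H = (\<lambda>x. x * g2 x + r * g1 x - x * g x)"
  define U where "U = (\<lambda>x. x powr r * g1 x * besA r x - x powr (r + 1) * besA (r + 2) x * g x)"
  define V where "V = (\<lambda>x. x powr r * g1 x * besB r x + x powr (r + 1) * besB (r + 2) x * g x)"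
  have w: "((\<lambda>x. x powr r * g1 x) has_real_derivative x powr (r - 1) * (r * g1 x + x * g2 x)) (at x)" if "x > 0" for x
  proof -
    have "((\<lambda>x. x powr r * g1 x) has_real_derivative (r * x powr r / x) * g1 x + g2 x * x powr r) (at x)"
      by (intro DERIV_mult powr_deriv d2 that)
    then show ?thesis using that by (simp add: powr_diff field_simps)
  qed
  have U': "(U has_real_derivative x powr (r - 1) * besA r x * H x) (at x)" if x: "x > 0" for x
  proof -
    have d: "(U has_real_derivative
       (x powr (r - 1) * (r * g1 x + x * g2 x)) * besA r x + (x * besA (r + 2) x) * (x powr r * g1 x)
       - ((x powr r * besA r x) * g x + g1 x * (x powr (r + 1) * besA (r + 2) x))) (at x)"
      unfolding U_def by (intro DERIV_diff DERIV_mult w besA_deriv besA_weighted_deriv d1 r x)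
    show ?thesis by (rule DERIV_cong[OF d]) (unfold powr_add1[OF x] H_def, use x in \<open>simp add: powr_diff field_simps\<close>)
  qed
  have V': "(V has_real_derivative x powr (r - 1) * besB r x * H x) (at x)" if x: "x > 0" for x
  proof -
    have d: "(V has_real_derivative
       (x powr (r - 1) * (r * g1 x + x * g2 x)) * besB r x + (- (x * besB (r + 2) x)) * (x powr r * g1 x)
       + ((- (x powr r * besB r x)) * g x + g1 x * (x powr (r + 1) * besB (r + 2) x))) (at x)"
      unfolding V_def by (intro DERIV_add DERIV_mult w besB_deriv besB_weighted_deriv d1 r x)
    show ?thesis by (rule DERIV_cong[OF d]) (unfold powr_add1[OF x] H_def, use x in \<open>simp add: powr_diff field_simps\<close>)
  qed
  have "((\<lambda>x. x powr r * g1 x * besA r x - x powr (r + 1) * g x * besA (r + 2) x) \<longlongrightarrow> 0 * besA r 0 - 0 * besA (r + 2) 0) (at_right 0)"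
    using r by (intro tendsto_intros zero besA_tendsto_0) auto
  then have U0: "(U \<longlongrightarrow> 0) (at_right 0)" unfolding U_def by (simp add: ac_simps)
  have Bg: "Bfun g at_top" "Bfun g1 at_top"
    unfolding Bfun_def by (intro exI[of _ "\<bar>C\<bar> + 1"] conjI eventually_at_top_linorderI[of 1]; use top in force)+
  have "((\<lambda>x. x powr r * besB r x * g1 x + x powr (r + 1) * besB (r + 2) x * g x) \<longlongrightarrow> 0 + 0) at_top"
    by (intro tendsto_add tendsto_0_mult_Bfun besB_decay Bg)
  then have V0: "(V \<longlongrightarrow> 0) at_top" unfolding V_def by (simp add: ac_simps)
  have U: "\<bar>U x\<bar> \<le> M * svgP r x"
  proof (rule abs_le_of_deriv_at_right[where g = "\<lambda>x. M * svgP r x", OF U' U0 DERIV_cmult[OF svgP_deriv[OF r]] _ _ x])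
    show "((\<lambda>x. M * svgP r x) \<longlongrightarrow> 0) (at_right 0)" by (intro tendsto_mult_right_zero svgP_at_0 r)
    fix t :: real assume t: "t > 0"
    have "\<bar>H t\<bar> * (t powr (r - 1) * besA r t) \<le> M * (t powr (r - 1) * besA r t)"
      using ode[OF t] besA_pos[OF r, of t] unfolding H_def by (intro mult_right_mono) auto
    then show "\<bar>t powr (r - 1) * besA r t * H t\<bar> \<le> M * (t powr (r - 1) * besA r t)"
      using besA_pos[OF r, of t] by (simp add: abs_mult ac_simps)
  qed
  have V: "\<bar>V x\<bar> \<le> M * svgQ r x"
  proof (rule abs_le_of_deriv_at_top[where g = "\<lambda>x. M * svgQ r x", OF V' V0 _ _ _ x])
    show "((\<lambda>x. M * svgQ r x) \<longlongrightarrow> 0) at_top" by (intro tendsto_mult_right_zero svgQ_at_top r)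
    fix t :: real assume t: "t > 0"
    show "((\<lambda>x. M * svgQ r x) has_real_derivative - (M * (t powr (r - 1) * besB r t))) (at t)"
      using DERIV_cmult[OF svgQ_deriv[OF r t], of M] by simp
    have "\<bar>H t\<bar> * (t powr (r - 1) * besB r t) \<le> M * (t powr (r - 1) * besB r t)"
      using ode[OF t] besB_nonneg[of r t] unfolding H_def by (intro mult_right_mono) auto
    then show "\<bar>t powr (r - 1) * besB r t * H t\<bar> \<le> M * (t powr (r - 1) * besB r t)"
      using besB_nonneg[of r t] by (simp add: abs_mult ac_simps)
  qed
  let ?w = "x powr (r + 1) * (besA (r + 2) x * besB r x + besA r x * besB (r + 2) x)"
  have a: "besA r x \<ge> 0" "besB r x \<ge> 0" "x * besA (r + 2) x \<ge> 0" "x * besB (r + 2) x \<ge> 0"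
    using besA_pos[OF r, of x] besA_pos[of "r + 2" x] besB_nonneg[of r x] besB_nonneg[of "r + 2" x] r x by auto
  have "g x = ?w * g x" by (simp add: wronskian[OF r x])
  also have "\<dots> = besA r x * V x - besB r x * U x"
    unfolding U_def V_def by (simp add: algebra_simps)
  finally have "\<bar>g x\<bar> \<le> besA r x * \<bar>V x\<bar> + besB r x * \<bar>U x\<bar>"
    using abs_triangle_ineq4[of "besA r x * V x" "besB r x * U x"] a by (simp add: abs_mult)
  also have "\<dots> \<le> besA r x * (M * svgQ r x) + besB r x * (M * svgP r x)"
    by (intro add_mono mult_left_mono U V a)
  also have "\<dots> = M * svgE 0 r x" unfolding svgE_eq[OF r x, symmetric] by (simp add: algebra_simps)
  finally show "\<bar>g x\<bar> \<le> M * svgE 0 r x" .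
  have "g1 x = ?w * g1 x" by (simp add: wronskian[OF r x])
  also have "\<dots> = (x * besA (r + 2) x) * V x + (x * besB (r + 2) x) * U x"
    unfolding U_def V_def powr_add1[OF x] by (simp add: algebra_simps)
  finally have "\<bar>g1 x\<bar> \<le> (x * besA (r + 2) x) * \<bar>V x\<bar> + (x * besB (r + 2) x) * \<bar>U x\<bar>"
    using abs_triangle_ineq[of "(x * besA (r + 2) x) * V x" "(x * besB (r + 2) x) * U x"] a
    by (simp only: abs_mult[of "x * _"] abs_of_nonneg)
  also have "\<dots> \<le> (x * besA (r + 2) x) * (M * svgQ r x) + (x * besB (r + 2) x) * (M * svgP r x)"
    by (intro add_mono mult_left_mono U V a)
  also have "\<dots> = M * svgS r x" unfolding svgS_def by (simp add: algebra_simps)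
  finally show "\<bar>g1 x\<bar> \<le> M * svgS r x" .
qed

text \<open>The second derivative as prescribed by the equation; it is the derivative of
  \<open>green'\<close> at points where \<open>k\<close> is continuous.\<close>

definition green'' :: "real \<Rightarrow> (real \<Rightarrow> real) \<Rightarrow> real \<Rightarrow> real" where
  "green'' r k x = green r k x - r / x * green' r k x + k x / x"

lemma green_global_bound:
  assumes r: "r > 0" and x: "x > 0" and k: "growth A B k"
  shows "\<bar>green r k x\<bar> \<le> A * svgE 0 r 0 + B" "\<bar>green' r k x\<bar> \<le> A * (2 / r) + B"
    "\<bar>green'' r k x\<bar> \<le> (A * svgE 0 r 0 + B) + r / x * (A * (2 / r) + B) + (A + B * x) / x"
proof -
  have A: "A \<ge> 0" using k by (simp add: growth_def)
  have 1: "A * svgE 0 r x \<le> A * svgE 0 r 0" using A x by (intro mult_left_mono svgE_le r) auto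
  have 2: "A * svgS r x \<le> A * (2 / r)" using A by (intro mult_left_mono svgS_le r x)
  show g0: "\<bar>green r k x\<bar> \<le> A * svgE 0 r 0 + B" using green_bound[OF r x k] 1 by linarith
  show g1: "\<bar>green' r k x\<bar> \<le> A * (2 / r) + B" using green'_bound[OF r x k] 2 by linarith
  have "\<bar>r / x * green' r k x\<bar> \<le> r / x * (A * (2 / r) + B)"
    unfolding abs_mult using r x g1 by (intro mult_mono) auto
  moreover have "\<bar>k x / x\<bar> \<le> (A + B * x) / x"
    unfolding abs_divide using k x by (intro frac_le) (auto simp: growth_def)
  ultimately show "\<bar>green'' r k x\<bar> \<le> (A * svgE 0 r 0 + B) + r / x * (A * (2 / r) + B) + (A + B * x) / x"
    unfolding green''_def using g0 by linarith
qed

lemma green''_deriv: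
  assumes r: "r > 0" and k: "growth A B k" and x: "x > 0" and k': "(k has_real_derivative k') (at x)"
  shows "(green'' r k has_real_derivative
    green' r k x - (r / x * green'' r k x - r / x\<^sup>2 * green' r k x) + (k' / x - k x / x\<^sup>2)) (at x)"
proof -
  have c: "isCont k x" using k' by (rule DERIV_isCont)
  have d1: "(green' r k has_real_derivative green'' r k x) (at x)"
    unfolding green''_def by (rule green'_deriv[OF r k x c])
  have d2: "((\<lambda>x. r / x) has_real_derivative - (r / x\<^sup>2)) (at x)"
    using x by (auto intro!: derivative_eq_intros simp: power2_eq_square)
  have d3: "((\<lambda>x. k x / x) has_real_derivative (k' / x - k x / x\<^sup>2)) (at x)"
    using x by (auto intro!: derivative_eq_intros k' simp: power2_eq_square field_simps)
  define G where "G = green'' r k x"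
  have eq: "green'' r k = (\<lambda>x. green r k x - r / x * green' r k x + k x / x)"
    unfolding green''_def ..
  have d: "((\<lambda>x. green r k x - r / x * green' r k x + k x / x) has_real_derivative
    green' r k x - ((- (r / x\<^sup>2)) * green' r k x + G * (r / x)) + (k' / x - k x / x\<^sup>2)) (at x)"
    by (intro DERIV_add DERIV_diff DERIV_mult green_deriv[OF r k x] d1[folded G_def] d2 d3)
  show ?thesis unfolding G_def[symmetric] unfolding eq by (rule DERIV_cong[OF d]) (simp add: algebra_simps)
qed

text \<open>\<open>green'\<close> satisfies the equation of order \<open>r + 1\<close> with
  right-hand side \<open>G + k'\<close>, and \<open>|G| \<le> A * svgE 0 r 0 + B\<close> together
  with \<open>|k'| \<le> B\<close> explains \<open>M\<close>. In the last bound that equation is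
  solved for its top term: \<open>M\<close> from the right-hand side, \<open>2 M\<close> from
  \<open>(r + 1) G''\<close>, the rest from \<open>x G'\<close>.\<close>

lemma smooth_green_bounds:
  assumes r: "r > 0" and k: "growth A B k" and x: "x > 0"
    and k': "\<And>t. t > 0 \<Longrightarrow> (k has_real_derivative k' t) (at t)" "\<And>t. t > 0 \<Longrightarrow> \<bar>k' t\<bar> \<le> B"
  defines "M \<equiv> A * svgE 0 r 0 + 2 * B"
  shows "\<bar>green' r k x\<bar> \<le> M * svgE 0 (r + 1) x"
    "\<bar>green'' r k x\<bar> \<le> M * svgS (r + 1) x"
    "\<exists>D. (green'' r k has_real_derivative D) (at x) \<and> \<bar>x * D\<bar> \<le> M * (4 + 1 / (2 * (r + 1)))"
proof -
  have AB: "A \<ge> 0" "B \<ge> 0" using k by (auto simp: growth_def)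
  have E0: "svgE 0 r 0 > 0" by (rule svgE_0_pos[OF r])
  define g2 where "g2 = (\<lambda>x. green' r k x - (r / x * green'' r k x - r / x\<^sup>2 * green' r k x) + (k' x / x - k x / x\<^sup>2))"
  have d1: "(green' r k has_real_derivative green'' r k x) (at x)" if "x > 0" for x
    unfolding green''_def by (rule green'_deriv[OF r k that DERIV_isCont[OF k'(1)[OF that]]])
  have d2: "(green'' r k has_real_derivative g2 x) (at x)" if "x > 0" for x
    unfolding g2_def by (rule green''_deriv[OF r k that k'(1)[OF that]])
  have ode: "\<bar>x * g2 x + (r + 1) * green'' r k x - x * green' r k x\<bar> \<le> M" if x: "x > 0" for x
  proof -
    have "x * g2 x = x * green' r k x - (r * green'' r k x - r / x * green' r k x) + (k' x - k x / x)"
      unfolding g2_def using x by (simp add: field_simps power2_eq_square)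
    then have "x * g2 x + (r + 1) * green'' r k x - x * green' r k x = green'' r k x + r / x * green' r k x - k x / x + k' x"
      by (simp add: algebra_simps)
    also have "\<dots> = green r k x + k' x" unfolding green''_def by simp
    finally show ?thesis using k'(2)[OF x] green_global_bound(1)[OF r x k] unfolding M_def by linarith
  qed
  define C1 where "C1 = A * svgE 0 r 0 + B"
  define C2 where "C2 = A * (2 / r) + B"
  have C: "C1 \<ge> 0" "C2 \<ge> 0" unfolding C1_def C2_def using AB r E0 by auto
  \<comment> \<open>\<open>green''\<close> may grow like \<open>1 / x\<close> at the origin; the
    weight of order \<open>r + 1\<close> has just the spare power of \<open>x\<close> to absorb
    it.\<close>
  have z1: "((\<lambda>x. x powr (r + 1) * green'' r k x) \<longlongrightarrow> 0) (at_right 0)"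
  proof (rule Lim_null_comparison)
    show "((\<lambda>x. x powr r * (x * C1 + r * C2 + A + B * x)) \<longlongrightarrow> 0) (at_right 0)"
    proof -
      have "((\<lambda>x. x powr r * (x * C1 + r * C2 + A + B * x)) \<longlongrightarrow> 0 * (0 * C1 + r * C2 + A + B * 0)) (at_right 0)"
        by (intro tendsto_mult tendsto_add tendsto_const tendsto_ident_at powr_tendsto_0 r)
      then show ?thesis by simp
    qed
    show "\<forall>\<^sub>F x in at_right 0. norm (x powr (r + 1) * green'' r k x) \<le> x powr r * (x * C1 + r * C2 + A + B * x)"
      using eventually_at_right_less[of 0]
    proof eventually_elim
      case (elim x)
      have "x * \<bar>green'' r k x\<bar> \<le> x * (C1 + r / x * C2 + (A + B * x) / x)"
        unfolding C1_def C2_def using elim by (intro mult_left_mono green_global_bound(3)[OF r elim k]) auto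
      also have "\<dots> = x * C1 + r * C2 + A + B * x" using elim by (simp add: field_simps)
      finally have "x powr r * (x * \<bar>green'' r k x\<bar>) \<le> x powr r * (x * C1 + r * C2 + A + B * x)"
        by (intro mult_left_mono) auto
      then show ?case unfolding powr_add1[OF elim] using elim by (simp add: abs_mult)
    qed
  qed
  have z2: "((\<lambda>x. x powr (r + 1 + 1) * green' r k x) \<longlongrightarrow> 0) (at_right 0)"
  proof (rule tendsto_0_mult_Bfun)
    show "((\<lambda>x::real. x powr (r + 1 + 1)) \<longlongrightarrow> 0) (at_right 0)" using r by (intro powr_tendsto_0) auto
    show "Bfun (green' r k) (at_right 0)"
      unfolding Bfun_def using C green_global_bound(2)[OF r _ k]
      by (intro exI[of _ "C2 + 1"] conjI eventually_at_rightI[of 0 1]) (force simp: C2_def)+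
  qed
  define C where "C = C1 + r * C2 + A + B + C2"
  have t1: "\<bar>green' r k x\<bar> \<le> C" if "x \<ge> 1" for x
  proof -
    have "0 \<le> r * C2" using r \<open>C2 \<ge> 0\<close> by simp
    then show ?thesis using green_global_bound(2)[OF r _ k, of x] that \<open>C1 \<ge> 0\<close> AB unfolding C_def C2_def by linarith
  qed
  have t2: "\<bar>green'' r k x\<bar> \<le> C" if "x \<ge> 1" for x
  proof -
    have "\<bar>green'' r k x\<bar> \<le> C1 + r / x * C2 + (A + B * x) / x"
      unfolding C1_def C2_def using that by (intro green_global_bound(3)[OF r _ k]) auto
    moreover have "r / x * C2 \<le> r / 1 * C2" using that r C by (intro mult_right_mono divide_left_mono) auto
    moreover have "(A + B * x) / x = A / x + B" using that by (simp add: field_simps)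
    moreover have "A / x \<le> A / 1" using that AB by (intro divide_left_mono) auto
    ultimately show ?thesis using C unfolding C_def by simp
  qed
  have r1: "r + 1 > 0" using r by simp
  show b1: "\<bar>green' r k x\<bar> \<le> M * svgE 0 (r + 1) x"
    by (rule a_priori_bound(1)[OF r1 d1 d2 ode z1 z2 t1 t2 x])
  show b2: "\<bar>green'' r k x\<bar> \<le> M * svgS (r + 1) x"
    by (rule a_priori_bound(2)[OF r1 d1 d2 ode z1 z2 t1 t2 x])
  have M: "M \<ge> 0" unfolding M_def using AB E0 by simp
  have "\<bar>x * g2 x\<bar> \<le> M * (4 + 1 / (2 * (r + 1)))"
  proof -
    have "\<bar>(r + 1) * green'' r k x\<bar> \<le> (r + 1) * (M * (2 / (r + 1)))"
    proof -
      have "M * svgS (r + 1) x \<le> M * (2 / (r + 1))" using M by (intro mult_left_mono svgS_le r1 x)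
      then show ?thesis unfolding abs_mult using b2 r by (intro mult_mono) auto
    qed
    also have "\<dots> = 2 * M" using r by simp
    finally have 1: "\<bar>(r + 1) * green'' r k x\<bar> \<le> 2 * M" .
    have "\<bar>x * green' r k x\<bar> \<le> x * (M * svgE 0 (r + 1) x)"
      unfolding abs_mult using b1 x by (intro mult_mono) auto
    also have "\<dots> = M * (x * svgE 0 (r + 1) x)" by simp
    also have "\<dots> \<le> M * (1 + 1 / (2 * (r + 1)))" using M by (intro mult_left_mono svgE_weighted_le r1 x)
    finally have "\<bar>x * green' r k x\<bar> \<le> M * (1 + 1 / (2 * (r + 1)))" .
    moreover have "M * (4 + 1 / (2 * (r + 1))) = M + 2 * M + M * (1 + 1 / (2 * (r + 1)))" by (simp add: algebra_simps)
    ultimately show ?thesis using 1 ode[OF x] by linarith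
  qed
  then show "\<exists>D. (green'' r k has_real_derivative D) (at x) \<and> \<bar>x * D\<bar> \<le> M * (4 + 1 / (2 * (r + 1)))"
    using d2[OF x] by blast
qed

subsection \<open>Lipschitz right-hand sides\<close>

lemma green_diff:
  assumes r: "r > 0" and x: "x > 0" and k: "growth A B k" and l: "growth A' B' l"
  shows "green r (\<lambda>t. k t - l t) x = green r k x - green r l x"
    "green' r (\<lambda>t. k t - l t) x = green' r k x - green' r l x"
    "green'' r (\<lambda>t. k t - l t) x = green'' r k x - green'' r l x"
proof -
  have X: "greenX r (\<lambda>t. k t - l t) x = greenX r k x - greenX r l x"
    unfolding greenX_def right_diff_distrib by (rule set_integral_diff(2)[OF greenX_bound(1)[OF r x k] greenX_bound(1)[OF r x l]])
  have Y: "greenY r (\<lambda>t. k t - l t) x = greenY r k x - greenY r l x"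
    unfolding greenY_def right_diff_distrib by (rule set_integral_diff(2)[OF greenY_bound(1)[OF r x k] greenY_bound(1)[OF r x l]])
  show 1: "green r (\<lambda>t. k t - l t) x = green r k x - green r l x"
    unfolding green_def X Y by (simp add: algebra_simps)
  show 2: "green' r (\<lambda>t. k t - l t) x = green' r k x - green' r l x"
    unfolding green'_def X Y by (simp add: algebra_simps)
  show "green'' r (\<lambda>t. k t - l t) x = green'' r k x - green'' r l x"
    unfolding green''_def 1 2 by (simp add: algebra_simps diff_divide_distrib)
qed

lemma lipschitz_smoothing:
  fixes k :: "real \<Rightarrow> real"
  assumes lip: "\<And>s t. \<bar>k s - k t\<bar> \<le> L * \<bar>s - t\<bar>" and e: "e > 0"
  obtains l l' where "\<And>t. (l has_real_derivative l' t) (at t)" "\<And>t. \<bar>l' t\<bar> \<le> L" "\<And>t. \<bar>k t - l t\<bar> \<le> L * e"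
proof -
  have L: "L \<ge> 0" using order_trans[OF abs_ge_zero lip[of 0 1]] by simp
  have cont: "isCont k t" for t
    using lip L unfolding continuous_at_eps_delta dist_real_def
  proof (intro allI impI)
    fix \<epsilon> :: real assume \<epsilon>: "\<epsilon> > 0"
    show "\<exists>d>0. \<forall>s. \<bar>s - t\<bar> < d \<longrightarrow> \<bar>k s - k t\<bar> < \<epsilon>"
    proof (intro exI[of _ "\<epsilon> / (L + 1)"] conjI allI impI)
      show "0 < \<epsilon> / (L + 1)" using \<epsilon> L by simp
      fix s assume s: "\<bar>s - t\<bar> < \<epsilon> / (L + 1)"
      have "L * \<bar>s - t\<bar> \<le> (L + 1) * \<bar>s - t\<bar>" by (intro mult_right_mono) auto
      also have "\<dots> < \<epsilon>" using s L by (simp add: field_simps)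
      finally show "\<bar>k s - k t\<bar> < \<epsilon>" using lip[of s t] by linarith
    qed
  qed
  have "\<exists>F. \<forall>t::real. -\<infinity> < ereal t \<longrightarrow> ereal t < \<infinity> \<longrightarrow> (F has_vector_derivative k t) (at t)"
    by (rule einterval_antiderivative) (auto intro: cont)
  then obtain F where F: "\<And>t. (F has_real_derivative k t) (at t)"
    by (auto simp: has_real_derivative_iff_has_vector_derivative)
  \<comment> \<open>The mean of \<open>k\<close> over \<open>[t, t + e]\<close>: its derivative is a
    difference quotient of \<open>k\<close> and inherits the Lipschitz constant.\<close>
  define l where "l = (\<lambda>t. (F (t + e) - F t) / e)"
  define l' where "l' = (\<lambda>t. (k (t + e) - k t) / e)"
  show thesis
  proof
    fix t
    have "((\<lambda>t. F (t + e)) has_real_derivative k (t + e) * 1) (at t)"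
      by (rule DERIV_chain2[OF F]) (auto intro!: derivative_eq_intros)
    then show "(l has_real_derivative l' t) (at t)"
      unfolding l_def l'_def by (intro DERIV_cdivide DERIV_diff F) simp
    show "\<bar>l' t\<bar> \<le> L" unfolding l'_def abs_divide using lip[of "t + e" t] e by (simp add: field_simps)
    have "\<exists>z>t. z < t + e \<and> F (t + e) - F t = (t + e - t) * k z"
      using e by (intro MVT2 F) auto
    then obtain z where z: "t < z" "z < t + e" "F (t + e) - F t = e * k z" by auto
    then have "l t = k z" unfolding l_def using e by simp
    moreover have "\<bar>k t - k z\<bar> \<le> L * \<bar>t - z\<bar>" by (rule lip)
    moreover have "L * \<bar>t - z\<bar> \<le> L * e" using z L by (intro mult_left_mono) auto
    ultimately show "\<bar>k t - l t\<bar> \<le> L * e" by simp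
  qed
qed

lemma le_of_le_add_eps_mult:
  fixes a b c :: real
  assumes "\<And>e. e > 0 \<Longrightarrow> a \<le> b + e * c"
  shows "a \<le> b"
proof (rule field_le_epsilon)
  fix e :: real assume e: "e > 0"
  have "a \<le> b + e / (\<bar>c\<bar> + 1) * c" using e by (intro assms) auto
  also have "e / (\<bar>c\<bar> + 1) * c \<le> e / (\<bar>c\<bar> + 1) * (\<bar>c\<bar> + 1)" using e by (intro mult_left_mono) auto
  also have "\<dots> = e" by (simp add: add_nonneg_eq_0_iff)
  finally show "a \<le> b + e" by simp
qed

text \<open>The intercept \<open>L / svgE 0 r 0\<close> is what makes \<open>M\<close> of
  \<open>smooth_green_bounds\<close> equal to \<open>L + 2 L\<close>, up to an error proportional to
  the smoothing width, which then tends to 0.\<close>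

lemma lipschitz_green_bounds:
  fixes k :: "real \<Rightarrow> real"
  assumes r: "r > 0" and lip: "\<And>s t. \<bar>k s - k t\<bar> \<le> L * \<bar>s - t\<bar>"
    and k: "growth (L / svgE 0 r 0) L k" and x: "x > 0"
  shows "\<bar>green r k x\<bar> \<le> 2 * L"
    "\<bar>green' r k x\<bar> \<le> 3 * L * svgE 0 (r + 1) x"
    "\<bar>green'' r k x\<bar> \<le> 3 * L * svgS (r + 1) x"
    "\<And>D. (green'' r k has_real_derivative D) (at x) \<Longrightarrow> \<bar>x * D\<bar> \<le> 3 * L * (4 + 1 / (2 * (r + 1)))"
proof -
  define E0 where "E0 = svgE 0 r 0"
  have E0: "E0 > 0" unfolding E0_def by (rule svgE_0_pos[OF r])
  have L: "L \<ge> 0" using k by (simp add: growth_def)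
  define K where "K = 4 + 1 / (2 * (r + 1))"
  show "\<bar>green r k x\<bar> \<le> 2 * L" using green_global_bound(1)[OF r x k] E0 unfolding E0_def by simp
  have approx: "\<exists>l. (\<forall>t>0. \<bar>green' r k t - green' r l t\<bar> \<le> e * (2 * L / r)
      \<and> \<bar>green'' r k t - green'' r l t\<bar> \<le> e * (L * E0 + r / t * (2 * L / r) + L / t)
      \<and> \<bar>green' r l t\<bar> \<le> (3 * L + e * (L * E0)) * svgE 0 (r + 1) t
      \<and> \<bar>green'' r l t\<bar> \<le> (3 * L + e * (L * E0)) * svgS (r + 1) t
      \<and> (\<exists>D. (green'' r l has_real_derivative D) (at t) \<and> \<bar>t * D\<bar> \<le> (3 * L + e * (L * E0)) * K))"
    if e: "e > 0" for e
  proof -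
    obtain l l' where l: "\<And>t. (l has_real_derivative l' t) (at t)" "\<And>t. \<bar>l' t\<bar> \<le> L" "\<And>t. \<bar>k t - l t\<bar> \<le> L * e"
      using lipschitz_smoothing[OF lip e] by blast
    have [measurable]: "k \<in> borel_measurable borel" using k by (simp add: growth_def)
    have [measurable]: "l \<in> borel_measurable borel"
      by (intro borel_measurable_continuous_onI continuous_at_imp_continuous_on ballI DERIV_isCont[OF l(1)])
    have gl: "growth (L / E0 + L * e) L l"
      unfolding growth_def
    proof (intro conjI allI impI)
      fix t :: real assume "t > 0"
      then have "\<bar>k t\<bar> \<le> L / E0 + L * t" using k by (simp add: growth_def E0_def)
      then show "\<bar>l t\<bar> \<le> L / E0 + L * e + L * t" using l(3)[of t] by linarith
    qed (use L E0 e in auto)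
    have gd: "growth (L * e) 0 (\<lambda>t. k t - l t)"
      unfolding growth_def using l(3) L e by auto
    have M: "(L / E0 + L * e) * svgE 0 r 0 + 2 * L = 3 * L + e * (L * E0)"
      unfolding E0_def[symmetric] using E0 by (simp add: field_simps)
    note sm = smooth_green_bounds[OF r gl _ l(1,2), unfolded M]
    show ?thesis
    proof (intro exI[of _ l] allI impI conjI)
      fix t :: real assume t: "t > 0"
      show "\<bar>green' r k t - green' r l t\<bar> \<le> e * (2 * L / r)"
        using green_global_bound(2)[OF r t gd] unfolding green_diff[OF r t k gl] by (simp add: ac_simps)
      show "\<bar>green'' r k t - green'' r l t\<bar> \<le> e * (L * E0 + r / t * (2 * L / r) + L / t)"
      proof -
        have "e * (L * E0 + r / t * (2 * L / r) + L / t) = (L * e * svgE 0 r 0 + 0) + r / t * (L * e * (2 / r) + 0) + (L * e + 0 * t) / t"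
          unfolding E0_def by (simp add: algebra_simps)
        then show ?thesis using green_global_bound(3)[OF r t gd] unfolding green_diff[OF r t k gl] by linarith
      qed
      show "\<bar>green' r l t\<bar> \<le> (3 * L + e * (L * E0)) * svgE 0 (r + 1) t" by (rule sm(1)[OF t])
      show "\<bar>green'' r l t\<bar> \<le> (3 * L + e * (L * E0)) * svgS (r + 1) t" by (rule sm(2)[OF t])
      show "\<exists>D. (green'' r l has_real_derivative D) (at t) \<and> \<bar>t * D\<bar> \<le> (3 * L + e * (L * E0)) * K"
        unfolding K_def by (rule sm(3)[OF t])
    qed
  qed
  show "\<bar>green' r k x\<bar> \<le> 3 * L * svgE 0 (r + 1) x"
  proof (rule le_of_le_add_eps_mult)
    fix e :: real assume "e > 0"
    from approx[OF this] obtain l where "\<bar>green' r k x - green' r l x\<bar> \<le> e * (2 * L / r)"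
      "\<bar>green' r l x\<bar> \<le> (3 * L + e * (L * E0)) * svgE 0 (r + 1) x" using x by blast
    then show "\<bar>green' r k x\<bar> \<le> 3 * L * svgE 0 (r + 1) x + e * (2 * L / r + L * E0 * svgE 0 (r + 1) x)"
      by (simp add: distrib_left distrib_right)
  qed
  show "\<bar>green'' r k x\<bar> \<le> 3 * L * svgS (r + 1) x"
  proof (rule le_of_le_add_eps_mult)
    fix e :: real assume "e > 0"
    from approx[OF this] obtain l where "\<bar>green'' r k x - green'' r l x\<bar> \<le> e * (L * E0 + r / x * (2 * L / r) + L / x)"
      "\<bar>green'' r l x\<bar> \<le> (3 * L + e * (L * E0)) * svgS (r + 1) x" using x by blast
    moreover have "(3 * L + e * (L * E0)) * svgS (r + 1) x = 3 * L * svgS (r + 1) x + e * (L * E0 * svgS (r + 1) x)"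
      by (simp add: algebra_simps)
    moreover have "e * (L * E0 + r / x * (2 * L / r) + L / x + L * E0 * svgS (r + 1) x) =
       e * (L * E0 + r / x * (2 * L / r) + L / x) + e * (L * E0 * svgS (r + 1) x)" by (rule distrib_left)
    ultimately show "\<bar>green'' r k x\<bar> \<le> 3 * L * svgS (r + 1) x + e * (L * E0 + r / x * (2 * L / r) + L / x + L * E0 * svgS (r + 1) x)"
      by linarith
  qed
  fix D assume D: "(green'' r k has_real_derivative D) (at x)"
  \<comment> \<open>Smoothing controls values of \<open>green''\<close> but not its derivatives. So
    the mean value theorem is applied to the smoothed potential, the values are exchanged at both
    ends at cost \<open>O(e)\<close>, and \<open>e\<close> tends to 0. The factor
    \<open>1 / min x z\<close> arises because the bound concerns \<open>t * D t\<close>.\<close>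
  have inc: "\<bar>green'' r k z - green'' r k x\<bar> \<le> 3 * L * K / min x z * \<bar>z - x\<bar>" if z: "z > 0" for z
  proof (rule le_of_le_add_eps_mult)
    fix e :: real assume e: "e > 0"
    define M where "M = (3 * L + e * (L * E0)) * K"
    define c where "c = (\<lambda>t. L * E0 + r / t * (2 * L / r) + L / t)"
    from approx[OF e] obtain l where l: "\<And>t. t > 0 \<Longrightarrow> \<bar>green'' r k t - green'' r l t\<bar> \<le> e * c t"
      "\<And>t. t > 0 \<Longrightarrow> \<exists>D. (green'' r l has_real_derivative D) (at t) \<and> \<bar>t * D\<bar> \<le> M"
      unfolding M_def c_def by blast
    then obtain D where D: "\<And>t. t > 0 \<Longrightarrow> (green'' r l has_real_derivative D t) (at t)" "\<And>t. t > 0 \<Longrightarrow> \<bar>t * D t\<bar> \<le> M"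
      by metis
    have m: "min x z > 0" using x z by simp
    have M0: "M \<ge> 0" using D(2)[OF x] by linarith
    have "norm (green'' r l z - green'' r l x) \<le> M / min x z * norm (z - x)"
    proof (rule field_differentiable_bound[where S = "{min x z..max x z}" and f' = D])
      fix t assume t: "t \<in> {min x z..max x z}"
      then have t0: "t > 0" using m by auto
      show "(green'' r l has_field_derivative D t) (at t within {min x z..max x z})"
        using D(1)[OF t0] by (rule has_field_derivative_at_within)
      have "\<bar>D t\<bar> \<le> M / t" using D(2)[OF t0] t0 by (simp add: abs_mult field_simps)
      also have "\<dots> \<le> M / min x z" using t m M0 by (intro divide_left_mono) auto
      finally show "norm (D t) \<le> M / min x z" by simp
    qed auto
    then have "\<bar>green'' r k z - green'' r k x\<bar> \<le> M / min x z * \<bar>z - x\<bar> + e * c z + e * c x"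
      using l(1)[OF x] l(1)[OF z] by (simp only: real_norm_def)
    also have "\<dots> = 3 * L * K / min x z * \<bar>z - x\<bar> + e * (L * E0 * K / min x z * \<bar>z - x\<bar> + c z + c x)"
      unfolding M_def by (simp add: algebra_simps add_divide_distrib)
    finally show "\<bar>green'' r k z - green'' r k x\<bar> \<le> 3 * L * K / min x z * \<bar>z - x\<bar> + e * (L * E0 * K / min x z * \<bar>z - x\<bar> + c z + c x)" .
  qed
  have "\<bar>D\<bar> \<le> 3 * L * K / min x x"
  proof (rule deriv_abs_le_limit[OF D])
    show "((\<lambda>z. 3 * L * K / min x z) \<longlongrightarrow> 3 * L * K / min x x) (at x)"
      using x by (intro tendsto_intros) auto
    have "\<forall>\<^sub>F z in at x. z > 0"
      using eventually_at_in_open'[of "{0<..}" x] x by simp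
    then show "\<forall>\<^sub>F z in at x. \<bar>green'' r k z - green'' r k x\<bar> \<le> 3 * L * K / min x z * \<bar>z - x\<bar>"
      by eventually_elim (rule inc)
  qed
  then show "\<bar>x * D\<bar> \<le> 3 * L * (4 + 1 / (2 * (r + 1)))"
    unfolding K_def[symmetric] using x by (simp add: abs_mult field_simps)
qed

text \<open>By \<open>svgP_le1\<close>, \<open>greenX\<close> is \<open>O(x^r)\<close>, which beats
  the singularity of \<open>b\<close> by \<open>besB_at_0\<close>. The convergence of
  \<open>greenY\<close> follows by dominating its missing piece over \<open>(0, x]\<close> by the
  known integrals of the weights.\<close>

lemma green_tendsto_0:
  assumes r: "r > 0" and k: "growth A B k"
  shows "(green r k \<longlongrightarrow> - besA r 0 * greenY r k 0) (at_right 0)"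
proof -
  have AB: "A \<ge> 0" "B \<ge> 0" using k by (auto simp: growth_def)
  have [measurable]: "k \<in> borel_measurable borel" using k by (simp add: growth_def)
  have "((\<lambda>x. besB r x * greenX r k x) \<longlongrightarrow> 0) (at_right 0)"
  proof (rule Lim_null_comparison)
    let ?g = "\<lambda>x. x powr r * besB r x * (A * (besA r x / r) + B * (x * besA (r + 2) x))"
    have "(?g \<longlongrightarrow> 0 * (A * (besA r 0 / r) + B * (0 * besA (r + 2) 0))) (at_right 0)"
      using r by (intro tendsto_mult tendsto_add tendsto_const tendsto_ident_at tendsto_divide besB_at_0 besA_tendsto_0) auto
    then show "(?g \<longlongrightarrow> 0) (at_right 0)" by simp
    show "\<forall>\<^sub>F x in at_right 0. norm (besB r x * greenX r k x) \<le> ?g x"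
      using eventually_at_right_less[of 0]
    proof eventually_elim
      case (elim x)
      have "norm (besB r x * greenX r k x) = besB r x * \<bar>greenX r k x\<bar>" by (simp add: abs_mult besB_nonneg)
      also have "\<dots> \<le> besB r x * (A * svgP r x + B * (x powr (r + 1) * besA (r + 2) x))"
        by (intro mult_left_mono greenX_bound[OF r elim k] besB_nonneg)
      also have "\<dots> \<le> besB r x * (A * (x powr r * besA r x / r) + B * (x powr (r + 1) * besA (r + 2) x))"
        by (intro mult_left_mono add_right_mono svgP_le1[OF r elim] besB_nonneg AB)
      also have "\<dots> = ?g x" unfolding powr_add1[OF elim] by (simp add: algebra_simps)
      finally show ?case .
    qed
  qed
  moreover have "(greenY r k \<longlongrightarrow> greenY r k 0) (at_right 0)"
  proof -
    let ?f = "\<lambda>p t. t powr p * besB r t" and ?fk = "\<lambda>t. t powr (r - 1) * besB r t * k t"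
    note I0 = besB_integral_0[OF r r r]
    have "((\<lambda>x. greenY r k x - greenY r k 0) \<longlongrightarrow> 0) (at_right 0)"
    proof (rule Lim_null_comparison)
      let ?g = "\<lambda>x. A * (svgE 0 r 0 / besA r 0 - svgQ r x) + B * (1 / besA r 0 - x powr (r + 1) * besB (r + 2) x)"
      have "(?g \<longlongrightarrow> A * (svgE 0 r 0 / besA r 0 - svgE 0 r 0 / besA r 0) + B * (1 / besA r 0 - 1 / besA r 0)) (at_right 0)"
        by (intro tendsto_intros svgQ_at_0 besB_order_at_0 r)
      then show "(?g \<longlongrightarrow> 0) (at_right 0)" by simp
      show "\<forall>\<^sub>F x in at_right 0. norm (greenY r k x - greenY r k 0) \<le> ?g x"
        using eventually_at_right_less[of 0]
      proof eventually_elim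
        case (elim x)
        note I = besB_integral[OF r elim]
        have S: "{0<..} = {0<..x} \<union> {x<..}" "{0<..x} \<inter> {x<..} = {}" "{0<..x} \<subseteq> {0<..}" using elim by auto
        have J: "set_integrable lborel {0<..x} (?f (r - 1))" "set_integrable lborel {0<..x} (?f r)" "set_integrable lborel {0<..x} ?fk"
          by (rule set_integrable_subset[OF I0(1)] set_integrable_subset[OF I0(3)] set_integrable_subset[OF greenY_0_bound(1)[OF r k]];
              use S in simp)+
        have 1: "svgE 0 r 0 / besA r 0 = (LINT t:{0<..x}|lborel. ?f (r - 1) t) + svgQ r x"
          unfolding I0(2)[symmetric] I(2)[symmetric] S(1) by (rule set_integral_Un[OF S(2) J(1) I(1)])
        have 2: "1 / besA r 0 = (LINT t:{0<..x}|lborel. ?f r t) + x powr (r + 1) * besB (r + 2) x"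
          unfolding I0(4)[symmetric] I(4)[symmetric] S(1) by (rule set_integral_Un[OF S(2) J(2) I(3)])
        have 3: "greenY r k 0 = (LINT t:{0<..x}|lborel. ?fk t) + greenY r k x"
          unfolding greenY_def S(1) by (rule set_integral_Un[OF S(2) J(3) greenY_bound(1)[OF r elim k]])
        have "\<bar>LINT t:{0<..x}|lborel. ?fk t\<bar> \<le> A * (LINT t:{0<..x}|lborel. ?f (r - 1) t) + B * (LINT t:{0<..x}|lborel. ?f r t)"
          by (rule growth_set_integral(2)[OF k besB_measurable besB_nonneg _ S(3) J(1,2)]) simp
        then show ?case unfolding 1 2 3 by simp
      qed
    qed
    then show ?thesis by (rule LIM_zero_cancel)
  qed
  ultimately have "((\<lambda>x. - (besB r x * greenX r k x) - besA r x * greenY r k x) \<longlongrightarrow> - 0 - besA r 0 * greenY r k 0) (at_right 0)"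
    by (intro tendsto_intros besA_tendsto_0 r)
  then show ?thesis unfolding green_def[abs_def] by simp
qed

subsection \<open>The Stein solution as a Green potential\<close>

lemma lborel_integrable_halves:
  fixes f :: "real \<Rightarrow> real"
  assumes [measurable]: "f \<in> borel_measurable borel"
    and 1: "set_integrable lborel {0<..} f" and 2: "set_integrable lborel {0<..} (\<lambda>t. f (- t))"
  shows "integrable lborel f"
proof -
  have eq: "indicat_real {0<..} (0 + (-1) * t) *\<^sub>R f (- (0 + (-1) * t)) = indicat_real {..<0} t *\<^sub>R f t" for t :: real
    by (auto simp: indicator_def)
  have "integrable lborel (\<lambda>t. indicat_real {..<0} t *\<^sub>R f t)"
    using lborel_integrable_real_affine[OF 2[unfolded set_integrable_def], of "-1" 0] unfolding eq by simp
  with 1 have "integrable lborel (\<lambda>t. indicat_real {0<..} t *\<^sub>R f t + indicat_real {..<0} t *\<^sub>R f t)"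
    unfolding set_integrable_def by (rule Bochner_Integration.integrable_add)
  moreover have "AE t in lborel. indicat_real {0<..} t *\<^sub>R f t + indicat_real {..<0} t *\<^sub>R f t = f t"
    using AE_lborel_singleton[of 0] by eventually_elim (auto simp: indicator_def)
  ultimately show ?thesis by (subst (asm) integrable_cong_AE) auto
qed

lemma growth_diff_const:
  assumes "growth A B k" shows "growth (A + \<bar>c\<bar>) B (\<lambda>t. k t - c)"
  using assms unfolding growth_def by (auto intro!: order_trans[OF abs_triangle_ineq4])

text \<open>Up to the constant in \<open>svg_pdf_scaled\<close>, the standardised density times
  \<open>k\<close>.\<close>

definition svg_kernel :: "real \<Rightarrow> (real \<Rightarrow> real) \<Rightarrow> real \<Rightarrow> real" where
  "svg_kernel r k t = \<bar>t\<bar> powr (r - 1) * besB r \<bar>t\<bar> * k t"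

lemma svg_kernel_integral:
  assumes r: "r > 0" and m: "k \<in> borel_measurable borel"
    and g: "growth A B (\<lambda>t. k t)" "growth A' B' (\<lambda>t. k (- t))"
  shows "integrable lborel (svg_kernel r k)"
    "(LINT t|lborel. svg_kernel r k t) = greenY r k 0 + greenY r (\<lambda>t. k (- t)) 0"
    "z > 0 \<Longrightarrow> (LINT t:{..- z}|lborel. svg_kernel r k t) = greenY r (\<lambda>t. k (- t)) z"
proof -
  note [measurable] = m
  have [measurable]: "svg_kernel r k \<in> borel_measurable borel"
    unfolding svg_kernel_def[abs_def] by measurable
  have c1: "set_integrable lborel {0<..} (\<lambda>t. t powr (r - 1) * besB r t * k t) \<longleftrightarrow> set_integrable lborel {0<..} (svg_kernel r k)"
    by (rule set_integrable_cong) (auto simp: svg_kernel_def)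
  have c2: "set_integrable lborel {0<..} (\<lambda>t. t powr (r - 1) * besB r t * k (- t)) \<longleftrightarrow> set_integrable lborel {0<..} (\<lambda>t. svg_kernel r k (- t))"
    by (rule set_integrable_cong) (auto simp: svg_kernel_def)
  show i: "integrable lborel (svg_kernel r k)"
    by (rule lborel_integrable_halves) (use greenY_0_bound(1)[OF r g(1)] greenY_0_bound(1)[OF r g(2)] c1 c2 in auto)
  have "(LINT t:{0<..}|lborel. svg_kernel r k t) = greenY r k 0"
    unfolding greenY_def by (rule set_lebesgue_integral_cong) (auto simp: svg_kernel_def)
  moreover have "(LINT t:{0<..}|lborel. svg_kernel r k (- t)) = greenY r (\<lambda>t. k (- t)) 0"
    unfolding greenY_def by (rule set_lebesgue_integral_cong) (auto simp: svg_kernel_def)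
  ultimately show "(LINT t|lborel. svg_kernel r k t) = greenY r k 0 + greenY r (\<lambda>t. k (- t)) 0"
    using lborel_integral_split_reflect(3)[OF i] by simp
  assume z: "z > 0"
  have "(LINT t:{..- z}|lborel. svg_kernel r k t) = (LINT t:{z..}|lborel. svg_kernel r k (- t))"
  proof -
    have eq: "indicat_real {..- z} (0 + (-1) * t) *\<^sub>R svg_kernel r k (0 + (-1) * t) = indicat_real {z..} t *\<^sub>R svg_kernel r k (- t)" for t
      by (auto simp: indicator_def)
    show ?thesis unfolding set_lebesgue_integral_def
      using lborel_integral_real_affine[of "-1" "\<lambda>t. indicat_real {..- z} t *\<^sub>R svg_kernel r k t" 0] unfolding eq by simp
  qed
  also have "\<dots> = (LINT t:{z<..}|lborel. svg_kernel r k (- t))"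
    by (rule set_integral_Ici_eq_Ioi) measurable
  also have "\<dots> = greenY r (\<lambda>t. k (- t)) z"
    unfolding greenY_def by (rule set_lebesgue_integral_cong) (use z in \<open>auto simp: svg_kernel_def\<close>)
  finally show "(LINT t:{..- z}|lborel. svg_kernel r k t) = greenY r (\<lambda>t. k (- t)) z" .
qed

text \<open>The constant is the one that gives mass one, because the weight integrates to
  \<open>svgE 0 r 0 / besA r 0\<close> over each half-line.\<close>

lemma svg_pdf_scaled:
  assumes r: "r > 0" and \<sigma>: "\<sigma> > 0"
  shows "\<sigma> * svg_pdf r \<sigma> \<mu> (\<mu> + \<sigma> * t) = besA r 0 / (2 * svgE 0 r 0) * (\<bar>t\<bar> powr (r - 1) * besB r \<bar>t\<bar>)"
proof (cases "t = 0")
  case False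
  define n where "n = (r - 1) / 2"
  have n: "(1 - r) / 2 = - n" "r - 1 = n + n" "(r + 1) / 2 = n + 1" unfolding n_def by (simp_all add: field_simps)
  have pn: "t powr (r - 1) = t powr n * t powr n" for t by (simp only: n powr_add)
  have E: "svgE 0 r 0 = sqrt pi * Gamma (r / 2) / Gamma (n + 1) / 2"
  proof -
    have "1 / 2 + r / 2 = n + 1" unfolding n_def by (simp add: field_simps)
    then show ?thesis unfolding svgE_0[OF r] Beta_def by (simp only: Gamma_one_half_real)
  qed
  have G: "Gamma (n + 1) > 0" "Gamma (r / 2) > 0" using r by (auto intro!: Gamma_real_pos simp: n_def field_simps)
  have A: "besA r 0 = 2 powr (- n) / Gamma (n + 1)"
    unfolding besA_0 besA_coef_def n by simp
  have "besA r 0 / (2 * svgE 0 r 0) = 2 powr (- n) / (sqrt pi * Gamma (r / 2))"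
    unfolding A E using G by (simp add: field_simps)
  moreover have "\<bar>t\<bar> powr (r - 1) * besB r \<bar>t\<bar> = \<bar>t\<bar> powr n * bessel_K n \<bar>t\<bar>"
    unfolding besB_def n(1) n_def[symmetric] pn using False by (simp add: powr_minus field_simps)
  moreover have "\<sigma> * svg_pdf r \<sigma> \<mu> (\<mu> + \<sigma> * t) = 1 / (sqrt pi * Gamma (r / 2)) * (\<bar>t\<bar> / 2) powr n * bessel_K n \<bar>t\<bar>"
    unfolding svg_pdf_def n_def[symmetric] using \<sigma> by (simp add: abs_mult)
  moreover have "(\<bar>t\<bar> / 2) powr n = \<bar>t\<bar> powr n * 2 powr (- n)"
    by (simp add: powr_divide powr_minus field_simps)
  ultimately show ?thesis by simp
\<comment> \<open>At \<open>t = 0\<close> both sides are 0, by the convention that 0 raised by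
  \<open>powr\<close> is 0.\<close>
qed (use \<sigma> in \<open>simp add: svg_pdf_def\<close>)

text \<open>Unit mass lets \<open>c\<close> move inside the integrals. With \<open>c\<close> the
  mean itself, the two half-line integrals sum to zero; with \<open>c = h \<mu>\<close>, the
  identity measures how far the mean is from the central value.\<close>

lemma svg_expect_eq:
  assumes r: "r > 0" and \<sigma>: "\<sigma> > 0"
    and g: "growth A B (\<lambda>t. h (\<mu> + \<sigma> * t))" "growth A B (\<lambda>t. h (\<mu> - \<sigma> * t))"
  shows "svg_expect r \<sigma> \<mu> h - c = besA r 0 / (2 * svgE 0 r 0) *
     (greenY r (\<lambda>t. h (\<mu> + \<sigma> * t) - c) 0 + greenY r (\<lambda>t. h (\<mu> - \<sigma> * t) - c) 0)"
proof -
  let ?\<kappa> = "besA r 0 / (2 * svgE 0 r 0)"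
  let ?k = "\<lambda>t. h (\<mu> + \<sigma> * t)"
  have m: "?k \<in> borel_measurable borel" using g(1) by (simp add: growth_def)
  have "svg_expect r \<sigma> \<mu> h = \<sigma> * (LINT t|lborel. svg_pdf r \<sigma> \<mu> (\<mu> + \<sigma> * t) * h (\<mu> + \<sigma> * t))"
    unfolding svg_expect_def using \<sigma> by (subst lborel_integral_real_affine[where c = \<sigma> and t = \<mu>]) auto
  also have "\<dots> = (LINT t|lborel. \<sigma> * (svg_pdf r \<sigma> \<mu> (\<mu> + \<sigma> * t) * h (\<mu> + \<sigma> * t)))"
    by (rule integral_mult_right_zero[symmetric])
  also have "\<dots> = (LINT t|lborel. ?\<kappa> * svg_kernel r ?k t)"
    unfolding mult.assoc[symmetric] svg_pdf_scaled[OF r \<sigma>] svg_kernel_def ..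
  also have "\<dots> = ?\<kappa> * (LINT t|lborel. svg_kernel r ?k t)" by (rule integral_mult_right_zero)
  also have "(LINT t|lborel. svg_kernel r ?k t) = greenY r ?k 0 + greenY r (\<lambda>t. ?k (- t)) 0"
    using g by (intro svg_kernel_integral(2)[OF r m]) auto
  also have "greenY r (\<lambda>t. ?k (- t)) 0 = greenY r (\<lambda>t. h (\<mu> - \<sigma> * t)) 0" by simp
  finally have e: "svg_expect r \<sigma> \<mu> h = ?\<kappa> * (greenY r ?k 0 + greenY r (\<lambda>t. h (\<mu> - \<sigma> * t)) 0)" .
  have d: "greenY r (\<lambda>t. k t - c) 0 = greenY r k 0 - c * (svgE 0 r 0 / besA r 0)" if "growth A B k" for k
  proof -
    note I0 = besB_integral_0[OF r r r]
    have "greenY r (\<lambda>t. k t - c) 0 = (LINT t:{0<..}|lborel. t powr (r - 1) * besB r t * k t - c * (t powr (r - 1) * besB r t))"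
      unfolding greenY_def by (simp add: algebra_simps)
    also have "\<dots> = greenY r k 0 - (LINT t:{0<..}|lborel. c * (t powr (r - 1) * besB r t))"
      unfolding greenY_def by (intro set_integral_diff(2) greenY_0_bound(1)[OF r that] set_integrable_mult_right I0(1))
    finally show ?thesis by (simp only: set_integral_mult_right I0(2))
  qed
  have "?\<kappa> * (2 * c * (svgE 0 r 0 / besA r 0)) = c"
    using svgE_0_pos[OF r] besA_pos[OF r, of 0] by (simp add: field_simps)
  then show ?thesis unfolding d[OF g(1)] d[OF g(2)] e by (simp add: algebra_simps)
qed

lemma svg_stein_formula_right:
  assumes r: "r > 0" and \<sigma>: "\<sigma> > 0" and z: "z > 0"
  shows "svg_stein_formula r \<sigma> \<mu> h (\<mu> + \<sigma> * z) = green r (\<lambda>t. h (\<mu> + \<sigma> * t) - svg_expect r \<sigma> \<mu> h) z / \<sigma>"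
proof -
  define n where "n = (r - 1) / 2"
  have n: "(1 - r) / 2 = - n" "r - 1 = n + n" unfolding n_def by (simp_all add: field_simps)
  have pn: "t powr (r - 1) = t powr n * t powr n" for t by (simp only: n powr_add)
  define k where "k = (\<lambda>t. h (\<mu> + \<sigma> * t) - svg_expect r \<sigma> \<mu> h)"
  let ?kt = "\<lambda>t. h (t + \<mu>) - svg_expect r \<sigma> \<mu> h"
  have X: "(LBINT t=ereal 0..ereal (\<sigma> * z). \<bar>t\<bar> powr n * bessel_I n (\<bar>t\<bar> / \<sigma>) * ?kt t) = \<sigma> * \<sigma> powr n * greenX r k z"
  proof -
    have eq: "indicat_real {0<..\<sigma> * z} (0 + \<sigma> * t) *\<^sub>R (\<bar>0 + \<sigma> * t\<bar> powr n * bessel_I n (\<bar>0 + \<sigma> * t\<bar> / \<sigma>) * ?kt (0 + \<sigma> * t))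
        = \<sigma> powr n * (indicat_real {0<..z} t *\<^sub>R (t powr (r - 1) * besA r t * k t))" for t
      using \<sigma> bessel_I_eq_besA[OF r, of t]
      by (auto simp: indicator_def n_def[symmetric] pn powr_mult k_def add.commute zero_less_mult_iff)
    have "(LBINT t=ereal 0..ereal (\<sigma> * z). \<bar>t\<bar> powr n * bessel_I n (\<bar>t\<bar> / \<sigma>) * ?kt t) = (LINT t:{0<..\<sigma> * z}|lborel. \<bar>t\<bar> powr n * bessel_I n (\<bar>t\<bar> / \<sigma>) * ?kt t)"
      using \<sigma> z by (intro interval_integral_Ioc) simp
    also have "\<dots> = \<sigma> * (LINT t|lborel. \<sigma> powr n * (indicat_real {0<..z} t *\<^sub>R (t powr (r - 1) * besA r t * k t)))"
      unfolding set_lebesgue_integral_def using \<sigma>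
      by (subst lborel_integral_real_affine[where c = \<sigma> and t = 0]) (simp, simp only: eq abs_of_pos, simp)
    also have "\<dots> = \<sigma> * \<sigma> powr n * greenX r k z"
      unfolding greenX_def set_lebesgue_integral_def by simp
    finally show ?thesis .
  qed
  have Y: "(LBINT t=ereal (\<sigma> * z)..PInfty. \<bar>t\<bar> powr n * bessel_K n (\<bar>t\<bar> / \<sigma>) * ?kt t) = \<sigma> * \<sigma> powr n * greenY r k z"
  proof -
    have eq: "indicat_real {\<sigma> * z<..} (0 + \<sigma> * t) *\<^sub>R (\<bar>0 + \<sigma> * t\<bar> powr n * bessel_K n (\<bar>0 + \<sigma> * t\<bar> / \<sigma>) * ?kt (0 + \<sigma> * t))
        = \<sigma> powr n * (indicat_real {z<..} t *\<^sub>R (t powr (r - 1) * besB r t * k t))" for t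
      using \<sigma> z
      by (auto simp: indicator_def besB_def n_def[symmetric] n(1) pn powr_minus powr_mult k_def add.commute zero_less_mult_iff)
    have "(LBINT t=ereal (\<sigma> * z)..PInfty. \<bar>t\<bar> powr n * bessel_K n (\<bar>t\<bar> / \<sigma>) * ?kt t) = (LINT t:{\<sigma> * z<..}|lborel. \<bar>t\<bar> powr n * bessel_K n (\<bar>t\<bar> / \<sigma>) * ?kt t)"
      by (simp add: interval_lebesgue_integral_def flip: infinity_ereal_def)
    also have "\<dots> = \<sigma> * (LINT t|lborel. \<sigma> powr n * (indicat_real {z<..} t *\<^sub>R (t powr (r - 1) * besB r t * k t)))"
      unfolding set_lebesgue_integral_def using \<sigma>
      by (subst lborel_integral_real_affine[where c = \<sigma> and t = 0]) (simp, simp only: eq abs_of_pos, simp)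
    also have "\<dots> = \<sigma> * \<sigma> powr n * greenY r k z"
      unfolding greenY_def set_lebesgue_integral_def by simp
    finally show ?thesis .
  qed
  have b: "bessel_K n (\<bar>\<mu> + \<sigma> * z - \<mu>\<bar> / \<sigma>) / (\<sigma>\<^sup>2 * \<bar>\<mu> + \<sigma> * z - \<mu>\<bar> powr n) = besB r z / (\<sigma>\<^sup>2 * \<sigma> powr n)"
    unfolding besB_def n n_def[symmetric] using \<sigma> z by (simp add: abs_mult powr_mult powr_minus field_simps)
  have a: "bessel_I n (\<bar>\<mu> + \<sigma> * z - \<mu>\<bar> / \<sigma>) / (\<sigma>\<^sup>2 * \<bar>\<mu> + \<sigma> * z - \<mu>\<bar> powr n) = besA r z / (\<sigma>\<^sup>2 * \<sigma> powr n)"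
    using \<sigma> z bessel_I_eq_besA[OF r z] unfolding n_def[symmetric] by (simp add: abs_mult powr_mult field_simps)
  have y: "\<mu> + \<sigma> * z - \<mu> = \<sigma> * z" by simp
  have "svg_stein_formula r \<sigma> \<mu> h (\<mu> + \<sigma> * z) = - (besB r z / (\<sigma>\<^sup>2 * \<sigma> powr n)) * (\<sigma> * \<sigma> powr n * greenX r k z)
     - besA r z / (\<sigma>\<^sup>2 * \<sigma> powr n) * (\<sigma> * \<sigma> powr n * greenY r k z)"
    unfolding svg_stein_formula_def Let_def n_def[symmetric] a b unfolding y X Y ..
  also have "\<dots> = green r k z / \<sigma>"
    unfolding green_def using \<sigma> by (simp add: field_simps power2_eq_square)
  finally show ?thesis unfolding k_def .
qed

text \<open>Reversed orientation changes the sign of the first integral. The second runs from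
  \<open>- \<sigma> * z\<close> across the centre to infinity; as the total integral is zero, it is
  minus the left tail, which reflection turns into \<open>greenY\<close>. Both signs flip, so the
  left half-line carries minus the potential of the reflected function.\<close>

lemma svg_stein_formula_left:
  assumes r: "r > 0" and \<sigma>: "\<sigma> > 0" and z: "z > 0"
    and g: "growth A B (\<lambda>t. h (\<mu> + \<sigma> * t))" "growth A B (\<lambda>t. h (\<mu> - \<sigma> * t))"
  shows "svg_stein_formula r \<sigma> \<mu> h (\<mu> - \<sigma> * z) = - green r (\<lambda>t. h (\<mu> - \<sigma> * t) - svg_expect r \<sigma> \<mu> h) z / \<sigma>"
proof -
  define n where "n = (r - 1) / 2"
  have n: "(1 - r) / 2 = - n" "r - 1 = n + n" unfolding n_def by (simp_all add: field_simps)
  have pn: "t powr (r - 1) = t powr n * t powr n" for t by (simp only: n powr_add)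
  define m where "m = svg_expect r \<sigma> \<mu> h"
  define k where "k = (\<lambda>t. h (\<mu> - \<sigma> * t) - m)"
  define l where "l = (\<lambda>t. h (\<mu> + \<sigma> * t) - m)"
  have lk: "(\<lambda>t. l (- t)) = k" unfolding l_def k_def by simp
  let ?kt = "\<lambda>t. h (t + \<mu>) - m"
  have gl: "growth (A + \<bar>m\<bar>) B l" "growth (A + \<bar>m\<bar>) B (\<lambda>t. l (- t))"
    unfolding lk unfolding l_def k_def by (intro growth_diff_const g)+
  have ml: "l \<in> borel_measurable borel" using gl by (simp add: growth_def)
  have X: "(LBINT t=ereal 0..ereal (- \<sigma> * z). \<bar>t\<bar> powr n * bessel_I n (\<bar>t\<bar> / \<sigma>) * ?kt t) = - (\<sigma> * \<sigma> powr n * greenX r k z)"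
  proof -
    have eq: "indicat_real {- \<sigma> * z..<0} (0 + - \<sigma> * t) *\<^sub>R (\<bar>0 + - \<sigma> * t\<bar> powr n * bessel_I n (\<bar>0 + - \<sigma> * t\<bar> / \<sigma>) * ?kt (0 + - \<sigma> * t))
        = \<sigma> powr n * (indicat_real {0<..z} t *\<^sub>R (t powr (r - 1) * besA r t * k t))" for t
      using \<sigma> bessel_I_eq_besA[OF r, of t]
      by (auto simp: indicator_def n_def[symmetric] pn powr_mult k_def abs_mult zero_less_mult_iff)
    have "(LBINT t=ereal 0..ereal (- \<sigma> * z). \<bar>t\<bar> powr n * bessel_I n (\<bar>t\<bar> / \<sigma>) * ?kt t) = - (LBINT t=ereal (- \<sigma> * z)..ereal 0. \<bar>t\<bar> powr n * bessel_I n (\<bar>t\<bar> / \<sigma>) * ?kt t)"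
      by (rule interval_integral_endpoints_reverse)
    also have "(LBINT t=ereal (- \<sigma> * z)..ereal 0. \<bar>t\<bar> powr n * bessel_I n (\<bar>t\<bar> / \<sigma>) * ?kt t) = (LINT t:{- \<sigma> * z..<0}|lborel. \<bar>t\<bar> powr n * bessel_I n (\<bar>t\<bar> / \<sigma>) * ?kt t)"
      using \<sigma> z by (intro interval_integral_Ico) simp
    also have "\<dots> = \<sigma> * (LINT t|lborel. \<sigma> powr n * (indicat_real {0<..z} t *\<^sub>R (t powr (r - 1) * besA r t * k t)))"
      unfolding set_lebesgue_integral_def using \<sigma>
      by (subst lborel_integral_real_affine[where c = "- \<sigma>" and t = 0]) (simp, simp only: eq abs_minus_cancel abs_of_pos, simp)
    also have "\<dots> = \<sigma> * \<sigma> powr n * greenX r k z"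
      unfolding greenX_def set_lebesgue_integral_def by simp
    finally show ?thesis .
  qed
  have Y: "(LBINT t=ereal (- \<sigma> * z)..PInfty. \<bar>t\<bar> powr n * bessel_K n (\<bar>t\<bar> / \<sigma>) * ?kt t) = - (\<sigma> * \<sigma> powr n * greenY r k z)"
  proof -
    have eq: "indicat_real {- \<sigma> * z<..} (0 + \<sigma> * t) *\<^sub>R (\<bar>0 + \<sigma> * t\<bar> powr n * bessel_K n (\<bar>0 + \<sigma> * t\<bar> / \<sigma>) * ?kt (0 + \<sigma> * t))
        = \<sigma> powr n * (indicat_real {- z<..} t *\<^sub>R svg_kernel r l t)" for t
    proof (cases "t = 0")
      case False
      have "\<bar>t\<bar> powr (r - 1) * besB r \<bar>t\<bar> = \<bar>t\<bar> powr n * bessel_K n \<bar>t\<bar>"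
        unfolding besB_def n(1) n_def[symmetric] pn using False by (simp add: powr_minus field_simps)
      moreover have "- \<sigma> * z < \<sigma> * t \<longleftrightarrow> - z < t" using \<sigma> mult_less_cancel_left_pos[of \<sigma> "- z" t] by simp
      ultimately show ?thesis
        using \<sigma> by (auto simp: svg_kernel_def indicator_def powr_mult l_def add.commute abs_mult)
    qed (auto simp: svg_kernel_def)
    have "(LBINT t=ereal (- \<sigma> * z)..PInfty. \<bar>t\<bar> powr n * bessel_K n (\<bar>t\<bar> / \<sigma>) * ?kt t) = (LINT t:{- \<sigma> * z<..}|lborel. \<bar>t\<bar> powr n * bessel_K n (\<bar>t\<bar> / \<sigma>) * ?kt t)"
      by (simp add: interval_lebesgue_integral_def flip: infinity_ereal_def)
    also have "\<dots> = \<sigma> * (LINT t|lborel. \<sigma> powr n * (indicat_real {- z<..} t *\<^sub>R svg_kernel r l t))"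
      unfolding set_lebesgue_integral_def using \<sigma>
      by (subst lborel_integral_real_affine[where c = \<sigma> and t = 0]) (simp, simp only: eq abs_of_pos, simp)
    also have "\<dots> = \<sigma> * \<sigma> powr n * (LINT t:{- z<..}|lborel. svg_kernel r l t)"
      unfolding set_lebesgue_integral_def by simp
    also have "(LINT t:{- z<..}|lborel. svg_kernel r l t) = - greenY r k z"
    proof -
      note I = svg_kernel_integral[OF r ml gl]
      have "greenY r l 0 + greenY r k 0 = 0"
        using svg_expect_eq[OF r \<sigma> g, of m] svgE_0_pos[OF r] besA_pos[OF r, of 0]
        unfolding m_def[symmetric] l_def k_def by simp
      then have "0 = (LINT t|lborel. svg_kernel r l t)" unfolding I(2) lk by simp
      also have "\<dots> = (LINT t:{..- z} \<union> {- z<..}|lborel. svg_kernel r l t)"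
      proof -
        have "{..- z} \<union> {- z<..} = UNIV" by auto
        then show ?thesis by (simp add: set_lebesgue_integral_def)
      qed
      also have "\<dots> = (LINT t:{..- z}|lborel. svg_kernel r l t) + (LINT t:{- z<..}|lborel. svg_kernel r l t)"
        using I(1) by (intro set_integral_Un) (auto simp: set_integrable_def intro!: integrable_mult_indicator[where 'b = real, simplified])
      finally show ?thesis unfolding I(3)[OF z] lk by simp
    qed
    finally show ?thesis by simp
  qed
  have b: "bessel_K n (\<bar>\<mu> - \<sigma> * z - \<mu>\<bar> / \<sigma>) / (\<sigma>\<^sup>2 * \<bar>\<mu> - \<sigma> * z - \<mu>\<bar> powr n) = besB r z / (\<sigma>\<^sup>2 * \<sigma> powr n)"
    unfolding besB_def n n_def[symmetric] using \<sigma> z by (simp add: abs_mult powr_mult powr_minus field_simps)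
  have a: "bessel_I n (\<bar>\<mu> - \<sigma> * z - \<mu>\<bar> / \<sigma>) / (\<sigma>\<^sup>2 * \<bar>\<mu> - \<sigma> * z - \<mu>\<bar> powr n) = besA r z / (\<sigma>\<^sup>2 * \<sigma> powr n)"
    using \<sigma> z bessel_I_eq_besA[OF r z] unfolding n_def[symmetric] by (simp add: abs_mult powr_mult field_simps)
  have y: "\<mu> - \<sigma> * z - \<mu> = - \<sigma> * z" by simp
  have "svg_stein_formula r \<sigma> \<mu> h (\<mu> - \<sigma> * z) = - (besB r z / (\<sigma>\<^sup>2 * \<sigma> powr n)) * - (\<sigma> * \<sigma> powr n * greenX r k z)
     - besA r z / (\<sigma>\<^sup>2 * \<sigma> powr n) * - (\<sigma> * \<sigma> powr n * greenY r k z)"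
    unfolding svg_stein_formula_def Let_def n_def[symmetric] a b m_def[symmetric] unfolding y X Y ..
  also have "\<dots> = - green r k z / \<sigma>"
    unfolding green_def using \<sigma> by (simp add: field_simps power2_eq_square)
  finally show ?thesis unfolding k_def m_def .
qed

subsection \<open>Iterated derivatives\<close>

lemma has_nth_deriv_1:
  assumes "has_nth_deriv f (Suc 0) x D"
  shows "(f has_real_derivative D) (at x)"
proof -
  obtain g where g: "\<forall>\<^sub>F t in nhds x. g t = f t" "(g has_real_derivative D) (at x)"
    using assms by auto
  from g(1) have "((g has_real_derivative D) (at x)) = ((f has_real_derivative D) (at x))"
    by (intro DERIV_cong_ev refl)
  with g(2) show ?thesis by simp
qed

text \<open>\<open>has_nth_deriv\<close> hides the intermediate derivatives behind existential
  quantifiers; on an open set where the first derivative is known, uniqueness identifies the hidden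
  one.\<close>

lemma has_nth_deriv_shift:
  assumes "open S" "\<And>t. t \<in> S \<Longrightarrow> (f has_real_derivative f1 t) (at t)" "x \<in> S"
    and "has_nth_deriv f (Suc (Suc n)) x D"
  shows "has_nth_deriv f1 (Suc n) x D"
  using assms(3,4)
proof (induction n arbitrary: x D)
  case 0
  then obtain g where g: "\<forall>\<^sub>F t in nhds x. has_nth_deriv f (Suc 0) t (g t)" "(g has_real_derivative D) (at x)"
    by auto
  have "\<forall>\<^sub>F t in nhds x. t \<in> S" using assms(1) 0 by (intro eventually_nhds_in_open) auto
  with g(1) have "\<forall>\<^sub>F t in nhds x. g t = f1 t"
    by eventually_elim (metis DERIV_unique assms(2) has_nth_deriv_1)
  with g(2) show ?case by auto
next
  case (Suc n)
  from Suc.prems(2) obtain g where g: "\<forall>\<^sub>F t in nhds x. has_nth_deriv f (Suc (Suc n)) t (g t)" "(g has_real_derivative D) (at x)"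
    unfolding has_nth_deriv.simps(2)[of f "Suc (Suc n)"] by blast
  have "\<forall>\<^sub>F t in nhds x. t \<in> S" using assms(1) Suc.prems by (intro eventually_nhds_in_open) auto
  with g(1) have "\<forall>\<^sub>F t in nhds x. has_nth_deriv f1 (Suc n) t (g t)"
    by eventually_elim (rule Suc.IH)
  with g(2) show ?case unfolding has_nth_deriv.simps(2)[of f1 "Suc n"] by blast
qed

text \<open>The mean value theorem on an interval ending at \<open>x\<close> uses derivatives at
  interior points only. This carries bounds from both half-lines to the centre.\<close>

lemma deriv_bound_punctured:
  fixes f :: "real \<Rightarrow> real"
  assumes D: "(f has_real_derivative D) (at x)"
    and ev: "\<forall>\<^sub>F t in at x. \<exists>D. (f has_real_derivative D) (at t) \<and> \<bar>D\<bar> \<le> M"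
  shows "\<bar>D\<bar> \<le> M"
proof (rule deriv_abs_le_limit[OF D tendsto_const])
  obtain d where d: "d > 0" "\<And>t. t \<noteq> x \<Longrightarrow> \<bar>t - x\<bar> < d \<Longrightarrow> \<exists>D. (f has_real_derivative D) (at t) \<and> \<bar>D\<bar> \<le> M"
    using ev unfolding eventually_at dist_real_def by auto
  have ct: "isCont f t" if "\<bar>t - x\<bar> < d" for t
    using that d(2)[of t] D by (cases "t = x") (auto intro: DERIV_isCont)
  have key: "\<bar>f b - f a\<bar> \<le> M * \<bar>b - a\<bar>" if "a < b" "a = x \<or> b = x" "\<bar>a - x\<bar> < d" "\<bar>b - x\<bar> < d" for a b
  proof -
    have "\<exists>l z. a < z \<and> z < b \<and> (f has_real_derivative l) (at z) \<and> f b - f a = (b - a) * l"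
    proof (rule MVT[OF \<open>a < b\<close>])
      show "continuous_on {a..b} f"
        using that by (intro continuous_at_imp_continuous_on ballI ct) auto
      fix t assume "a < t" "t < b"
      then have "t \<noteq> x" "\<bar>t - x\<bar> < d" using that by auto
      then show "f differentiable at t" using d(2) unfolding real_differentiable_def by blast
    qed
    then obtain l z where z: "a < z" "z < b" "(f has_real_derivative l) (at z)" "f b - f a = (b - a) * l" by blast
    then have "z \<noteq> x" "\<bar>z - x\<bar> < d" using that by auto
    then have "\<bar>l\<bar> \<le> M" using d(2) z(3) DERIV_unique by blast
    then show ?thesis unfolding z(4) abs_mult by (simp add: mult.commute mult_right_mono)
  qed
  show "\<forall>\<^sub>F z in at x. \<bar>f z - f x\<bar> \<le> M * \<bar>z - x\<bar>"
    unfolding eventually_at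
  proof (intro exI[of _ d] conjI ballI impI d(1))
    fix z assume "z \<noteq> x \<and> dist z x < d"
    then show "\<bar>f z - f x\<bar> \<le> M * \<bar>z - x\<bar>"
      using key[of x z] key[of z x] d(1) by (cases "x < z") (auto simp: dist_real_def abs_minus_commute)
  qed
qed

lemma svg_stein_sol_side:
  assumes r: "r > 0" and \<sigma>: "\<sigma> > 0" and s: "s = 1 \<or> s = - 1" and x: "s * (x - \<mu>) > 0"
    and g: "growth A B (\<lambda>t. h (\<mu> + \<sigma> * t))" "growth A B (\<lambda>t. h (\<mu> - \<sigma> * t))"
  shows "svg_stein_sol r \<sigma> \<mu> h x = s / \<sigma> * green r (\<lambda>t. h (\<mu> + s * \<sigma> * t) - svg_expect r \<sigma> \<mu> h) (s * (x - \<mu>) / \<sigma>)"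
  using s
proof
  assume s: "s = 1"
  then have z: "(x - \<mu>) / \<sigma> > 0" using x \<sigma> by simp
  have "\<mu> + \<sigma> * ((x - \<mu>) / \<sigma>) = x" using \<sigma> by simp
  then show ?thesis using svg_stein_formula_right[OF r \<sigma> z, of \<mu> h] x s unfolding svg_stein_sol_def by simp
next
  assume s: "s = - 1"
  then have z: "(\<mu> - x) / \<sigma> > 0" using x \<sigma> by simp
  have "\<mu> - \<sigma> * ((\<mu> - x) / \<sigma>) = x" using \<sigma> by simp
  then show ?thesis using svg_stein_formula_left[OF r \<sigma> z g] x s unfolding svg_stein_sol_def by simp
qed

lemma svg_stein_sol_deriv:
  assumes r: "r > 0" and \<sigma>: "\<sigma> > 0" and s: "s = 1 \<or> s = - 1" and x: "s * (x - \<mu>) > 0"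
    and g: "growth A B (\<lambda>t. h (\<mu> + \<sigma> * t))" "growth A B (\<lambda>t. h (\<mu> - \<sigma> * t))"
  shows "(svg_stein_sol r \<sigma> \<mu> h has_real_derivative
     1 / \<sigma>\<^sup>2 * green' r (\<lambda>t. h (\<mu> + s * \<sigma> * t) - svg_expect r \<sigma> \<mu> h) (s * (x - \<mu>) / \<sigma>)) (at x)"
proof -
  let ?k = "\<lambda>t. h (\<mu> + s * \<sigma> * t) - svg_expect r \<sigma> \<mu> h"
  have ss: "s * s = 1" using s by auto
  have gk: "growth (A + \<bar>svg_expect r \<sigma> \<mu> h\<bar>) B ?k"
    using s g by (intro growth_diff_const) auto
  have z: "s * (x - \<mu>) / \<sigma> > 0" using x \<sigma> by simp
  have "((\<lambda>x. s * (x - \<mu>) / \<sigma>) has_real_derivative s / \<sigma>) (at x)"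
    using \<sigma> by (auto intro!: derivative_eq_intros)
  from DERIV_cmult[OF DERIV_chain2[OF green_deriv[OF r gk z] this], of "s / \<sigma>"]
  have "((\<lambda>x. s / \<sigma> * green r ?k (s * (x - \<mu>) / \<sigma>)) has_real_derivative 1 / \<sigma>\<^sup>2 * green' r ?k (s * (x - \<mu>) / \<sigma>)) (at x)"
    using ss by (simp add: power2_eq_square mult.assoc mult.left_commute[of s])
  moreover have "\<forall>\<^sub>F t in nhds x. t \<in> {t. s * (t - \<mu>) > 0}"
    using x by (intro eventually_nhds_in_open open_Collect_less continuous_intros) auto
  then have "\<forall>\<^sub>F t in nhds x. svg_stein_sol r \<sigma> \<mu> h t = s / \<sigma> * green r ?k (s * (t - \<mu>) / \<sigma>)"
    by eventually_elim (rule svg_stein_sol_side[OF r \<sigma> s _ g], simp)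
  ultimately show ?thesis by (subst DERIV_cong_ev) (auto intro: refl)
qed

text \<open>The one-sided limits involve \<open>greenY\<close> at 0 of the two reflected functions,
  with opposite signs; they agree because these values sum to zero, so the \<open>Lim\<close> in the
  definition is a genuine limit.\<close>

lemma svg_stein_sol_tendsto:
  assumes r: "r > 0" and \<sigma>: "\<sigma> > 0"
    and g: "growth A B (\<lambda>t. h (\<mu> + \<sigma> * t))" "growth A B (\<lambda>t. h (\<mu> - \<sigma> * t))"
  shows "svg_stein_sol r \<sigma> \<mu> h \<mu> = - besA r 0 * greenY r (\<lambda>t. h (\<mu> + \<sigma> * t) - svg_expect r \<sigma> \<mu> h) 0 / \<sigma>"
proof -
  let ?m = "svg_expect r \<sigma> \<mu> h"
  let ?k = "\<lambda>t. h (\<mu> + \<sigma> * t) - ?m" and ?l = "\<lambda>t. h (\<mu> - \<sigma> * t) - ?m"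
  let ?F = "svg_stein_formula r \<sigma> \<mu> h"
  let ?c = "- besA r 0 * greenY r ?k 0 / \<sigma>"
  have sum: "greenY r ?k 0 + greenY r ?l 0 = 0"
    using svg_expect_eq[OF r \<sigma> g, of ?m] svgE_0_pos[OF r] besA_pos[OF r, of 0] by simp
  have lim: "filterlim (\<lambda>t. s * (t - \<mu>) / \<sigma>) (at_right 0) (at \<mu> within {t. s * (t - \<mu>) > 0})" for s
  proof -
    have "((\<lambda>t. s * (t - \<mu>) / \<sigma>) \<longlongrightarrow> 0) (at \<mu> within {t. s * (t - \<mu>) > 0})"
      using \<sigma> by (auto intro!: tendsto_eq_intros)
    moreover have "\<forall>\<^sub>F t in at \<mu> within {t. s * (t - \<mu>) > 0}. s * (t - \<mu>) / \<sigma> \<in> {0<..} \<and> s * (t - \<mu>) / \<sigma> \<noteq> 0"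
      unfolding eventually_at_filter using \<sigma> by (intro always_eventually) auto
    ultimately show ?thesis unfolding filterlim_at by blast
  qed
  have R: "(?F \<longlongrightarrow> ?c) (at_right \<mu>)"
  proof -
    have "((\<lambda>t. green r ?k (1 * (t - \<mu>) / \<sigma>) / \<sigma>) \<longlongrightarrow> - besA r 0 * greenY r ?k 0 / \<sigma>) (at_right \<mu>)"
      using lim[of 1] \<sigma>
      by (intro tendsto_divide tendsto_const filterlim_compose[OF green_tendsto_0[OF r growth_diff_const[OF g(1)]]])
        (auto simp: greaterThan_def)
    moreover have "\<forall>\<^sub>F t in at_right \<mu>. green r ?k (1 * (t - \<mu>) / \<sigma>) / \<sigma> = ?F t"
      using eventually_at_right_less[of \<mu>]
    proof eventually_elim
      case (elim t)
      then have "(t - \<mu>) / \<sigma> > 0" using \<sigma> by simp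
      from svg_stein_formula_right[OF r \<sigma> this, of \<mu> h] show ?case using \<sigma> by simp
    qed
    ultimately show ?thesis by (rule Lim_transform_eventually)
  qed
  have L: "(?F \<longlongrightarrow> ?c) (at_left \<mu>)"
  proof -
    have e: "?c = - (- besA r 0 * greenY r ?l 0) / \<sigma>" 
    proof -
      have "greenY r ?l 0 = - greenY r ?k 0" using sum by linarith
      then show ?thesis by simp
    qed
    have "((\<lambda>t. - green r ?l (- 1 * (t - \<mu>) / \<sigma>) / \<sigma>) \<longlongrightarrow> - (- besA r 0 * greenY r ?l 0) / \<sigma>) (at_left \<mu>)"
      using lim[of "-1"] \<sigma>
      by (intro tendsto_divide tendsto_minus tendsto_const filterlim_compose[OF green_tendsto_0[OF r growth_diff_const[OF g(2)]]])
        (auto simp: lessThan_def)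
    moreover have "\<forall>\<^sub>F t in at_left \<mu>. t < \<mu>" by (simp add: eventually_at_filter)
    then have "\<forall>\<^sub>F t in at_left \<mu>. - green r ?l (- 1 * (t - \<mu>) / \<sigma>) / \<sigma> = ?F t"
    proof eventually_elim
      case (elim t)
      then have "(\<mu> - t) / \<sigma> > 0" using \<sigma> by simp
      from svg_stein_formula_left[OF r \<sigma> this g] show ?case using \<sigma> by simp
    qed
    ultimately show ?thesis unfolding e by (rule Lim_transform_eventually)
  qed
  have "(?F \<longlongrightarrow> ?c) (at \<mu>)" using L R by (simp add: filterlim_at_split)
  then show ?thesis unfolding svg_stein_sol_def by (simp add: tendsto_Lim)
qed

subsection \<open>Bounds for the Stein solution\<close>

text \<open>The value -1 at the centre is a convention; derivative formulas through it are stated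
  off the centre.\<close>

definition svg_side :: "real \<Rightarrow> real \<Rightarrow> real" where
  "svg_side \<mu> x = (if x > \<mu> then 1 else - 1)"

definition svg_pos :: "real \<Rightarrow> real \<Rightarrow> real \<Rightarrow> real" where
  "svg_pos \<sigma> \<mu> x = svg_side \<mu> x * (x - \<mu>) / \<sigma>"

definition svg_centred :: "real \<Rightarrow> real \<Rightarrow> real \<Rightarrow> (real \<Rightarrow> real) \<Rightarrow> real \<Rightarrow> real \<Rightarrow> real" where
  "svg_centred r \<sigma> \<mu> h s t = h (\<mu> + s * \<sigma> * t) - svg_expect r \<sigma> \<mu> h"

lemma svg_side: "svg_side \<mu> x = 1 \<or> svg_side \<mu> x = - 1"
  by (simp add: svg_side_def)

lemma abs_svg_side: "\<bar>svg_side \<mu> x\<bar> = 1"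
  by (simp add: svg_side_def)

lemma svg_side_mult: "svg_side \<mu> x * (x - \<mu>) = \<bar>x - \<mu>\<bar>"
  by (simp add: svg_side_def)

lemma svg_pos_pos: "\<sigma> > 0 \<Longrightarrow> x \<noteq> \<mu> \<Longrightarrow> svg_pos \<sigma> \<mu> x > 0"
  unfolding svg_pos_def svg_side_mult by simp

lemma abs_eq_svg_pos: "\<sigma> > 0 \<Longrightarrow> \<bar>x - \<mu>\<bar> = \<sigma> * svg_pos \<sigma> \<mu> x"
  unfolding svg_pos_def svg_side_mult by simp

lemma svg_side_eventually:
  assumes "x \<noteq> \<mu>"
  shows "\<forall>\<^sub>F t in nhds x. svg_side \<mu> t = svg_side \<mu> x"
proof -
  have "\<forall>\<^sub>F t in nhds x. t \<in> {t. svg_side \<mu> x * (t - \<mu>) > 0}"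
    using assms by (intro eventually_nhds_in_open open_Collect_less continuous_intros) (auto simp: svg_side_mult)
  then show ?thesis by eventually_elim (auto simp: svg_side_def split: if_splits)
qed

text \<open>\<open>F\<close> takes the side as an argument since the two half-lines carry different
  functions. The side is locally constant, so what remains is an affine change of variable, inverted
  with \<open>s * s = 1\<close>. The forward direction transports an assumed derivative to the
  half-line.\<close>

lemma svg_scaled_deriv_iff:
  assumes \<sigma>: "\<sigma> > 0" and x: "x \<noteq> \<mu>"
  shows "((\<lambda>t. F (svg_side \<mu> t) (svg_pos \<sigma> \<mu> t)) has_real_derivative D) (at x) \<longleftrightarrow>
    (F (svg_side \<mu> x) has_real_derivative svg_side \<mu> x * \<sigma> * D) (at (svg_pos \<sigma> \<mu> x))"
proof -
  define s where "s = svg_side \<mu> x"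
  have ss: "s * s = 1" using svg_side[of \<mu> x] unfolding s_def by auto
  have ev: "\<forall>\<^sub>F t in nhds x. F (svg_side \<mu> t) (svg_pos \<sigma> \<mu> t) = F s (s * (t - \<mu>) / \<sigma>)"
    using svg_side_eventually[OF x] by eventually_elim (simp add: svg_pos_def s_def)
  have "((\<lambda>t. F (svg_side \<mu> t) (svg_pos \<sigma> \<mu> t)) has_real_derivative D) (at x) \<longleftrightarrow>
      ((\<lambda>t. F s (s * (t - \<mu>) / \<sigma>)) has_real_derivative D) (at x)"
    by (rule DERIV_cong_ev[OF refl ev refl])
  also have "\<dots> \<longleftrightarrow> (F s has_real_derivative s * \<sigma> * D) (at (s * (x - \<mu>) / \<sigma>))"
  proof
    assume D: "((\<lambda>t. F s (s * (t - \<mu>) / \<sigma>)) has_real_derivative D) (at x)"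
    have e: "\<mu> + s * \<sigma> * (s * (x - \<mu>) / \<sigma>) = x" using \<sigma> ss by (simp add: field_simps)
    have "((\<lambda>z. \<mu> + s * \<sigma> * z) has_real_derivative s * \<sigma>) (at (s * (x - \<mu>) / \<sigma>))"
      by (auto intro!: derivative_eq_intros)
    moreover have "((\<lambda>t. F s (s * (t - \<mu>) / \<sigma>)) has_real_derivative D) (at (\<mu> + s * \<sigma> * (s * (x - \<mu>) / \<sigma>)))"
      unfolding e by (rule D)
    ultimately have "((\<lambda>z. F s (s * (\<mu> + s * \<sigma> * z - \<mu>) / \<sigma>)) has_real_derivative D * (s * \<sigma>)) (at (s * (x - \<mu>) / \<sigma>))"
      by (rule DERIV_chain2[where f = "\<lambda>t. F s (s * (t - \<mu>) / \<sigma>)" and g = "\<lambda>z. \<mu> + s * \<sigma> * z", rotated])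
    moreover have "s * (\<mu> + s * \<sigma> * z - \<mu>) / \<sigma> = z" for z
      using \<sigma> ss by (simp add: mult.assoc[symmetric])
    ultimately show "(F s has_real_derivative s * \<sigma> * D) (at (s * (x - \<mu>) / \<sigma>))" by (simp add: mult.commute)
  next
    assume D: "(F s has_real_derivative s * \<sigma> * D) (at (s * (x - \<mu>) / \<sigma>))"
    have "((\<lambda>x. s * (x - \<mu>) / \<sigma>) has_real_derivative s / \<sigma>) (at x)"
      using \<sigma> by (auto intro!: derivative_eq_intros)
    from DERIV_chain2[where f = "F s" and g = "\<lambda>x. s * (x - \<mu>) / \<sigma>", OF D this]
    have "((\<lambda>t. F s (s * (t - \<mu>) / \<sigma>)) has_real_derivative s * \<sigma> * D * (s / \<sigma>)) (at x)" .
    moreover have "s * \<sigma> * D * (s / \<sigma>) = (s * s) * D" using \<sigma> by simp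
    ultimately show "((\<lambda>t. F s (s * (t - \<mu>) / \<sigma>)) has_real_derivative D) (at x)"
      unfolding ss by simp
  qed
  finally show ?thesis unfolding svg_pos_def s_def .
qed

lemma svg_stein_sol_abs:
  assumes r: "r > 0" and \<sigma>: "\<sigma> > 0" and x: "x \<noteq> \<mu>"
    and g: "growth A B (\<lambda>t. h (\<mu> + \<sigma> * t))" "growth A B (\<lambda>t. h (\<mu> - \<sigma> * t))"
  shows "\<bar>svg_stein_sol r \<sigma> \<mu> h x\<bar> = \<bar>green r (svg_centred r \<sigma> \<mu> h (svg_side \<mu> x)) (svg_pos \<sigma> \<mu> x)\<bar> / \<sigma>"
proof -
  have "svg_side \<mu> x * (x - \<mu>) > 0" using x unfolding svg_side_mult by simp
  from svg_stein_sol_side[OF r \<sigma> svg_side this g] show ?thesis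
    using \<sigma> abs_svg_side[of \<mu> x] unfolding svg_pos_def svg_centred_def[abs_def] by (simp add: abs_mult)
qed

lemma svg_stein_sol_has_deriv:
  assumes r: "r > 0" and \<sigma>: "\<sigma> > 0" and x: "x \<noteq> \<mu>"
    and g: "growth A B (\<lambda>t. h (\<mu> + \<sigma> * t))" "growth A B (\<lambda>t. h (\<mu> - \<sigma> * t))"
  shows "(svg_stein_sol r \<sigma> \<mu> h has_real_derivative
    1 / \<sigma>\<^sup>2 * green' r (svg_centred r \<sigma> \<mu> h (svg_side \<mu> x)) (svg_pos \<sigma> \<mu> x)) (at x)"
proof -
  have "svg_side \<mu> x * (x - \<mu>) > 0" using x unfolding svg_side_mult by simp
  from svg_stein_sol_deriv[OF r \<sigma> svg_side this g] show ?thesis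
    unfolding svg_pos_def svg_centred_def[abs_def] .
qed

lemma svg_stein_bounded:
  fixes r \<sigma> \<mu> M x D :: real and h :: "real \<Rightarrow> real"
  assumes r: "r > 0" and \<sigma>: "\<sigma> > 0" and [measurable]: "h \<in> borel_measurable borel"
    and M: "\<And>x. \<bar>h x - svg_expect r \<sigma> \<mu> h\<bar> \<le> M"
  defines "f \<equiv> svg_stein_sol r \<sigma> \<mu> h"
  shows "\<bar>(x - \<mu>) * f x\<bar> \<le> (1 + 1 / (2 * r)) * M"
    "has_nth_deriv f 1 x D \<Longrightarrow> \<bar>(x - \<mu>) * D\<bar> \<le> 1 / \<sigma> * (1 + 1 / (2 * r)) * M"
    "has_nth_deriv f 2 x D \<Longrightarrow> \<bar>(x - \<mu>) * D\<bar> \<le> 1 / \<sigma>\<^sup>2 * (4 + 1 / (2 * r)) * M"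
proof -
  let ?m = "svg_expect r \<sigma> \<mu> h"
  let ?k = "svg_centred r \<sigma> \<mu> h (svg_side \<mu> x)" and ?z = "svg_pos \<sigma> \<mu> x"
  have M0: "M \<ge> 0" using M[of 0] by linarith
  have hM: "\<bar>h t\<bar> \<le> M + \<bar>?m\<bar>" for t using M[of t] by linarith
  have g: "growth (M + \<bar>?m\<bar>) 0 (\<lambda>t. h (\<mu> + \<sigma> * t))" "growth (M + \<bar>?m\<bar>) 0 (\<lambda>t. h (\<mu> - \<sigma> * t))"
    unfolding growth_def using hM M0 by auto
  have gk: "growth M 0 ?k" unfolding growth_def svg_centred_def[abs_def] using M M0 by auto
  have E: "?z * \<bar>green r ?k ?z\<bar> \<le> (1 + 1 / (2 * r)) * M" if "x \<noteq> \<mu>"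
  proof -
    note z = svg_pos_pos[OF \<sigma> that]
    have "?z * \<bar>green r ?k ?z\<bar> \<le> ?z * (M * svgE 0 r ?z)"
      using green_bound[OF r z gk] z by (intro mult_left_mono) auto
    also have "\<dots> = (?z * svgE 0 r ?z) * M" by simp
    also have "\<dots> \<le> (1 + 1 / (2 * r)) * M" using M0 by (intro mult_right_mono svgE_weighted_le r z)
    finally show ?thesis .
  qed
  show "\<bar>(x - \<mu>) * f x\<bar> \<le> (1 + 1 / (2 * r)) * M"
  proof (cases "x = \<mu>")
    case False
    then show ?thesis using E[OF False] \<sigma> svg_pos_pos[OF \<sigma> False]
      unfolding abs_mult f_def svg_stein_sol_abs[OF r \<sigma> False g] abs_eq_svg_pos[OF \<sigma>] by simp
  qed (use M0 r in simp)
  define G1 where "G1 = (\<lambda>x. 1 / \<sigma>\<^sup>2 * green' r (svg_centred r \<sigma> \<mu> h (svg_side \<mu> x)) (svg_pos \<sigma> \<mu> x))"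
  have d1: "(f has_real_derivative G1 t) (at t)" if "t \<in> - {\<mu>}" for t
    unfolding f_def G1_def using that by (intro svg_stein_sol_has_deriv[OF r \<sigma> _ g]) auto
  show "\<bar>(x - \<mu>) * D\<bar> \<le> 1 / \<sigma> * (1 + 1 / (2 * r)) * M" if "has_nth_deriv f 1 x D"
  proof (cases "x = \<mu>")
    case False
    note z = svg_pos_pos[OF \<sigma> False]
    have "(f has_real_derivative D) (at x)" using that by (intro has_nth_deriv_1) (simp del: has_nth_deriv.simps)
    then have D: "D = G1 x" by (rule DERIV_unique) (use d1 False in auto)
    have "\<bar>(x - \<mu>) * D\<bar> = 1 / \<sigma> * (?z * \<bar>green' r ?k ?z\<bar>)"
      unfolding D G1_def abs_mult abs_eq_svg_pos[OF \<sigma>] using \<sigma> by (simp add: power2_eq_square)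
    also have "\<dots> \<le> 1 / \<sigma> * (?z * (M * svgS r ?z))"
      using green'_bound[OF r z gk] z \<sigma> by (intro mult_left_mono) auto
    also have "\<dots> = 1 / \<sigma> * (?z * svgS r ?z) * M" by simp
    also have "\<dots> \<le> 1 / \<sigma> * (1 + 1 / (2 * r)) * M"
      using M0 \<sigma> by (intro mult_left_mono mult_right_mono svgS_le r z) auto
    finally show ?thesis .
  qed (use M0 r \<sigma> in simp)
  show "\<bar>(x - \<mu>) * D\<bar> \<le> 1 / \<sigma>\<^sup>2 * (4 + 1 / (2 * r)) * M" if D: "has_nth_deriv f 2 x D"
  proof (cases "x = \<mu>")
    case False
    note z = svg_pos_pos[OF \<sigma> False]
    \<comment> \<open>The derivative in the standardised variable: \<open>\<sigma>^2\<close> undoes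
      the prefactor of \<open>G1\<close>, and the side times \<open>\<sigma>\<close> inverts the
      inner derivative.\<close>
    define D' where "D' = svg_side \<mu> x * \<sigma> * (\<sigma>\<^sup>2 * D)"
    have "has_nth_deriv G1 (Suc 0) x D"
      by (rule has_nth_deriv_shift[where S = "- {\<mu>}", OF _ d1]) (use D False in \<open>simp_all add: numeral_2_eq_2 open_Compl del: has_nth_deriv.simps\<close>)
    from DERIV_cmult[OF has_nth_deriv_1[OF this], of "\<sigma>\<^sup>2"]
    have "((\<lambda>t. green' r (svg_centred r \<sigma> \<mu> h (svg_side \<mu> t)) (svg_pos \<sigma> \<mu> t)) has_real_derivative \<sigma>\<^sup>2 * D) (at x)"
      unfolding G1_def using \<sigma> by simp
    then have "(green' r ?k has_real_derivative D') (at ?z)"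
      unfolding svg_scaled_deriv_iff[OF \<sigma> False, of "\<lambda>s. green' r (svg_centred r \<sigma> \<mu> h s)"] D'_def .
    from green'_deriv_bound[OF r gk z this]
    have "?z * \<bar>D' - (green r ?k ?z - r / ?z * green' r ?k ?z)\<bar> \<le> ?z * (M / ?z)" using z by (intro mult_left_mono) auto
    moreover have "?z * \<bar>D' - (green r ?k ?z - r / ?z * green' r ?k ?z)\<bar> = \<bar>?z * D' - (?z * green r ?k ?z - r * green' r ?k ?z)\<bar>"
    proof -
      have "?z * D' - (?z * green r ?k ?z - r * green' r ?k ?z) = ?z * (D' - (green r ?k ?z - r / ?z * green' r ?k ?z))"
        using z by (simp add: field_simps)
      then show ?thesis using z by (simp only: abs_mult abs_of_pos)
    qed
    moreover have "?z * (M / ?z) = M" using z by simp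
    ultimately have t1: "\<bar>?z * D' - (?z * green r ?k ?z - r * green' r ?k ?z)\<bar> \<le> M" by (simp only:)
    have "\<bar>r * green' r ?k ?z\<bar> \<le> r * (M * (2 / r) + 0)"
      unfolding abs_mult using green_global_bound(2)[OF r z gk] r by (intro mult_mono) auto
    also have "\<dots> = 2 * M" using r by simp
    finally have t2: "\<bar>r * green' r ?k ?z\<bar> \<le> 2 * M" .
    have t3: "\<bar>?z * green r ?k ?z\<bar> \<le> (1 + 1 / (2 * r)) * M"
      using E[OF False] z by (simp add: abs_mult)
    have "\<bar>a\<bar> \<le> M1 + M2 + M3" if "\<bar>a - (b - c)\<bar> \<le> M1" "\<bar>c\<bar> \<le> M2" "\<bar>b\<bar> \<le> M3" for a b c M1 M2 M3 :: real
      using that by linarith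
    from this[OF t1 t2 t3] have "\<bar>?z * D'\<bar> \<le> (4 + 1 / (2 * r)) * M" by (simp add: algebra_simps)
    then have "1 / \<sigma>\<^sup>2 * \<bar>?z * D'\<bar> \<le> 1 / \<sigma>\<^sup>2 * ((4 + 1 / (2 * r)) * M)" by (intro mult_left_mono) auto
    moreover have "\<bar>(x - \<mu>) * D\<bar> = 1 / \<sigma>\<^sup>2 * \<bar>?z * D'\<bar>"
      unfolding D'_def abs_mult abs_svg_side abs_eq_svg_pos[OF \<sigma>] using \<sigma> z by (simp add: power2_eq_square)
    ultimately show ?thesis by simp
  qed (use M0 r \<sigma> in simp)
qed

lemma svg_lipschitz_growth:
  fixes h :: "real \<Rightarrow> real"
  assumes r: "r > 0" and \<sigma>: "\<sigma> > 0" and lip: "L-lipschitz_on UNIV h"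
  shows "growth \<bar>h \<mu>\<bar> (L * \<sigma>) (\<lambda>t. h (\<mu> + \<sigma> * t))" "growth \<bar>h \<mu>\<bar> (L * \<sigma>) (\<lambda>t. h (\<mu> - \<sigma> * t))"
    "s = 1 \<or> s = - 1 \<Longrightarrow> growth (L * \<sigma> / svgE 0 r 0) (L * \<sigma>) (svg_centred r \<sigma> \<mu> h s)"
    "s = 1 \<or> s = - 1 \<Longrightarrow> \<bar>svg_centred r \<sigma> \<mu> h s a - svg_centred r \<sigma> \<mu> h s b\<bar> \<le> L * \<sigma> * \<bar>a - b\<bar>"
proof -
  let ?\<Lambda> = "L * \<sigma>" and ?m = "svg_expect r \<sigma> \<mu> h"
  have lh: "\<bar>h s - h t\<bar> \<le> L * \<bar>s - t\<bar>" for s t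
    using lipschitz_onD[OF lip, of s t] by (simp add: dist_real_def)
  have [measurable]: "h \<in> borel_measurable borel"
    using lipschitz_on_continuous_on[OF lip] by (rule borel_measurable_continuous_onI)
  have \<Lambda>: "?\<Lambda> \<ge> 0" using lipschitz_on_nonneg[OF lip] \<sigma> by simp
  have d: "\<bar>h (\<mu> + s * \<sigma> * t) - h \<mu>\<bar> \<le> ?\<Lambda> * t" if "t > 0" "s = 1 \<or> s = - 1" for s t
    using lh[of "\<mu> + s * \<sigma> * t" \<mu>] that \<sigma> by (auto simp: abs_mult ac_simps)
  have g0: "growth 0 ?\<Lambda> (\<lambda>t. h (\<mu> + \<sigma> * t) - h \<mu>)" "growth 0 ?\<Lambda> (\<lambda>t. h (\<mu> - \<sigma> * t) - h \<mu>)"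
    unfolding growth_def using d[of _ 1] d[of _ "-1"] \<Lambda> by auto
  show g: "growth \<bar>h \<mu>\<bar> ?\<Lambda> (\<lambda>t. h (\<mu> + \<sigma> * t))" "growth \<bar>h \<mu>\<bar> ?\<Lambda> (\<lambda>t. h (\<mu> - \<sigma> * t))"
    using growth_diff_const[OF g0(1), of "- h \<mu>"] growth_diff_const[OF g0(2), of "- h \<mu>"] by auto
  have E0: "svgE 0 r 0 > 0" and A0: "besA r 0 > 0" using r by (auto intro: svgE_0_pos besA_pos)
  \<comment> \<open>Centre at \<open>h \<mu>\<close> in \<open>svg_expect_eq\<close>: each half-line
    function then has intercept 0 and slope \<open>L * \<sigma>\<close>, contributing at most that
    slope divided by \<open>besA r 0\<close>.\<close>
  have m: "\<bar>?m - h \<mu>\<bar> \<le> ?\<Lambda> / svgE 0 r 0"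
  proof -
    have "\<bar>?m - h \<mu>\<bar> = besA r 0 / (2 * svgE 0 r 0) * \<bar>greenY r (\<lambda>t. h (\<mu> + \<sigma> * t) - h \<mu>) 0 + greenY r (\<lambda>t. h (\<mu> - \<sigma> * t) - h \<mu>) 0\<bar>"
      unfolding svg_expect_eq[OF r \<sigma> g, of "h \<mu>"] abs_mult using E0 A0 by simp
    also have "\<dots> \<le> besA r 0 / (2 * svgE 0 r 0) * (2 * (?\<Lambda> * (1 / besA r 0)))"
      using greenY_0_bound(2)[OF r g0(1)] greenY_0_bound(2)[OF r g0(2)] E0 A0 by (intro mult_left_mono) auto
    also have "\<dots> = ?\<Lambda> / svgE 0 r 0" using A0 by simp
    finally show ?thesis .
  qed
  show "growth (?\<Lambda> / svgE 0 r 0) ?\<Lambda> (svg_centred r \<sigma> \<mu> h s)" if "s = 1 \<or> s = - 1"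
    unfolding growth_def
  proof (intro conjI allI impI)
    fix t :: real assume "t > 0"
    from d[OF this that] m show "\<bar>svg_centred r \<sigma> \<mu> h s t\<bar> \<le> ?\<Lambda> / svgE 0 r 0 + ?\<Lambda> * t" unfolding svg_centred_def by linarith
  qed (use \<Lambda> E0 in \<open>auto simp: svg_centred_def[abs_def]\<close>)
  show "\<bar>svg_centred r \<sigma> \<mu> h s a - svg_centred r \<sigma> \<mu> h s b\<bar> \<le> ?\<Lambda> * \<bar>a - b\<bar>" if "s = 1 \<or> s = - 1"
  proof -
    have "\<bar>svg_centred r \<sigma> \<mu> h s a - svg_centred r \<sigma> \<mu> h s b\<bar> \<le> L * \<bar>(\<mu> + s * \<sigma> * a) - (\<mu> + s * \<sigma> * b)\<bar>"
      unfolding svg_centred_def using lh[of "\<mu> + s * \<sigma> * a" "\<mu> + s * \<sigma> * b"] by simp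
    also have "(\<mu> + s * \<sigma> * a) - (\<mu> + s * \<sigma> * b) = s * (\<sigma> * (a - b))" by (simp add: algebra_simps)
    also have "L * \<bar>s * (\<sigma> * (a - b))\<bar> = ?\<Lambda> * \<bar>a - b\<bar>" using that \<sigma> by (auto simp: abs_mult)
    finally show ?thesis .
  qed
qed

lemma svg_stein_lipschitz:
  fixes r \<sigma> \<mu> L x D :: real and h :: "real \<Rightarrow> real"
  assumes r: "r > 0" and \<sigma>: "\<sigma> > 0" and lip: "L-lipschitz_on UNIV h"
  defines "f \<equiv> svg_stein_sol r \<sigma> \<mu> h"
  shows "\<bar>f x\<bar> \<le> 2 * L"
    "has_nth_deriv f 1 x D \<Longrightarrow> \<bar>D\<bar> \<le> 3 / \<sigma> * svgE 0 (r + 1) 0 * L"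
    "has_nth_deriv f 2 x D \<Longrightarrow> \<bar>D\<bar> \<le> 6 / (\<sigma>\<^sup>2 * (r + 1)) * L"
    "has_nth_deriv f 1 x D \<Longrightarrow> \<bar>(x - \<mu>) * D\<bar> \<le> 3 * (1 + 1 / (2 * (r + 1))) * L"
    "has_nth_deriv f 2 x D \<Longrightarrow> \<bar>(x - \<mu>) * D\<bar> \<le> 3 / \<sigma> * (1 + 1 / (2 * (r + 1))) * L"
    "has_nth_deriv f 3 x D \<Longrightarrow> \<bar>(x - \<mu>) * D\<bar> \<le> 3 / \<sigma>\<^sup>2 * (4 + 1 / (2 * (r + 1))) * L"
proof -
  let ?\<Lambda> = "L * \<sigma>"
  let ?k = "\<lambda>x. svg_centred r \<sigma> \<mu> h (svg_side \<mu> x)" and ?z = "svg_pos \<sigma> \<mu>"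
  have L0: "L \<ge> 0" using lip by (rule lipschitz_on_nonneg)
  have \<Lambda>: "?\<Lambda> \<ge> 0" using L0 \<sigma> by simp
  have r1: "r + 1 > 0" using r by simp
  note g = svg_lipschitz_growth(1,2)[OF r \<sigma> lip]
  note gk = svg_lipschitz_growth(3)[OF r \<sigma> lip]
  note pos = svg_pos_pos[OF \<sigma>]
  note absx = abs_eq_svg_pos[OF \<sigma>]
  have E0: "svgE 0 r 0 > 0" and A0: "besA r 0 > 0" using r by (auto intro: svgE_0_pos besA_pos)
  note lk = svg_lipschitz_growth(4)[OF r \<sigma> lip svg_side]
  have lg1: "\<bar>green r (?k x) (?z x)\<bar> \<le> 2 * ?\<Lambda>" if "x \<noteq> \<mu>" for x
    by (rule lipschitz_green_bounds(1)[OF r lk gk[OF svg_side] pos[OF that]])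
  have lg2: "\<bar>green' r (?k x) (?z x)\<bar> \<le> 3 * ?\<Lambda> * svgE 0 (r + 1) (?z x)" if "x \<noteq> \<mu>" for x
    by (rule lipschitz_green_bounds(2)[OF r lk gk[OF svg_side] pos[OF that]])
  have lg3: "\<bar>green'' r (?k x) (?z x)\<bar> \<le> 3 * ?\<Lambda> * svgS (r + 1) (?z x)" if "x \<noteq> \<mu>" for x
    by (rule lipschitz_green_bounds(3)[OF r lk gk[OF svg_side] pos[OF that]])
  have lg4: "\<bar>?z x * D\<bar> \<le> 3 * ?\<Lambda> * (4 + 1 / (2 * (r + 1)))"
    if "x \<noteq> \<mu>" "(green'' r (?k x) has_real_derivative D) (at (?z x))" for x D
    by (rule lipschitz_green_bounds(4)[OF r lk gk[OF svg_side] pos[OF that(1)] that(2)])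
  have kc: "isCont (svg_centred r \<sigma> \<mu> h s) t" for s t
  proof -
    have "isCont h u" for u using lipschitz_on_continuous_on[OF lip] by (simp add: continuous_on_eq_continuous_at)
    then have "isCont (\<lambda>t. h (\<mu> + s * \<sigma> * t)) t"
      by (intro isCont_o2[where g = h and f = "\<lambda>t. \<mu> + s * \<sigma> * t"]) (auto intro!: continuous_intros)
    then show ?thesis unfolding svg_centred_def[abs_def] by (intro continuous_diff continuous_const)
  qed
  show "\<bar>f x\<bar> \<le> 2 * L"
  proof (cases "x = \<mu>")
    case True
    have k1: "(\<lambda>t. h (\<mu> + \<sigma> * t) - svg_expect r \<sigma> \<mu> h) = svg_centred r \<sigma> \<mu> h 1" unfolding svg_centred_def by simp
    have "\<bar>f x\<bar> = besA r 0 * \<bar>greenY r (svg_centred r \<sigma> \<mu> h 1) 0\<bar> / \<sigma>"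
      unfolding f_def True svg_stein_sol_tendsto[OF r \<sigma> g] k1 using A0 \<sigma> by (simp add: abs_mult)
    also have "\<dots> \<le> besA r 0 * (?\<Lambda> / svgE 0 r 0 * (svgE 0 r 0 / besA r 0) + ?\<Lambda> * (1 / besA r 0)) / \<sigma>"
      using A0 \<sigma> by (intro divide_right_mono mult_left_mono greenY_0_bound(2)[OF r gk]) auto
    also have "\<dots> = 2 * L" using A0 E0 \<sigma> by (simp add: field_simps)
    finally show ?thesis .
  next
    case False
    have "\<bar>f x\<bar> = \<bar>green r (?k x) (?z x)\<bar> / \<sigma>" unfolding f_def by (rule svg_stein_sol_abs[OF r \<sigma> False g])
    also have "\<dots> \<le> 2 * ?\<Lambda> / \<sigma>" using lg1[OF False] \<sigma> by (intro divide_right_mono) auto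
    finally show ?thesis using \<sigma> by simp
  qed
  define G1 where "G1 = (\<lambda>x. 1 / \<sigma>\<^sup>2 * green' r (?k x) (?z x))"
  \<comment> \<open>Each differentiation brings a factor side over \<open>\<sigma>\<close>, on top
    of the same factor in the solution itself; the side survives in the second derivative and
    squares away in the first.\<close>
  define G2 where "G2 = (\<lambda>x. svg_side \<mu> x / \<sigma> ^ 3 * green'' r (?k x) (?z x))"
  have d1: "(f has_real_derivative G1 t) (at t)" if "t \<in> - {\<mu>}" for t
    unfolding f_def G1_def using that by (intro svg_stein_sol_has_deriv[OF r \<sigma> _ g]) auto
  have d2: "(G1 has_real_derivative G2 t) (at t)" if "t \<in> - {\<mu>}" for t
  proof -
    have t: "t \<noteq> \<mu>" using that by simp
    have ss: "svg_side \<mu> t * svg_side \<mu> t = 1" using svg_side[of \<mu> t] by auto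
    have "(green' r (?k t) has_real_derivative green'' r (?k t) (?z t)) (at (?z t))"
      unfolding green''_def by (rule green'_deriv[OF r gk[OF svg_side] pos[OF t] kc])
    then have "(green' r (?k t) has_real_derivative svg_side \<mu> t * \<sigma> * (svg_side \<mu> t / \<sigma> * green'' r (?k t) (?z t))) (at (?z t))"
      using \<sigma> ss by (simp add: mult.assoc[symmetric])
    then have "((\<lambda>t. green' r (?k t) (?z t)) has_real_derivative svg_side \<mu> t / \<sigma> * green'' r (?k t) (?z t)) (at t)"
      unfolding svg_scaled_deriv_iff[OF \<sigma> t, of "\<lambda>s. green' r (svg_centred r \<sigma> \<mu> h s)"] .
    from DERIV_cmult[OF this, of "1 / \<sigma>\<^sup>2"] show ?thesis
      unfolding G1_def G2_def by (simp add: power2_eq_square power3_eq_cube ac_simps)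
  qed
  have n1: "D = G1 x" if "x \<noteq> \<mu>" "has_nth_deriv f 1 x D" for x D
  proof -
    have "(f has_real_derivative D) (at x)" using that(2) by (intro has_nth_deriv_1) (simp del: has_nth_deriv.simps)
    then show ?thesis by (rule DERIV_unique) (use d1 that(1) in auto)
  qed
  have n2: "D = G2 x" if "x \<noteq> \<mu>" "has_nth_deriv f 2 x D" for x D
  proof -
    have "has_nth_deriv G1 (Suc 0) x D"
      by (rule has_nth_deriv_shift[where S = "- {\<mu>}", OF _ d1]) (use that in \<open>simp_all add: numeral_2_eq_2 open_Compl del: has_nth_deriv.simps\<close>)
    from has_nth_deriv_1[OF this] d2[of x] that(1) show ?thesis by (auto intro: DERIV_unique)
  qed
  have n3: "(G2 has_real_derivative D) (at x)" if "x \<noteq> \<mu>" "has_nth_deriv f 3 x D" for x D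
  proof -
    have "has_nth_deriv G1 (Suc (Suc 0)) x D"
      by (rule has_nth_deriv_shift[where S = "- {\<mu>}", OF _ d1]) (use that in \<open>simp_all add: numeral_3_eq_3 open_Compl del: has_nth_deriv.simps\<close>)
    then have "has_nth_deriv G2 (Suc 0) x D"
      by (intro has_nth_deriv_shift[where S = "- {\<mu>}", OF _ d2]) (use that in \<open>simp_all add: open_Compl del: has_nth_deriv.simps\<close>)
    then show ?thesis by (rule has_nth_deriv_1)
  qed
  let ?e = "svgE 0 (r + 1) 0"
  have b1: "\<bar>G1 x\<bar> \<le> 3 / \<sigma> * ?e * L" if "x \<noteq> \<mu>" for x
  proof -
    have "\<bar>G1 x\<bar> = 1 / \<sigma>\<^sup>2 * \<bar>green' r (?k x) (?z x)\<bar>" unfolding G1_def abs_mult by simp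
    also have "\<dots> \<le> 1 / \<sigma>\<^sup>2 * (3 * ?\<Lambda> * ?e)"
    proof (intro mult_left_mono)
      have "3 * ?\<Lambda> * svgE 0 (r + 1) (?z x) \<le> 3 * ?\<Lambda> * ?e"
        using \<Lambda> pos[OF that] by (intro mult_left_mono svgE_le r1) auto
      then show "\<bar>green' r (?k x) (?z x)\<bar> \<le> 3 * ?\<Lambda> * ?e" using lg2[OF that] by linarith
    qed simp
    also have "\<dots> = 3 / \<sigma> * ?e * L" using \<sigma> by (simp add: power2_eq_square)
    finally show ?thesis .
  qed
  have b2: "\<bar>G2 x\<bar> \<le> 6 / (\<sigma>\<^sup>2 * (r + 1)) * L" if "x \<noteq> \<mu>" for x
  proof -
    have "\<bar>G2 x\<bar> = 1 / \<sigma> ^ 3 * \<bar>green'' r (?k x) (?z x)\<bar>"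
      unfolding G2_def abs_mult abs_divide abs_svg_side using \<sigma> by simp
    also have "\<dots> \<le> 1 / \<sigma> ^ 3 * (3 * ?\<Lambda> * (2 / (r + 1)))"
    proof (intro mult_left_mono)
      have "3 * ?\<Lambda> * svgS (r + 1) (?z x) \<le> 3 * ?\<Lambda> * (2 / (r + 1))"
        using \<Lambda> pos[OF that] by (intro mult_left_mono svgS_le r1) auto
      then show "\<bar>green'' r (?k x) (?z x)\<bar> \<le> 3 * ?\<Lambda> * (2 / (r + 1))" using lg3[OF that] by linarith
    qed (use \<sigma> in simp)
    also have "\<dots> = 6 / (\<sigma>\<^sup>2 * (r + 1)) * L" using \<sigma> by (simp add: power2_eq_square power3_eq_cube)
    finally show ?thesis .
  qed
  have ev: "\<forall>\<^sub>F t in at \<mu>. t \<noteq> \<mu>" by (simp add: eventually_at_filter)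
  show "\<bar>D\<bar> \<le> 3 / \<sigma> * ?e * L" if "has_nth_deriv f 1 x D"
  proof (cases "x = \<mu>")
    case True
    have "(f has_real_derivative D) (at \<mu>)"
      using that True by (intro has_nth_deriv_1) (simp del: has_nth_deriv.simps)
    moreover have "\<forall>\<^sub>F t in at \<mu>. \<exists>D. (f has_real_derivative D) (at t) \<and> \<bar>D\<bar> \<le> 3 / \<sigma> * ?e * L"
      using ev by eventually_elim (use d1 b1 in blast)
    ultimately show ?thesis by (rule deriv_bound_punctured)
  qed (use n1[of x D] b1[of x] that in \<open>simp del: has_nth_deriv.simps\<close>)
  show "\<bar>D\<bar> \<le> 6 / (\<sigma>\<^sup>2 * (r + 1)) * L" if D: "has_nth_deriv f 2 x D"
  proof (cases "x = \<mu>")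
    case True
    \<comment> \<open>At the centre \<open>G1\<close> takes an arbitrary value, so it cannot replace
      the derivative of \<open>f\<close> there. The hidden first derivative \<open>u\<close> agrees
      with \<open>G1\<close> off the centre, which is enough for the punctured bound.\<close>
    obtain u where u: "\<forall>\<^sub>F t in nhds \<mu>. has_nth_deriv f (Suc 0) t (u t)" "(u has_real_derivative D) (at \<mu>)"
      using D True unfolding numeral_2_eq_2 has_nth_deriv.simps(2)[of f "Suc 0"] by blast
    obtain S where S: "open S" "\<mu> \<in> S" "\<And>t. t \<in> S \<Longrightarrow> has_nth_deriv f (Suc 0) t (u t)"
      using u(1) unfolding eventually_nhds by blast
    have ut: "(u has_real_derivative G2 t) (at t)" if t: "t \<in> S" "t \<noteq> \<mu>" for t
    proof -
      have "\<forall>\<^sub>F v in nhds t. v \<in> S - {\<mu>}" using S t by (intro eventually_nhds_in_open) auto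
      then have "\<forall>\<^sub>F v in nhds t. G1 v = u v"
      proof eventually_elim
        case (elim v)
        have "has_nth_deriv f 1 v (u v)" using S(3)[of v] elim by (simp del: has_nth_deriv.simps)
        with elim have "u v = G1 v" by (intro n1) auto
        then show ?case by (rule sym)
      qed
      then have "(G1 has_real_derivative G2 t) (at t) \<longleftrightarrow> (u has_real_derivative G2 t) (at t)"
        by (intro DERIV_cong_ev refl)
      with d2[of t] t show ?thesis by simp
    qed
    have "\<forall>\<^sub>F t in at \<mu>. t \<in> S" using S by (simp add: eventually_at_in_open')
    with ev have "\<forall>\<^sub>F t in at \<mu>. \<exists>D. (u has_real_derivative D) (at t) \<and> \<bar>D\<bar> \<le> 6 / (\<sigma>\<^sup>2 * (r + 1)) * L"
      by eventually_elim (use ut b2 in blast)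
    with u(2) show ?thesis by (rule deriv_bound_punctured)
  qed (use n2[of x D] b2[of x] D in \<open>simp del: has_nth_deriv.simps\<close>)
  show "\<bar>(x - \<mu>) * D\<bar> \<le> 3 * (1 + 1 / (2 * (r + 1))) * L" if D: "has_nth_deriv f 1 x D"
  proof (cases "x = \<mu>")
    case False
    note z = pos[OF False]
    have "\<bar>(x - \<mu>) * D\<bar> = 1 / \<sigma> * (?z x * \<bar>green' r (?k x) (?z x)\<bar>)"
      unfolding n1[OF False D] G1_def abs_mult absx using \<sigma> by (simp add: power2_eq_square)
    also have "\<dots> \<le> 1 / \<sigma> * (?z x * (3 * ?\<Lambda> * svgE 0 (r + 1) (?z x)))"
      using lg2[OF False] z \<sigma> by (intro mult_left_mono) auto
    also have "\<dots> = 3 * (?z x * svgE 0 (r + 1) (?z x)) * L" using \<sigma> by simp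
    also have "\<dots> \<le> 3 * (1 + 1 / (2 * (r + 1))) * L"
      using L0 by (intro mult_left_mono mult_right_mono svgE_weighted_le r1 z) auto
    finally show ?thesis .
  qed (use L0 r in simp)
  show "\<bar>(x - \<mu>) * D\<bar> \<le> 3 / \<sigma> * (1 + 1 / (2 * (r + 1))) * L" if D: "has_nth_deriv f 2 x D"
  proof (cases "x = \<mu>")
    case False
    note z = pos[OF False]
    have "\<bar>(x - \<mu>) * D\<bar> = 1 / \<sigma>\<^sup>2 * (?z x * \<bar>green'' r (?k x) (?z x)\<bar>)"
      unfolding n2[OF False D] G2_def abs_mult abs_divide abs_svg_side absx using \<sigma> by (simp add: power2_eq_square power3_eq_cube)
    also have "\<dots> \<le> 1 / \<sigma>\<^sup>2 * (?z x * (3 * ?\<Lambda> * svgS (r + 1) (?z x)))"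
      using lg3[OF False] z \<sigma> by (intro mult_left_mono) auto
    also have "\<dots> = 3 / \<sigma> * (?z x * svgS (r + 1) (?z x)) * L" using \<sigma> by (simp add: power2_eq_square)
    also have "\<dots> \<le> 3 / \<sigma> * (1 + 1 / (2 * (r + 1))) * L"
      using L0 \<sigma> by (intro mult_left_mono mult_right_mono svgS_le r1 z) auto
    finally show ?thesis .
  qed (use L0 r \<sigma> in simp)
  show "\<bar>(x - \<mu>) * D\<bar> \<le> 3 / \<sigma>\<^sup>2 * (4 + 1 / (2 * (r + 1))) * L" if D: "has_nth_deriv f 3 x D"
  proof (cases "x = \<mu>")
    case False
    note z = pos[OF False]
    define D' where "D' = svg_side \<mu> x * \<sigma> * D"
    have "((\<lambda>y. svg_side \<mu> x / \<sigma> ^ 3 * green'' r (?k x) y) has_real_derivative D') (at (?z x))"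
      using n3[OF False D] unfolding G2_def D'_def
        svg_scaled_deriv_iff[OF \<sigma> False, of "\<lambda>s y. s / \<sigma> ^ 3 * green'' r (svg_centred r \<sigma> \<mu> h s) y"] .
    from DERIV_cmult[OF this, of "svg_side \<mu> x * \<sigma> ^ 3"]
    have "(green'' r (?k x) has_real_derivative svg_side \<mu> x * \<sigma> ^ 3 * D') (at (?z x))"
      using \<sigma> svg_side[of \<mu> x] by auto
    from lg4[OF False this] have b: "\<bar>?z x * (svg_side \<mu> x * \<sigma> ^ 3 * D')\<bar> \<le> 3 * ?\<Lambda> * (4 + 1 / (2 * (r + 1)))" .
    have "\<bar>(x - \<mu>) * D\<bar> = 1 / \<sigma> ^ 3 * \<bar>?z x * (svg_side \<mu> x * \<sigma> ^ 3 * D')\<bar>"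
      unfolding D'_def abs_mult absx abs_svg_side using \<sigma> z by simp
    also have "\<dots> \<le> 1 / \<sigma> ^ 3 * (3 * ?\<Lambda> * (4 + 1 / (2 * (r + 1))))" using b \<sigma> by (intro mult_left_mono) auto
    also have "\<dots> = 3 / \<sigma>\<^sup>2 * (4 + 1 / (2 * (r + 1))) * L" using \<sigma> by (simp add: power2_eq_square power3_eq_cube)
    finally show ?thesis .
  qed (use L0 r \<sigma> in simp)
qed

theorem theorem3p1:
  fixes r \<sigma> \<mu> L :: real and h :: "real \<Rightarrow> real"
  assumes r: "r > 0" and \<sigma>: "\<sigma> > 0"
    and int: "integrable lborel (\<lambda>x. svg_pdf r \<sigma> \<mu> x * h x)"
  defines "f \<equiv> svg_stein_sol r \<sigma> \<mu> h"
    and "nh \<equiv> (SUP x. \<bar>h x - svg_expect r \<sigma> \<mu> h\<bar>)"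
  shows
   "(bounded (range h) \<and> h \<in> borel_measurable borel \<longrightarrow>
       (\<forall>x. \<bar>(x - \<mu>) * f x\<bar> \<le> (3 / 2 + 1 / (2 * r)) * nh)
     \<and> (\<forall>x D. has_nth_deriv f 1 x D \<longrightarrow> \<bar>(x - \<mu>) * D\<bar> \<le> 1 / \<sigma> * (1 + 1 / (2 * r)) * nh)
     \<and> (\<forall>x D. has_nth_deriv f 2 x D \<longrightarrow> \<bar>(x - \<mu>) * D\<bar> \<le> 1 / (2 * \<sigma>\<^sup>2) * (9 + 1 / r) * nh))
  \<and> (lipschitz_on L UNIV h \<longrightarrow>
       (\<forall>x. \<bar>f x\<bar> \<le> 7 / 2 * L)
     \<and> (\<forall>x D. has_nth_deriv f 1 x D \<longrightarrow>
          \<bar>D\<bar> \<le> 9 / (2 * \<sigma>) * (1 / (r + 1) + pi * Gamma ((r + 1) / 2) / (2 * Gamma (r / 2 + 1))) * L)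
     \<and> (\<forall>x D. has_nth_deriv f 2 x D \<longrightarrow> \<bar>D\<bar> \<le> 9 / (\<sigma>\<^sup>2 * (r + 1)) * L)
     \<and> (\<forall>x D. has_nth_deriv f 1 x D \<longrightarrow> \<bar>(x - \<mu>) * D\<bar> \<le> 9 / 2 * (3 / 2 + 1 / (2 * (r + 1))) * L)
     \<and> (\<forall>x D. has_nth_deriv f 2 x D \<longrightarrow> \<bar>(x - \<mu>) * D\<bar> \<le> 9 / (2 * \<sigma>) * (1 + 1 / (2 * (r + 1))) * L)
     \<and> (\<forall>x D. has_nth_deriv f 3 x D \<longrightarrow> \<bar>(x - \<mu>) * D\<bar> \<le> 9 / (4 * \<sigma>\<^sup>2) * (9 + 1 / (r + 1)) * L))"
proof (intro conjI impI allI)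
  {
    assume "bounded (range h) \<and> h \<in> borel_measurable borel"
    then have bh: "bounded (range h)" and mh: "h \<in> borel_measurable borel" by auto
    obtain C where C: "\<And>x. \<bar>h x\<bar> \<le> C" using bh unfolding bounded_iff by auto
    \<comment> \<open>A real \<open>SUP\<close> is an upper bound only for a family bounded
      above.\<close>
    have bdd: "bdd_above (range (\<lambda>x. \<bar>h x - svg_expect r \<sigma> \<mu> h\<bar>))"
    proof (rule bdd_aboveI2)
      show "\<bar>h x - svg_expect r \<sigma> \<mu> h\<bar> \<le> C + \<bar>svg_expect r \<sigma> \<mu> h\<bar>" for x using C[of x] by linarith
    qed
    have nh: "\<bar>h x - svg_expect r \<sigma> \<mu> h\<bar> \<le> nh" for x unfolding nh_def by (rule cSUP_upper[OF UNIV_I bdd])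
    have nh0: "nh \<ge> 0" using nh[of 0] by linarith
    note b = svg_stein_bounded[OF r \<sigma> mh nh, folded f_def]
    show "\<bar>(x - \<mu>) * f x\<bar> \<le> (3 / 2 + 1 / (2 * r)) * nh" for x
      by (rule order_trans[OF b(1) mult_right_mono[OF _ nh0]]) simp
    show "\<bar>(x - \<mu>) * D\<bar> \<le> 1 / \<sigma> * (1 + 1 / (2 * r)) * nh" if "has_nth_deriv f 1 x D" for x D
      by (rule b(2)[OF that])
    show "\<bar>(x - \<mu>) * D\<bar> \<le> 1 / (2 * \<sigma>\<^sup>2) * (9 + 1 / r) * nh" if "has_nth_deriv f 2 x D" for x D
    proof (rule order_trans[OF b(3)[OF that] mult_right_mono[OF _ nh0]])
      have "1 / \<sigma>\<^sup>2 * (4 + 1 / (2 * r)) \<le> 1 / \<sigma>\<^sup>2 * ((9 + 1 / r) / 2)"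
        using r by (intro mult_left_mono) (auto simp: field_simps)
      then show "1 / \<sigma>\<^sup>2 * (4 + 1 / (2 * r)) \<le> 1 / (2 * \<sigma>\<^sup>2) * (9 + 1 / r)" by (simp add: mult.commute)
    qed
  }
  {
    assume lip: "L-lipschitz_on UNIV h"
    have L0: "L \<ge> 0" using lip by (rule lipschitz_on_nonneg)
    have q: "0 \<le> 1 / (2 * (r + 1))" using r by simp
    have le: "3 * (1 + q) \<le> 9 / 2 * (3 / 2 + q)" if "0 \<le> q" for q :: real using that by (simp add: field_simps)
    note b = svg_stein_lipschitz[OF r \<sigma> lip, of \<mu>, folded f_def]
    show "\<bar>f x\<bar> \<le> 7 / 2 * L" for x
      by (rule order_trans[OF b(1) mult_right_mono[OF _ L0]]) simp
    show "\<bar>D\<bar> \<le> 9 / (2 * \<sigma>) * (1 / (r + 1) + pi * Gamma ((r + 1) / 2) / (2 * Gamma (r / 2 + 1))) * L"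
      if "has_nth_deriv f 1 x D" for x D
    proof (rule order_trans[OF b(2)[OF that] mult_right_mono[OF _ L0]])
      let ?g = "Gamma ((r + 1) / 2) / (2 * Gamma (r / 2 + 1))"
      have g: "?g > 0" using r by (intro divide_pos_pos mult_pos_pos Gamma_real_pos) (auto intro: add_pos_pos)
      have a: "1 / 2 + (r + 1) / 2 = r / 2 + 1" by (simp add: field_simps)
      have r1: "r + 1 > 0" using r by simp
      \<comment> \<open>Half the Beta value at 1/2 and \<open>(r + 1) / 2\<close> contains
        \<open>sqrt pi\<close>, from the Gamma value at 1/2, where the stated bound has
        \<open>pi\<close>.\<close>
      have "svgE 0 (r + 1) 0 = sqrt pi * ?g" unfolding svgE_0[OF r1] Beta_def a by (simp add: Gamma_one_half_real)
      also have "\<dots> \<le> pi * ?g"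
      proof (intro mult_right_mono)
        have "1 \<le> sqrt pi" using pi_gt3 by simp
        then have "sqrt pi * 1 \<le> sqrt pi * sqrt pi" by (intro mult_left_mono) auto
        then show "sqrt pi \<le> pi" by simp
      qed (use g in simp)
      also have "\<dots> \<le> 1 / (r + 1) + pi * ?g" using r by simp
      finally have "svgE 0 (r + 1) 0 \<le> 1 / (r + 1) + pi * Gamma ((r + 1) / 2) / (2 * Gamma (r / 2 + 1))" by simp
      then show "3 / \<sigma> * svgE 0 (r + 1) 0 \<le> 9 / (2 * \<sigma>) * (1 / (r + 1) + pi * Gamma ((r + 1) / 2) / (2 * Gamma (r / 2 + 1)))"
        using \<sigma> svgE_0_pos[OF r1] by (intro mult_mono) (auto simp: field_simps)
    qed
    show "\<bar>D\<bar> \<le> 9 / (\<sigma>\<^sup>2 * (r + 1)) * L" if "has_nth_deriv f 2 x D" for x D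
      by (rule order_trans[OF b(3)[OF that] mult_right_mono[OF _ L0]]) (use r in \<open>auto intro!: divide_right_mono\<close>)
    show "\<bar>(x - \<mu>) * D\<bar> \<le> 9 / 2 * (3 / 2 + 1 / (2 * (r + 1))) * L" if "has_nth_deriv f 1 x D" for x D
      by (rule order_trans[OF b(4)[OF that] mult_right_mono[OF _ L0]]) (use q in \<open>rule le\<close>)
    show "\<bar>(x - \<mu>) * D\<bar> \<le> 9 / (2 * \<sigma>) * (1 + 1 / (2 * (r + 1))) * L" if "has_nth_deriv f 2 x D" for x D
    proof (rule order_trans[OF b(5)[OF that] mult_right_mono[OF _ L0]])
      have "3 / \<sigma> \<le> 9 / (2 * \<sigma>)" using \<sigma> by (simp add: field_simps)
      then show "3 / \<sigma> * (1 + 1 / (2 * (r + 1))) \<le> 9 / (2 * \<sigma>) * (1 + 1 / (2 * (r + 1)))"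
        using r by (intro mult_right_mono) auto
    qed
    show "\<bar>(x - \<mu>) * D\<bar> \<le> 9 / (4 * \<sigma>\<^sup>2) * (9 + 1 / (r + 1)) * L" if "has_nth_deriv f 3 x D" for x D
    proof (rule order_trans[OF b(6)[OF that] mult_right_mono[OF _ L0]])
      have "1 / \<sigma>\<^sup>2 * (3 * (4 + 1 / (2 * (r + 1)))) \<le> 1 / \<sigma>\<^sup>2 * (9 / 4 * (9 + 1 / (r + 1)))"
        using r by (intro mult_left_mono) (auto simp: field_simps)
      then show "3 / \<sigma>\<^sup>2 * (4 + 1 / (2 * (r + 1))) \<le> 9 / (4 * \<sigma>\<^sup>2) * (9 + 1 / (r + 1))" by (simp add: mult.commute)
    qed
  }
qed

end
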